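(* Let $\mathcal{P} \subset \mathbb{R}^2$ be any parallelogram with side lengths $\ell_1, \ell_2$, labelled so that $\ell_1 \leq \ell_2$, with area $|\mathcal{P}|$ and one angle $\varphi$. Define $$\lambda_\pm = \frac{\pi^2}{2 |\mathcal{P}|^2} \left( \ell_1^2 + \ell_2^2 \pm \sqrt{\big(\ell_1^2 - \ell_2^2 \big)^2 + \frac{256}{\pi^4} \ell_1^2 \ell_2^2 \cos^2 \varphi} \right)$$ and $$\eta_\pm = \frac{6}{|\mathcal{P}|^2} \left( \ell_1^2 + \ell_2^2 \pm \sqrt{\big(\ell_1^2 - \ell_2^2 \big)^2 + 4 \ell_1^2 \ell_2^2 \cos^2 \varphi} \right).$$ Then $$\text{(i)}\quad \mu_2 (\mathcal{P}) \leq \min \{\lambda_-, \eta_-\}$$ and $$\text{(ii)}\quad \mu_3 (\mathcal{P}) \leq \lambda_+ .$$ In particular, $$\text{(iii)}\quad \frac{\mu_2 (\mathcal{P}) + \mu_3 (\mathcal{P})}{2} \leq \frac{\pi^2}{|\mathcal{P}|^2} \frac{\ell_1^2 + \ell_2^2}{2}.$$ Equality holds in (i) if and only if $\mathcal{P}$ is a rectangle, in which case $\mu_2 (\mathcal{P})=\lambda_-=\frac{\pi^2}{\ell_2^2}$. Equality holds in (ii) if and only if $\mathcal{P}$ is a rectangle and $\ell_2 \le 2 \ell_1$; likewise, equality holds in (iii) if and only if $\mathcal{P}$ is a rectangle and $\ell_2 \le 2 \ell_1$. In this case, $$\mu_2(\mathcal{P})=\lambda_-=\frac{\pi^2}{\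ell_2^2}\quad\text{and}\quad\mu_3(\mathcal{P})=\lambda_+=\frac{\pi^2}{\ell_1^2}.$$
   Context: A parallelogram is understood as a (non-degenerate) open bounded planar domain. For a bounded, connected Lipschitz domain $\Omega\subset\mathbb{R}^2$, $0=\mu_1(\Omega)<\mu_2(\Omega)\le\mu_3(\Omega)\le\dots$ denote the eigenvalues, counted with multiplicities, of the Neumann Laplacian on $\Omega$, that is, of the self-adjoint operator in $L^2(\Omega)$ associated with the quadratic form $u\mapsto\int_\Omega|\nabla u|^2$ with domain $H^1(\Omega)$. *)

theory Defs
  imports "HOL-Analysis.Analysis" "HOL-Library.Extended_Nat"
begin

subsection \<open>Test functions, weak gradients and \<open>H\<^sup>1\<close>\<close>

primrec Ck :: "nat \<Rightarrow> ('a::euclidean_space \<Rightarrow> real) \<Rightarrow> bool" where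
  "Ck 0 f \<longleftrightarrow> continuous_on UNIV f"
| "Ck (Suc k) f \<longleftrightarrow> (\<forall>x. f differentiable (at x)) \<and>
     (\<forall>b\<in>Basis. Ck k (\<lambda>x. frechet_derivative f (at x) b))"

text \<open>Elements of \<open>C\<^sub>c\<^sup>\<infinity>(\<Omega>)\<close>, extended by zero to the whole space.\<close>

definition test_function :: "'a::euclidean_space set \<Rightarrow> ('a \<Rightarrow> real) \<Rightarrow> bool" where
  "test_function \<Omega> \<phi> \<longleftrightarrow> (\<forall>k. Ck k \<phi>) \<and>
     compact (closure {x. \<phi> x \<noteq> 0}) \<and> closure {x. \<phi> x \<noteq> 0} \<subseteq> \<Omega>"

text \<open>Elements of \<open>L\<^sup>2(\<Omega>)\<close> are represented by functions on the whole space. Their values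
  outside \<open>\<Omega>\<close> and on null sets are irrelevant; passing to almost-everywhere classes matters only
  for linear independence below.\<close>

definition L2 :: "'a::euclidean_space set \<Rightarrow> ('a \<Rightarrow> real) set" where
  "L2 \<Omega> = {u \<in> borel_measurable (lebesgue_on \<Omega>). integrable (lebesgue_on \<Omega>) (\<lambda>x. (u x)\<^sup>2)}"

definition L2_independent :: "'a::euclidean_space set \<Rightarrow> nat \<Rightarrow> (nat \<Rightarrow> 'a \<Rightarrow> real) \<Rightarrow> bool" where
  "L2_independent \<Omega> n u \<longleftrightarrow>
     (\<forall>c. (AE x in lebesgue_on \<Omega>. (\<Sum>i<n. c i * u i x) = 0) \<longrightarrow> (\<forall>i<n. c i = 0))"

definition has_weak_gradient ::
  "'a::euclidean_space set \<Rightarrow> ('a \<Rightarrow> real) \<Rightarrow> ('a \<Rightarrow> 'a) \<Rightarrow> bool" where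
  "has_weak_gradient \<Omega> u g \<longleftrightarrow>
     (\<forall>b\<in>Basis. (\<lambda>x. g x \<bullet> b) \<in> L2 \<Omega> \<and>
       (\<forall>\<phi>. test_function \<Omega> \<phi> \<longrightarrow>
          (LINT x|lebesgue_on \<Omega>. u x * frechet_derivative \<phi> (at x) b) =
          - (LINT x|lebesgue_on \<Omega>. (g x \<bullet> b) * \<phi> x)))"

definition H1 :: "'a::euclidean_space set \<Rightarrow> ('a \<Rightarrow> real) set" where
  "H1 \<Omega> = {u \<in> L2 \<Omega>. \<exists>g. has_weak_gradient \<Omega> u g}"

text \<open>For open \<open>\<Omega>\<close> the weak gradient is unique up to null sets, so that the choice of
  representative does not affect the integrals below.\<close>

definition weak_gradient :: "'a::euclidean_space set \<Rightarrow> ('a \<Rightarrow> real) \<Rightarrow> 'a \<Rightarrow> 'a" where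
  "weak_gradient \<Omega> u = (SOME g. has_weak_gradient \<Omega> u g)"

subsection \<open>The Neumann Laplacian and its eigenvalues\<close>

definition dirichlet_form ::
  "'a::euclidean_space set \<Rightarrow> ('a \<Rightarrow> real) \<Rightarrow> ('a \<Rightarrow> real) \<Rightarrow> real" where
  "dirichlet_form \<Omega> u v = (LINT x|lebesgue_on \<Omega>. weak_gradient \<Omega> u x \<bullet> weak_gradient \<Omega> v x)"

text \<open>The graph of the self-adjoint operator associated with the form: \<open>u\<close> belongs to the operator
  domain, and is mapped to \<open>f\<close>, iff the form of \<open>u\<close> against any \<open>v\<close> in the form domain is the
  inner product of \<open>f\<close> and \<open>v\<close>.\<close>

definition neumann_laplacian ::
  "'a::euclidean_space set \<Rightarrow> ('a \<Rightarrow> real) \<Rightarrow> ('a \<Rightarrow> real) \<Rightarrow> bool" where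
  "neumann_laplacian \<Omega> u f \<longleftrightarrow> u \<in> H1 \<Omega> \<and> f \<in> L2 \<Omega> \<and>
     (\<forall>v\<in>H1 \<Omega>. dirichlet_form \<Omega> u v = (LINT x|lebesgue_on \<Omega>. f x * v x))"

definition neumann_eigenspace :: "'a::euclidean_space set \<Rightarrow> real \<Rightarrow> ('a \<Rightarrow> real) set" where
  "neumann_eigenspace \<Omega> t = {u. neumann_laplacian \<Omega> u (\<lambda>x. t * u x)}"

text \<open>The dimension of the eigenspace in \<open>L\<^sup>2(\<Omega>)\<close>; it is 0 iff \<open>t\<close> is not an eigenvalue.\<close>

definition neumann_multiplicity :: "'a::euclidean_space set \<Rightarrow> real \<Rightarrow> enat" where
  "neumann_multiplicity \<Omega> t =
     (SUP n\<in>{n. \<exists>u. (\<forall>i<n. u i \<in> neumann_eigenspace \<Omega> t) \<and> L2_independent \<Omega> n u}. enat n)"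

text \<open>The number of eigenvalues not exceeding \<open>t\<close>, counted with multiplicities. A sum of extended
  natural numbers over any index set exists.\<close>

definition neumann_count :: "'a::euclidean_space set \<Rightarrow> real \<Rightarrow> enat" where
  "neumann_count \<Omega> t = (\<Sum>\<^sub>\<infinity>s\<in>{..t}. neumann_multiplicity \<Omega> s)"

text \<open>The \<open>k\<close>-th eigenvalue in nondecreasing order, counted with multiplicities and numbered from
  \<open>k = 1\<close>.\<close>

definition neumann_mu :: "'a::euclidean_space set \<Rightarrow> nat \<Rightarrow> real" where
  "neumann_mu \<Omega> k = Inf {t. enat k \<le> neumann_count \<Omega> t}"

subsection \<open>Parallelograms\<close>

definition open_parallelogram :: "real^2 \<Rightarrow> real^2 \<Rightarrow> real^2 \<Rightarrow> (real^2) set" where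
  "open_parallelogram p a b = {p + s *\<^sub>R a + t *\<^sub>R b | s t. 0 < s \<and> s < 1 \<and> 0 < t \<and> t < 1}"

definition is_rectangle :: "(real^2) set \<Rightarrow> bool" where
  "is_rectangle P \<longleftrightarrow>
     (\<exists>p a b. a \<noteq> 0 \<and> b \<noteq> 0 \<and> orthogonal a b \<and> P = open_parallelogram p a b)"

definition angle_between :: "real^2 \<Rightarrow> real^2 \<Rightarrow> real" where
  "angle_between a b = arccos ((a \<bullet> b) / (norm a * norm b))"

definition lambda_minus :: "real \<Rightarrow> real \<Rightarrow> real \<Rightarrow> real \<Rightarrow> real" where
  "lambda_minus A l1 l2 \<phi> = pi\<^sup>2 / (2 * A\<^sup>2) *
     (l1\<^sup>2 + l2\<^sup>2 - sqrt ((l1\<^sup>2 - l2\<^sup>2)\<^sup>2 + 256 / pi ^ 4 * l1\<^sup>2 * l2\<^sup>2 * (cos \<phi>)\<^sup>2))"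

definition lambda_plus :: "real \<Rightarrow> real \<Rightarrow> real \<Rightarrow> real \<Rightarrow> real" where
  "lambda_plus A l1 l2 \<phi> = pi\<^sup>2 / (2 * A\<^sup>2) *
     (l1\<^sup>2 + l2\<^sup>2 + sqrt ((l1\<^sup>2 - l2\<^sup>2)\<^sup>2 + 256 / pi ^ 4 * l1\<^sup>2 * l2\<^sup>2 * (cos \<phi>)\<^sup>2))"

definition eta_minus :: "real \<Rightarrow> real \<Rightarrow> real \<Rightarrow> real \<Rightarrow> real" where
  "eta_minus A l1 l2 \<phi> = 6 / A\<^sup>2 *
     (l1\<^sup>2 + l2\<^sup>2 - sqrt ((l1\<^sup>2 - l2\<^sup>2)\<^sup>2 + 4 * l1\<^sup>2 * l2\<^sup>2 * (cos \<phi>)\<^sup>2))"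

end

theory Submission
  imports Defs "HOL-Library.Function_Algebras"
begin

text \<open>
  In the coordinates \<open>s, t\<close> of \<open>p + s a + t b\<close>, the parallelogram is the unit square and the gradient
  of \<open>f(s)\<close> is \<open>f'(s) \<alpha>\<close>, where \<open>\<alpha>, \<beta>\<close> is the basis dual to \<open>a, b\<close>. Expansion in
  \<open>cos(j\<pi>s) cos(k\<pi>t)\<close> gives a Rellich inequality, so that successive minimizers of the Rayleigh
  quotient exist, are eigenfunctions, and produce exactly the numbers \<open>\<mu>\<^sub>k\<close>. The bounds follow from
  the min-max principle with the trial spaces spanned by \<open>1, f(s), f(t)\<close>, where \<open>f = cos(\<pi>\<cdot>)\<close> for
  \<open>\<lambda>\<^sub>\<plusminus>\<close> and \<open>f(s) = s - 1/2\<close> for \<open>\<eta>\<^sub>-\<close>. If a bound is attained, some trial function is an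
  eigenfunction. Testing its equation against \<open>cos(3\<pi>s)\<close> and \<open>cos(3\<pi>t)\<close> forces \<open>a \<bottom> b\<close> in the cosine
  case, while \<open>sin(2\<pi>s)\<close> and \<open>sin(2\<pi>t)\<close> rule out the linear case.
\<close>

subsection \<open>Positive semidefinite forms\<close>

text \<open>Two obstacles shape the development. The numbers \<mu> are infima over a function that
  sums multiplicities over all reals. The whole spectrum is never determined: the minimality clause
  carried by finitely many eigenvectors controls every multiplicity below the last value. Moreover,
  an element of H^1 comes without boundary values to integrate by parts with. The products sin(j pi
  s) cos(k pi t) vanish on the two sides that \<open>a\<close> crosses, so testing the weak gradient
  along \<open>a\<close> with them returns the cosine coefficients of the function, and Bessel's
  inequality for the gradient takes the place of trace and regularity theory. For rectangles the
  same inequality is sharp and yields the lower bounds. The off-diagonal factor of the cosine trial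
  matrix is (integral of f')^2 / (integral of f^2) = 4 / (1/2) = 8, against pi^2 on the diagonal,
  whence 256 / pi^4 = 4 (8 / pi^2)^2; for the linear profile both factors are 12.\<close>

lemma homogeneous_system_nontrivial:
  fixes A :: "'i \<Rightarrow> 'j \<Rightarrow> real"
  assumes "finite J" "finite I" "card J < card I"
  shows "\<exists>c. (\<exists>i\<in>I. c i \<noteq> 0) \<and> (\<forall>j\<in>J. (\<Sum>i\<in>I. c i * A i j) = 0)"
  using assms
proof (induction J arbitrary: I A rule: finite_induct)
  case empty
  then obtain i where "i \<in> I" by fastforce
  then show ?case by (intro exI[of _ "\<lambda>_. 1"]) auto
next
  case (insert j J)
  show ?case
  proof (cases "\<forall>i\<in>I. A i j = 0")
    case True
    obtain c where c: "\<exists>i\<in>I. c i \<noteq> 0" "\<forall>j\<in>J. (\<Sum>i\<in>I. c i * A i j) = 0"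
      using insert.IH[of I A] insert.prems insert.hyps by auto
    then show ?thesis using True by (intro exI[of _ c]) auto
  next
    case False
    then obtain k where k: "k \<in> I" "A k j \<noteq> 0" by auto
    \<comment> \<open>Gaussian elimination: equation \<open>j\<close> is solved for the unknown
      \<open>k\<close>, and \<open>?A\<close> is the matrix of the other equations after
      substitution.\<close>
    let ?I = "I - {k}" and ?A = "\<lambda>i l. A i l - A i j / A k j * A k l"
    have "card J < card ?I" using insert.prems insert.hyps k by simp
    then obtain c where c: "\<exists>i\<in>?I. c i \<noteq> 0" "\<forall>l\<in>J. (\<Sum>i\<in>?I. c i * ?A i l) = 0"
      using insert.IH[of ?I ?A] insert.prems by auto
    define e where "e = (\<lambda>i. if i = k then - (\<Sum>i\<in>?I. c i * A i j / A k j) else c i)"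
    have s: "(\<Sum>i\<in>I. e i * A i l) = (\<Sum>i\<in>?I. c i * ?A i l)" for l
    proof -
      have "(\<Sum>i\<in>I. e i * A i l) = e k * A k l + (\<Sum>i\<in>?I. e i * A i l)"
        using k insert.prems by (simp add: sum.remove)
      also have "(\<Sum>i\<in>?I. e i * A i l) = (\<Sum>i\<in>?I. c i * A i l)"
        by (rule sum.cong) (auto simp: e_def)
      also have "e k * A k l = - (\<Sum>i\<in>?I. c i * (A i j / A k j * A k l))"
        by (simp add: e_def sum_distrib_right mult.assoc)
      finally show ?thesis by (simp add: right_diff_distrib sum_subtractf)
    qed
    have "(\<Sum>i\<in>I. e i * A i j) = 0" unfolding s using k by simp
    moreover have "\<exists>i\<in>I. e i \<noteq> 0" using c by (auto simp: e_def)
    ultimately show ?thesis using c s by (intro exI[of _ e]) auto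
  qed
qed

text \<open>The first-order condition at a minimum, in the form used for variations: for small
  \<open>t\<close> the linear term decides the sign.\<close>

lemma linear_coefficient_zero:
  fixes b c :: real
  assumes "\<And>t. 0 \<le> 2 * t * b + t\<^sup>2 * c"
  shows "b = 0"
proof (rule ccontr)
  assume b: "b \<noteq> 0"
  \<comment> \<open>Every positive \<open>k\<close> with \<open>c < 2 * k\<close> makes the value at
    \<open>- b / k\<close> negative; this one serves for either sign of \<open>c\<close>.\<close>
  define k where "k = \<bar>c\<bar> + 1"
  have k: "k > 0" "c < 2 * k" by (auto simp: k_def)
  define t where "t = - b / k"
  have tk: "t * k = - b" using k by (simp add: t_def)
  have "k\<^sup>2 * (2 * t * b + t\<^sup>2 * c) = 2 * k * b * (t * k) + (t * k)\<^sup>2 * c"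
    by (simp add: power2_eq_square algebra_simps)
  also have "\<dots> = b\<^sup>2 * (c - 2 * k)" unfolding tk by (simp add: power2_eq_square algebra_simps)
  also have "\<dots> < 0" using b k by (intro mult_pos_neg) auto
  finally show False using assms[of t] k by (simp add: mult_less_0_iff)
qed

text \<open>Only semidefinite: functions are not identified almost everywhere, and the Dirichlet
  form vanishes on constants. The Hilbert space arguments are therefore run on seminorms.\<close>

locale psd_form =
  fixes S :: "'v::real_vector set" and q :: "'v \<Rightarrow> 'v \<Rightarrow> real"
  assumes subspace: "subspace S"
    and sym: "\<lbrakk>u \<in> S; v \<in> S\<rbrakk> \<Longrightarrow> q u v = q v u"
    and add_left: "\<lbrakk>u \<in> S; v \<in> S; w \<in> S\<rbrakk> \<Longrightarrow> q (u + v) w = q u w + q v w"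
    and scale_left: "\<lbrakk>u \<in> S; v \<in> S\<rbrakk> \<Longrightarrow> q (c *\<^sub>R u) v = c * q u v"
    and nonneg: "u \<in> S \<Longrightarrow> 0 \<le> q u u"
begin

lemma closed [intro, simp]:
  "0 \<in> S" "\<lbrakk>u \<in> S; v \<in> S\<rbrakk> \<Longrightarrow> u + v \<in> S" "u \<in> S \<Longrightarrow> c *\<^sub>R u \<in> S"
  "\<lbrakk>u \<in> S; v \<in> S\<rbrakk> \<Longrightarrow> u - v \<in> S" "u \<in> S \<Longrightarrow> - u \<in> S"
  using subspace by (auto simp: subspace_def subspace_diff subspace_neg)

lemma closed_sum [intro, simp]: "(\<And>i. i \<in> I \<Longrightarrow> f i \<in> S) \<Longrightarrow> sum f I \<in> S"
  using subspace by (rule subspace_sum)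

lemma add_right: "\<lbrakk>u \<in> S; v \<in> S; w \<in> S\<rbrakk> \<Longrightarrow> q w (u + v) = q w u + q w v"
  using add_left[of u v w] sym[of w] by auto

lemma scale_right: "\<lbrakk>u \<in> S; v \<in> S\<rbrakk> \<Longrightarrow> q v (c *\<^sub>R u) = c * q v u"
  using scale_left[of u v c] sym[of v] by auto

lemma minus_left: "\<lbrakk>u \<in> S; v \<in> S\<rbrakk> \<Longrightarrow> q (- u) v = - q u v"
  using scale_left[of u v "-1"] by simp

lemma minus_right: "\<lbrakk>u \<in> S; v \<in> S\<rbrakk> \<Longrightarrow> q v (- u) = - q v u"
  using scale_right[of u v "-1"] by simp

lemma diff_left: "\<lbrakk>u \<in> S; v \<in> S; w \<in> S\<rbrakk> \<Longrightarrow> q (u - v) w = q u w - q v w"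
  using add_left[of u "- v" w] by (simp add: minus_left)

lemma diff_right: "\<lbrakk>u \<in> S; v \<in> S; w \<in> S\<rbrakk> \<Longrightarrow> q w (u - v) = q w u - q w v"
  using add_right[of u "- v" w] by (simp add: minus_right)

lemma zero_left [simp]: "u \<in> S \<Longrightarrow> q 0 u = 0"
  using scale_left[of 0 u 0] by simp

lemma zero_right [simp]: "u \<in> S \<Longrightarrow> q u 0 = 0"
  using scale_right[of 0 u 0] by simp

lemmas expand = add_left add_right scale_left scale_right diff_left diff_right minus_left minus_right

lemma sum_left:
  "\<lbrakk>\<And>i. i \<in> I \<Longrightarrow> f i \<in> S; v \<in> S\<rbrakk> \<Longrightarrow> q (\<Sum>i\<in>I. c i *\<^sub>R f i) v = (\<Sum>i\<in>I. c i * q (f i) v)"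
  by (induction I rule: infinite_finite_induct) (auto simp: expand)

lemma sum_right:
  "\<lbrakk>\<And>i. i \<in> I \<Longrightarrow> f i \<in> S; v \<in> S\<rbrakk> \<Longrightarrow> q v (\<Sum>i\<in>I. c i *\<^sub>R f i) = (\<Sum>i\<in>I. c i * q v (f i))"
  by (induction I rule: infinite_finite_induct) (auto simp: expand)

lemma square_add:
  "\<lbrakk>u \<in> S; v \<in> S\<rbrakk> \<Longrightarrow> q (u + v) (u + v) = q u u + 2 * q u v + q v v"
  by (simp add: expand sym[of v u])

lemma square_diff:
  "\<lbrakk>u \<in> S; v \<in> S\<rbrakk> \<Longrightarrow> q (u - v) (u - v) = q u u - 2 * q u v + q v v"
  by (simp add: expand sym[of v u])

lemma square_scale: "u \<in> S \<Longrightarrow> q (c *\<^sub>R u) (c *\<^sub>R u) = c\<^sup>2 * q u u"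
  by (simp add: expand power2_eq_square)

lemma square_diff_le: "\<lbrakk>u \<in> S; v \<in> S\<rbrakk> \<Longrightarrow> q (u - v) (u - v) \<le> 2 * q u u + 2 * q v v"
  using nonneg[of "u + v"] by (simp add: square_add square_diff)

lemma square_diff_swap: "\<lbrakk>u \<in> S; v \<in> S\<rbrakk> \<Longrightarrow> q (u - v) (u - v) = q (v - u) (v - u)"
  by (simp add: square_diff sym[of u v])

lemma Cauchy_Schwarz:
  assumes "u \<in> S" "v \<in> S"
  shows "(q u v)\<^sup>2 \<le> q u u * q v v"
proof (cases "q v v = 0")
  case True
  \<comment> \<open>Division by \<open>q v v\<close> is impossible here; instead, nonnegativity of
    the square of \<open>v + s u\<close> for all \<open>s\<close> leaves no linear term.\<close>
  have "q v u = 0"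
  proof (rule linear_coefficient_zero)
    fix s
    have "0 \<le> q (v + s *\<^sub>R u) (v + s *\<^sub>R u)" using assms by (intro nonneg) auto
    then show "0 \<le> 2 * s * q v u + s\<^sup>2 * q u u"
      using assms True by (simp add: square_add scale_left scale_right power2_eq_square mult.assoc)
  qed
  then show ?thesis using assms True sym by simp
next
  case False
  then have p: "q v v > 0" using nonneg[of v] assms by simp
  have "0 \<le> q (q v v *\<^sub>R u - q u v *\<^sub>R v) (q v v *\<^sub>R u - q u v *\<^sub>R v)"
    using assms by (intro nonneg) auto
  also have "\<dots> = q v v * (q u u * q v v - (q u v)\<^sup>2)"
    using assms by (simp add: square_diff scale_left scale_right sym[of v u])
      (simp add: power2_eq_square algebra_simps)
  finally show ?thesis using p by (simp add: zero_le_mult_iff)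
qed

lemma square_orthogonal_sum:
  assumes "finite I" "\<And>i. i \<in> I \<Longrightarrow> f i \<in> S"
    and "\<And>i j. \<lbrakk>i \<in> I; j \<in> I; i \<noteq> j\<rbrakk> \<Longrightarrow> q (f i) (f j) = 0"
  shows "q (\<Sum>i\<in>I. c i *\<^sub>R f i) (\<Sum>i\<in>I. c i *\<^sub>R f i) = (\<Sum>i\<in>I. (c i)\<^sup>2 * q (f i) (f i))"
proof -
  have "q (\<Sum>i\<in>I. c i *\<^sub>R f i) (\<Sum>i\<in>I. c i *\<^sub>R f i) = (\<Sum>i\<in>I. c i * (\<Sum>j\<in>I. c j * q (f i) (f j)))"
    using assms by (subst sum_left) (auto simp: sum_right)
  also have "\<dots> = (\<Sum>i\<in>I. c i * (c i * q (f i) (f i)))"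
  proof (rule sum.cong[OF refl])
    fix i assume i: "i \<in> I"
    have "(\<Sum>j\<in>I. c j * q (f i) (f j)) = (\<Sum>j\<in>I. if j = i then c i * q (f i) (f i) else 0)"
      using assms i by (intro sum.cong) auto
    then show "c i * (\<Sum>j\<in>I. c j * q (f i) (f j)) = c i * (c i * q (f i) (f i))"
      using assms i by simp
  qed
  finally show ?thesis by (simp add: power2_eq_square mult.assoc)
qed

text \<open>Pythagoras for the orthogonal projection onto the span of the \<open>f i\<close>.
  Bessel's inequality and the error of the partial sums in Parseval's identity are read off from
  it.\<close>

lemma projection_error:
  assumes "finite I" "\<And>i. i \<in> I \<Longrightarrow> f i \<in> S" "u \<in> S"
    and orth: "\<And>i j. \<lbrakk>i \<in> I; j \<in> I; i \<noteq> j\<rbrakk> \<Longrightarrow> q (f i) (f j) = 0"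
    and pos: "\<And>i. i \<in> I \<Longrightarrow> q (f i) (f i) > 0"
  defines "s \<equiv> \<Sum>i\<in>I. (q u (f i) / q (f i) (f i)) *\<^sub>R f i"
  shows "q (u - s) (u - s) = q u u - (\<Sum>i\<in>I. (q u (f i))\<^sup>2 / q (f i) (f i))"
proof -
  have "s \<in> S" using assms by auto
  have "q s s = (\<Sum>i\<in>I. (q u (f i) / q (f i) (f i))\<^sup>2 * q (f i) (f i))"
    unfolding s_def using assms by (intro square_orthogonal_sum) auto
  also have "\<dots> = (\<Sum>i\<in>I. (q u (f i))\<^sup>2 / q (f i) (f i))"
    using pos by (intro sum.cong) (force simp: power2_eq_square)+
  finally have 1: "q s s = (\<Sum>i\<in>I. (q u (f i))\<^sup>2 / q (f i) (f i))" .
  have 2: "q u s = (\<Sum>i\<in>I. (q u (f i))\<^sup>2 / q (f i) (f i))"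
    unfolding s_def using assms by (simp add: sum_right power2_eq_square)
  show ?thesis using \<open>s \<in> S\<close> \<open>u \<in> S\<close> 1 2 by (simp add: square_diff)
qed

lemma Bessel:
  assumes "finite I" "\<And>i. i \<in> I \<Longrightarrow> f i \<in> S" "u \<in> S"
    and "\<And>i j. \<lbrakk>i \<in> I; j \<in> I; i \<noteq> j\<rbrakk> \<Longrightarrow> q (f i) (f j) = 0"
    and "\<And>i. i \<in> I \<Longrightarrow> q (f i) (f i) > 0"
  shows "(\<Sum>i\<in>I. (q u (f i))\<^sup>2 / q (f i) (f i)) \<le> q u u"
proof -
  have "(\<Sum>i\<in>I. (q u (f i) / q (f i) (f i)) *\<^sub>R f i) \<in> S" using assms by auto
  then have "0 \<le> q (u - (\<Sum>i\<in>I. (q u (f i) / q (f i) (f i)) *\<^sub>R f i))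
      (u - (\<Sum>i\<in>I. (q u (f i) / q (f i) (f i)) *\<^sub>R f i))"
    using assms by (intro nonneg) auto
  then show ?thesis using projection_error[of I f u] assms by simp
qed

lemma tendsto_left:
  assumes v: "\<And>n. v n \<in> S" "w \<in> S" "u \<in> S" and lim: "(\<lambda>n. q (v n - w) (v n - w)) \<longlonglongrightarrow> 0"
  shows "(\<lambda>n. q (v n) u) \<longlonglongrightarrow> q w u"
proof -
  have "(\<lambda>n. sqrt (q (v n - w) (v n - w) * q u u)) \<longlonglongrightarrow> sqrt (0 * q u u)"
    by (intro tendsto_intros lim)
  then have 0: "(\<lambda>n. sqrt (q (v n - w) (v n - w) * q u u)) \<longlonglongrightarrow> 0" by simp
  have "(\<lambda>n. q (v n) u - q w u) \<longlonglongrightarrow> 0"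
  proof (rule Lim_null_comparison[OF _ 0])
    show "\<forall>\<^sub>F n in sequentially. norm (q (v n) u - q w u) \<le> sqrt (q (v n - w) (v n - w) * q u u)"
      using v by (intro always_eventually allI)
        (auto simp: diff_left[symmetric] intro!: real_le_rsqrt Cauchy_Schwarz)
  qed
  then show ?thesis by (simp add: LIM_zero_iff)
qed

lemma tendsto_square:
  assumes v: "\<And>n. v n \<in> S" "w \<in> S" and lim: "(\<lambda>n. q (v n - w) (v n - w)) \<longlonglongrightarrow> 0"
  shows "(\<lambda>n. q (v n) (v n)) \<longlonglongrightarrow> q w w"
proof -
  have "(\<lambda>n. q (v n - w) (v n - w) + 2 * q (v n) w - q w w) \<longlonglongrightarrow> 0 + 2 * q w w - q w w"
    by (intro tendsto_intros lim tendsto_left v)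
  then show ?thesis using v by (simp add: square_diff)
qed

end

subsection \<open>Eigenvalues of a pair of forms\<close>

locale form_pair = q: psd_form S q + d: psd_form S d
  for S :: "'v::real_vector set" and q d :: "'v \<Rightarrow> 'v \<Rightarrow> real"
begin

definition eig :: "real \<Rightarrow> 'v set" where
  "eig t = {u\<in>S. \<forall>v\<in>S. d u v = t * q u v}"

text \<open>Independence modulo vectors of seminorm zero, which for \<open>L2\<close> is
  independence of almost-everywhere classes.\<close>

definition q_independent :: "nat \<Rightarrow> (nat \<Rightarrow> 'v) \<Rightarrow> bool" where
  "q_independent n w \<longleftrightarrow>
     (\<forall>c. q (\<Sum>i<n. c i *\<^sub>R w i) (\<Sum>i<n. c i *\<^sub>R w i) = 0 \<longrightarrow> (\<forall>i<n. c i = 0))"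

definition multiplicity :: "real \<Rightarrow> enat" where
  "multiplicity t = (SUP n\<in>{n. \<exists>w. (\<forall>i<n. w i \<in> eig t) \<and> q_independent n w}. enat n)"

definition eigenvalue_count :: "real \<Rightarrow> enat" where
  "eigenvalue_count t = (\<Sum>\<^sub>\<infinity>s\<in>{..t}. multiplicity s)"

text \<open>The last clause makes \<open>m i\<close> the minimum of the Rayleigh quotient over the
  \<open>q\<close>-orthogonal complement of the preceding eigenvectors.\<close>

definition eigensystem :: "nat \<Rightarrow> (nat \<Rightarrow> 'v) \<Rightarrow> (nat \<Rightarrow> real) \<Rightarrow> bool" where
  "eigensystem n u m \<longleftrightarrow> (\<forall>i<n. u i \<in> eig (m i) \<and> (\<forall>j<n. q (u i) (u j) = of_bool (i = j)) \<and>
     (\<forall>v\<in>S. (\<forall>j<i. q v (u j) = 0) \<longrightarrow> m i * q v v \<le> d v v))"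

lemma eig_in_S: "u \<in> eig t \<Longrightarrow> u \<in> S"
  by (simp add: eig_def)

lemma eig_eq: "\<lbrakk>u \<in> eig t; v \<in> S\<rbrakk> \<Longrightarrow> d u v = t * q u v"
  by (simp add: eig_def)

lemma subspace_eig: "subspace (eig t)"
  by (auto simp: subspace_def eig_def q.expand d.expand algebra_simps)

lemma eig_orthogonal:
  assumes "u \<in> eig s" "v \<in> eig t" "s \<noteq> t"
  shows "q u v = 0"
proof -
  have "s * q u v = t * q u v"
    using assms eig_eq[of u s v] eig_eq[of v t u] eig_in_S by (simp add: d.sym[of u v] q.sym[of u v])
  then show ?thesis using assms by simp
qed

lemma eigensystemD:
  assumes "eigensystem n u m" "i < n"
  shows "u i \<in> eig (m i)" "u i \<in> S" "j < n \<Longrightarrow> q (u i) (u j) = of_bool (i = j)"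
    "\<lbrakk>v \<in> S; \<And>j. j < i \<Longrightarrow> q v (u j) = 0\<rbrakk> \<Longrightarrow> m i * q v v \<le> d v v"
  using assms by (auto simp: eigensystem_def eig_in_S)

lemma eigensystem_mono:
  assumes "eigensystem n u m" "i \<le> j" "j < n"
  shows "m i \<le> m j"
proof -
  have "m i * q (u j) (u j) \<le> d (u j) (u j)"
    using assms by (intro eigensystemD(4)[OF assms(1)]) (auto simp: eigensystemD)
  also have "\<dots> = m j * q (u j) (u j)"
    using assms by (intro eig_eq) (auto simp: eigensystemD)
  finally show ?thesis using assms by (simp add: eigensystemD)
qed

text \<open>\<open>v\<close> minimizes \<open>d - t q\<close> over \<open>W\<close> with minimum 0,
  so the first variation in every direction of \<open>W\<close> vanishes.\<close>

lemma minimizer_variation: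
  assumes W: "subspace W" "W \<subseteq> S" and min: "\<And>w. w \<in> W \<Longrightarrow> t * q w w \<le> d w w"
    and v: "v \<in> W" "d v v \<le> t * q v v" and w: "w \<in> W"
  shows "d v w = t * q v w"
proof -
  have S: "v \<in> S" "w \<in> S" using assms by auto
  have "d v w - t * q v w = 0"
  proof (rule linear_coefficient_zero)
    fix s
    have "v + s *\<^sub>R w \<in> W" using W v w by (intro subspace_add subspace_scale)
    then have "t * q (v + s *\<^sub>R w) (v + s *\<^sub>R w) \<le> d (v + s *\<^sub>R w) (v + s *\<^sub>R w)" by (rule min)
    then show "0 \<le> 2 * s * (d v w - t * q v w) + s\<^sup>2 * (d w w - t * q w w)"
      using S v(2) by (simp add: q.square_add d.square_add q.scale_left d.scale_left
          q.scale_right d.scale_right power2_eq_square algebra_simps)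
  qed
  then show ?thesis by simp
qed

lemma orthogonal_remainder:
  assumes e: "eigensystem n u m" "k \<le> n" and x: "x \<in> S" and j: "j < k"
  shows "q (x - (\<Sum>i<k. q x (u i) *\<^sub>R u i)) (u j) = 0"
proof -
  have u: "\<And>i. i < k \<Longrightarrow> u i \<in> S" using e eigensystemD(2) by auto
  have "q (\<Sum>i<k. q x (u i) *\<^sub>R u i) (u j) = (\<Sum>i<k. q x (u i) * q (u i) (u j))"
    using u j by (intro q.sum_left) auto
  also have "\<dots> = (\<Sum>i<k. if i = j then q x (u i) else 0)"
    using e j by (intro sum.cong) (auto simp: eigensystemD(3))
  finally have "q (\<Sum>i<k. q x (u i) *\<^sub>R u i) (u j) = q x (u j)" using j by simp
  then show ?thesis using u j x by (subst q.diff_left) auto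
qed

text \<open>The first variation gives the eigenvalue equation only against vectors orthogonal to the
  \<open>u j\<close>. It extends to all of \<open>S\<close> because \<open>v\<close> is orthogonal
  to the \<open>u j\<close> for \<open>q\<close> and, as these are eigenvectors, for
  \<open>d\<close> as well.\<close>

lemma orthogonal_minimizer_eig:
  assumes e: "eigensystem n u m" "k \<le> n"
    and min: "\<And>w. \<lbrakk>w \<in> S; \<And>j. j < k \<Longrightarrow> q w (u j) = 0\<rbrakk> \<Longrightarrow> t * q w w \<le> d w w"
    and v: "v \<in> S" "\<And>j. j < k \<Longrightarrow> q v (u j) = 0" "d v v \<le> t * q v v"
  shows "v \<in> eig t"
proof -
  have u: "\<And>i. i < k \<Longrightarrow> u i \<in> S" "\<And>i. i < k \<Longrightarrow> u i \<in> eig (m i)"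
    using e eigensystemD by auto
  define W where "W = {w\<in>S. \<forall>j<k. q w (u j) = 0}"
  have W: "subspace W" "W \<subseteq> S" using u by (auto simp: W_def subspace_def q.expand)
  have "d v x = t * q v x" if x: "x \<in> S" for x
  proof -
    let ?s = "\<Sum>i<k. q x (u i) *\<^sub>R u i"
    have s: "?s \<in> S" using u by auto
    have "x - ?s \<in> W" using orthogonal_remainder[OF e x] x s by (auto simp: W_def)
    then have 1: "d v (x - ?s) = t * q v (x - ?s)"
      using W min v by (intro minimizer_variation[of W]) (auto simp: W_def)
    have "d v (u i) = 0" if "i < k" for i
      using eig_eq[OF u(2)[OF that] v(1)] v(1,2) u that by (simp add: d.sym[of v] q.sym[of _ v])
    then have 2: "d v ?s = 0" using u v by (subst d.sum_right) auto
    have 3: "q v ?s = 0" using u v by (subst q.sum_right) auto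
    show ?thesis using 1 2 3 x s v by (simp add: q.diff_right d.diff_right)
  qed
  then show ?thesis using v by (simp add: eig_def)
qed

lemma combination_orthogonal:
  assumes w: "\<And>i. i < n \<Longrightarrow> w i \<in> S" and J: "finite J" "card J < n" "\<And>j. j \<in> J \<Longrightarrow> f j \<in> S"
  shows "\<exists>c. (\<exists>i<n. c i \<noteq> 0) \<and> (\<forall>j\<in>J. q (\<Sum>i<n. c i *\<^sub>R w i) (f j) = 0)"
proof -
  obtain c where "\<exists>i\<in>{..<n}. c i \<noteq> 0" "\<forall>j\<in>J. (\<Sum>i<n. c i * q (w i) (f j)) = 0"
    using homogeneous_system_nontrivial[of J "{..<n}" "\<lambda>i j. q (w i) (f j)"] J by auto
  moreover have "q (\<Sum>i<n. c i *\<^sub>R w i) (f j) = (\<Sum>i<n. c i * q (w i) (f j))" if "j \<in> J" for j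
    using w J that by (intro q.sum_left) auto
  ultimately show ?thesis by (intro exI[of _ c]) auto
qed

lemma q_independent_pos:
  assumes "q_independent n w" "\<And>i. i < n \<Longrightarrow> w i \<in> S" "\<exists>i<n. c i \<noteq> 0"
  shows "0 < q (\<Sum>i<n. c i *\<^sub>R w i) (\<Sum>i<n. c i *\<^sub>R w i)"
proof -
  have "0 \<le> q (\<Sum>i<n. c i *\<^sub>R w i) (\<Sum>i<n. c i *\<^sub>R w i)"
    using assms by (intro q.nonneg) auto
  then show ?thesis using assms unfolding q_independent_def by (metis order_le_less)
qed

text \<open>A dimension count puts a nonzero combination of the \<open>k + 1\<close> trial vectors
  into the \<open>q\<close>-complement of \<open>u 0, ..., u (k - 1)\<close>, where
  \<open>m k\<close> is the minimum. In the case of equality this combination attains the minimum,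
  hence is an eigenvector.\<close>

lemma minmax_upper:
  assumes e: "eigensystem n u m" "k < n"
    and w: "\<And>i. i < Suc k \<Longrightarrow> w i \<in> S" "q_independent (Suc k) w"
    and le: "\<And>c. d (\<Sum>i<Suc k. c i *\<^sub>R w i) (\<Sum>i<Suc k. c i *\<^sub>R w i) \<le>
        t * q (\<Sum>i<Suc k. c i *\<^sub>R w i) (\<Sum>i<Suc k. c i *\<^sub>R w i)"
  shows "m k \<le> t" "m k = t \<Longrightarrow> \<exists>c. (\<exists>i<Suc k. c i \<noteq> 0) \<and> (\<Sum>i<Suc k. c i *\<^sub>R w i) \<in> eig t"
proof -
  have "\<exists>c. (\<exists>i<Suc k. c i \<noteq> 0) \<and> (\<forall>j\<in>{..<k}. q (\<Sum>i<Suc k. c i *\<^sub>R w i) (u j) = 0)"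
    by (rule combination_orthogonal) (use w e eigensystemD(2)[OF e(1)] in auto)
  then obtain c where c: "\<exists>i<Suc k. c i \<noteq> 0"
    "\<And>j. j \<in> {..<k} \<Longrightarrow> q (\<Sum>i<Suc k. c i *\<^sub>R w i) (u j) = 0" by blast
  define v where "v = (\<Sum>i<Suc k. c i *\<^sub>R w i)"
  have v: "v \<in> S" unfolding v_def using w(1) by (intro q.closed_sum q.closed) auto
  have v0: "\<And>j. j < k \<Longrightarrow> q v (u j) = 0"
    using c unfolding v_def by auto
  have pos: "q v v > 0" unfolding v_def using w c by (intro q_independent_pos) auto
  have "m k * q v v \<le> d v v" using v v0 e by (intro eigensystemD(4)[OF e]) auto
  also have "\<dots> \<le> t * q v v" unfolding v_def by (rule le)
  finally show "m k \<le> t" using pos by simp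
  assume t: "m k = t"
  have "v \<in> eig t"
  proof (rule orthogonal_minimizer_eig[OF e(1), of k])
    show "t * q w w \<le> d w w" if "w \<in> S" "\<And>j. j < k \<Longrightarrow> q w (u j) = 0" for w
      unfolding t[symmetric] using e that by (intro eigensystemD(4)) auto
    show "d v v \<le> t * q v v" unfolding v_def by (rule le)
  qed (use v v0 e in auto)
  then show "\<exists>c. (\<exists>i<Suc k. c i \<noteq> 0) \<and> (\<Sum>i<Suc k. c i *\<^sub>R w i) \<in> eig t"
    using c(1) unfolding v_def by blast
qed

text \<open>The dual count: some combination of \<open>u 0, ..., u k\<close> is orthogonal to the
  \<open>k\<close> vectors \<open>f j\<close>, and its Rayleigh quotient is at most
  \<open>m k\<close>.\<close>

lemma minmax_lower:
  assumes e: "eigensystem n u m" "k < n" and f: "\<And>j. j < k \<Longrightarrow> f j \<in> S"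
    and ge: "\<And>v. \<lbrakk>v \<in> S; \<And>j. j < k \<Longrightarrow> q v (f j) = 0\<rbrakk> \<Longrightarrow> t * q v v \<le> d v v"
  shows "t \<le> m k"
proof -
  have u: "\<And>i. i < Suc k \<Longrightarrow> u i \<in> S" "\<And>i. i < Suc k \<Longrightarrow> u i \<in> eig (m i)"
    using e eigensystemD by auto
  have "\<exists>c. (\<exists>i<Suc k. c i \<noteq> 0) \<and> (\<forall>j\<in>{..<k}. q (\<Sum>i<Suc k. c i *\<^sub>R u i) (f j) = 0)"
    by (rule combination_orthogonal) (use u f in auto)
  then obtain c where c: "\<exists>i<Suc k. c i \<noteq> 0"
    "\<And>j. j \<in> {..<k} \<Longrightarrow> q (\<Sum>i<Suc k. c i *\<^sub>R u i) (f j) = 0" by blast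
  define v where "v = (\<Sum>i<Suc k. c i *\<^sub>R u i)"
  have v: "v \<in> S" unfolding v_def using u(1) by (intro q.closed_sum q.closed) auto
  have vq: "q v v = (\<Sum>i<Suc k. (c i)\<^sup>2 * q (u i) (u i))"
    unfolding v_def by (rule q.square_orthogonal_sum) (use u e in \<open>auto simp: eigensystemD(3)\<close>)
  have "d v v = (\<Sum>i<Suc k. (c i)\<^sup>2 * d (u i) (u i))"
    unfolding v_def
  proof (rule d.square_orthogonal_sum)
    fix i j assume "i \<in> {..<Suc k}" "j \<in> {..<Suc k}" "i \<noteq> j"
    then show "d (u i) (u j) = 0"
      using u e eig_eq[of "u i" "m i" "u j"] by (simp add: eigensystemD(3)[OF e(1)])
  qed (use u in auto)
  also have "\<dots> \<le> (\<Sum>i<Suc k. (c i)\<^sup>2 * (m k * q (u i) (u i)))"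
  proof (intro sum_mono mult_left_mono)
    fix i assume "i \<in> {..<Suc k}"
    then show "d (u i) (u i) \<le> m k * q (u i) (u i)"
      using u e eig_eq[of "u i" "m i" "u i"] eigensystem_mono[OF e(1), of i k]
      by (simp add: eigensystemD(3)[OF e(1)])
  qed auto
  finally have "d v v \<le> m k * q v v" unfolding vq by (simp add: sum_distrib_left mult_ac del: sum.lessThan_Suc)
  moreover have "t * q v v \<le> d v v" using v c by (intro ge) (auto simp: v_def)
  moreover have "q v v > 0"
  proof -
    have "q v v = (\<Sum>i<Suc k. (c i)\<^sup>2)" unfolding vq using e by (intro sum.cong) (auto simp: eigensystemD(3))
    also have "\<dots> > 0"
    proof -
      obtain i where "i < Suc k" "c i \<noteq> 0" using c(1) by blast
      then show ?thesis by (intro sum_pos2[of _ i]) auto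
    qed
    finally show ?thesis .
  qed
  ultimately have "t * q v v \<le> m k * q v v" by linarith
  then show ?thesis using \<open>q v v > 0\<close> by simp
qed

lemma multiplicity_ge:
  assumes e: "eigensystem n u m" and I: "I \<subseteq> {..<n}" "\<And>i. i \<in> I \<Longrightarrow> m i = t"
  shows "enat (card I) \<le> multiplicity t"
proof -
  have fin: "finite I" using I finite_subset by blast
  obtain h where h: "bij_betw h {0..<card I} I" using ex_bij_betw_nat_finite[OF fin] by blast
  then have h': "\<And>i. i < card I \<Longrightarrow> h i \<in> I" "inj_on h {..<card I}"
    by (auto simp: bij_betw_def atLeast0LessThan)
  have "q_independent (card I) (u \<circ> h)"
    unfolding q_independent_def
  proof (intro allI impI)
    fix c i assume 0: "q (\<Sum>i<card I. c i *\<^sub>R (u \<circ> h) i) (\<Sum>i<card I. c i *\<^sub>R (u \<circ> h) i) = 0"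
      and i: "i < card I"
    have "q (\<Sum>i<card I. c i *\<^sub>R (u \<circ> h) i) (\<Sum>i<card I. c i *\<^sub>R (u \<circ> h) i) =
        (\<Sum>i<card I. (c i)\<^sup>2 * q ((u \<circ> h) i) ((u \<circ> h) i))"
    proof (rule q.square_orthogonal_sum)
      fix i j assume "i \<in> {..<card I}" "j \<in> {..<card I}" "i \<noteq> j"
      then have "h i < n" "h j < n" "h i \<noteq> h j" using h' I by (auto dest: inj_onD)
      then show "q ((u \<circ> h) i) ((u \<circ> h) j) = 0" using e by (simp add: eigensystemD(3))
    next
      fix i assume "i \<in> {..<card I}"
      then have "h i < n" using h' I by auto
      then show "(u \<circ> h) i \<in> S" using e eigensystemD(2) by simp
    qed simp
    also have "\<dots> = (\<Sum>i<card I. (c i)\<^sup>2)"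
    proof (rule sum.cong)
      fix i assume "i \<in> {..<card I}"
      then have "h i < n" using h' I by auto
      then show "(c i)\<^sup>2 * q ((u \<circ> h) i) ((u \<circ> h) i) = (c i)\<^sup>2" using e by (simp add: eigensystemD(3))
    qed simp
    finally have "(\<Sum>i<card I. (c i)\<^sup>2) = 0" using 0 by simp
    then have "\<forall>i\<in>{..<card I}. (c i)\<^sup>2 = 0" by (subst (asm) sum_nonneg_eq_0_iff) auto
    then show "c i = 0" using i by simp
  qed
  moreover have "(u \<circ> h) i \<in> eig t" if "i < card I" for i
    using h'(1)[OF that] I eigensystemD(1)[OF e, of "h i"] by auto
  ultimately show ?thesis
    unfolding multiplicity_def by (intro SUP_upper) blast
qed

text \<open>With more independent eigenvectors than listed indices, some combination is orthogonal
  to every \<open>u j\<close> with \<open>j < k\<close>, those of other eigenvalues being orthogonal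
  anyway. Minimality then forces its Rayleigh quotient up to \<open>m k\<close>, whereas it equals
  \<open>t\<close>.\<close>

lemma multiplicity_le:
  assumes e: "eigensystem n u m" "k < n" and t: "t < m k"
  shows "multiplicity t \<le> enat (card {i. i < k \<and> m i = t})"
  unfolding multiplicity_def
proof (rule SUP_least)
  let ?J = "{i. i < k \<and> m i = t}"
  fix N assume "N \<in> {N. \<exists>w. (\<forall>i<N. w i \<in> eig t) \<and> q_independent N w}"
  then obtain w where w: "\<And>i. i < N \<Longrightarrow> w i \<in> eig t" "q_independent N w" by auto
  have u: "u j \<in> S" "u j \<in> eig (m j)" if "j < k" for j using e eigensystemD that by auto
  show "enat N \<le> enat (card ?J)"
  proof (rule ccontr)
    assume "\<not> ?thesis"
    then have "card ?J < N" by simp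
    then have "\<exists>c. (\<exists>i<N. c i \<noteq> 0) \<and> (\<forall>j\<in>?J. q (\<Sum>i<N. c i *\<^sub>R w i) (u j) = 0)"
      by (intro combination_orthogonal) (use w u in \<open>auto intro: eig_in_S\<close>)
    then obtain c where c: "\<exists>i<N. c i \<noteq> 0"
      "\<And>j. j \<in> ?J \<Longrightarrow> q (\<Sum>i<N. c i *\<^sub>R w i) (u j) = 0" by blast
    define v where "v = (\<Sum>i<N. c i *\<^sub>R w i)"
    have v: "v \<in> eig t" unfolding v_def
      using w by (intro subspace_sum subspace_scale subspace_eig) auto
    have "q v (u j) = 0" if "j < k" for j
    proof (cases "m j = t")
      case True
      then show ?thesis using c that by (simp add: v_def)
    next
      case False
      then show ?thesis using eig_orthogonal[of v t "u j" "m j"] u that v by auto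
    qed
    then have "m k * q v v \<le> d v v" using v e by (intro eigensystemD(4)[OF e]) (auto simp: eig_in_S)
    also have "\<dots> = t * q v v" using v eig_in_S by (intro eig_eq) auto
    finally have "q v v \<le> 0" using t by (simp add: not_less mult_le_cancel_right)
    moreover have "q v v > 0"
      unfolding v_def using w c eig_in_S by (intro q_independent_pos) auto
    ultimately show False by simp
  qed
qed

lemma eigenvalue_count_ge:
  assumes e: "eigensystem n u m" "k < n"
  shows "enat (Suc k) \<le> eigenvalue_count (m k)"
proof -
  let ?V = "m ` {..k}"
  have "enat (Suc k) = enat (card (\<Union>s\<in>?V. {i. i \<le> k \<and> m i = s}))"
  proof -
    have "(\<Union>s\<in>?V. {i. i \<le> k \<and> m i = s}) = {..k}" by auto
    then show ?thesis by simp
  qed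
  also have "card (\<Union>s\<in>?V. {i. i \<le> k \<and> m i = s}) = (\<Sum>s\<in>?V. card {i. i \<le> k \<and> m i = s})"
    by (rule card_UN_disjoint) auto
  also have "enat \<dots> = (\<Sum>s\<in>?V. enat (card {i. i \<le> k \<and> m i = s}))"
    by (simp add: of_nat_eq_enat[symmetric] del: of_nat_eq_enat)
  also have "\<dots> \<le> (\<Sum>s\<in>?V. multiplicity s)"
    using e by (intro sum_mono multiplicity_ge[OF e(1)]) auto
  \<comment> \<open>The values \<open>m 0, ..., m k\<close> all lie in \<open>{..m k}\<close>, and
    the remaining multiplicities only increase the sum.\<close>
  also have "\<dots> \<le> eigenvalue_count (m k)"
    unfolding eigenvalue_count_def
        unfolding infsum_finite[OF finite_imageI[OF finite_atMost], symmetric]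
    by (rule infsum_mono_neutral)
      (use e eigensystem_mono[OF e(1)] in \<open>auto intro!: nonneg_summable_on_complete\<close>)
  finally show ?thesis .
qed

lemma eigenvalue_count_le:
  assumes e: "eigensystem n u m" "k < n" and t: "t < m k"
  shows "eigenvalue_count t \<le> enat k"
proof -
  let ?V = "m ` {..<k}"
  let ?f = "\<lambda>s. enat (card {i. i < k \<and> m i = s})"
  have "eigenvalue_count t \<le> infsum ?f ?V"
    unfolding eigenvalue_count_def
  proof (rule infsum_mono_neutral)
    \<comment> \<open>Outside the values of \<open>m\<close> the bound of
      \<open>multiplicity_le\<close> counts an empty set, so the sum over uncountably many reals is
      supported on finitely many.\<close>
    fix s assume "s \<in> {..t} - ?V"
    then have "multiplicity s \<le> ?f s" using t by (intro multiplicity_le[OF e]) auto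
    also have "{i. i < k \<and> m i = s} = {}" using \<open>s \<in> {..t} - ?V\<close> by auto
    finally show "multiplicity s \<le> 0" by (simp add: zero_enat_def)
  next
    fix s assume "s \<in> {..t} \<inter> ?V"
    then show "multiplicity s \<le> ?f s" using t by (intro multiplicity_le[OF e]) auto
  qed (auto intro!: nonneg_summable_on_complete)
  also have "infsum ?f ?V = (\<Sum>s\<in>?V. ?f s)" by simp
  also have "\<dots> = enat (\<Sum>s\<in>?V. card {i. i < k \<and> m i = s})"
    by (simp add: of_nat_eq_enat[symmetric] del: of_nat_eq_enat)
  also have "(\<Sum>s\<in>?V. card {i. i < k \<and> m i = s}) = card (\<Union>s\<in>?V. {i. i < k \<and> m i = s})"
    by (rule card_UN_disjoint[symmetric]) auto
  also have "(\<Union>s\<in>?V. {i. i < k \<and> m i = s}) = {..<k}" by auto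
  finally show ?thesis by simp
qed

text \<open>The count jumps at \<open>m k\<close>: it is at most \<open>k\<close> to the left and at
  least \<open>k + 1\<close> at the point itself, so the infimum is attained there.\<close>

lemma eigensystem_Inf_count:
  assumes e: "eigensystem n u m" "k < n"
  shows "Inf {t. enat (Suc k) \<le> eigenvalue_count t} = m k"
proof (rule cInf_eq_minimum)
  show "m k \<in> {t. enat (Suc k) \<le> eigenvalue_count t}" using eigenvalue_count_ge[OF e] by simp
  fix t assume "t \<in> {t. enat (Suc k) \<le> eigenvalue_count t}"
  then show "m k \<le> t" using eigenvalue_count_le[OF e, of t]
    by (metis enat_ord_simps(1) mem_Collect_eq not_less not_less_eq_eq order_refl order_trans)
qed

section \<open>Compactness from countably many functionals\<close>

lemma compact_box_fun:
  fixes M :: "'i \<Rightarrow> real"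
  shows "compact {f. \<forall>i. \<bar>f i\<bar> \<le> M i}"
proof -
  have "compactin (product_topology (\<lambda>i::'i. euclidean) UNIV) (PiE UNIV (\<lambda>i. {- M i..M i}))"
    by (subst compactin_PiE) auto
  moreover have "PiE UNIV (\<lambda>i. {- M i..M i}) = {f. \<forall>i. \<bar>f i\<bar> \<le> M i}"
    by (auto simp: PiE_def Pi_def abs_le_iff) (metis minus_le_iff)+
  ultimately show ?thesis
    by (simp add: euclidean_product_topology)
qed

text \<open>Compactness of a box in the product topology, metrizable for a countable index set,
  replaces the diagonal argument: along one subsequence all functionals converge. The hypothesis
  with \<open>F\<close> and \<open>K\<close> then controls \<open>q\<close> by finitely many of
  them, up to a small multiple of the bounded form \<open>d\<close>.\<close>

lemma precompact_by_functionals: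
  fixes \<psi> :: "'i::countable \<Rightarrow> 'v \<Rightarrow> real"
  assumes diff: "\<And>i u w. \<lbrakk>u \<in> S; w \<in> S\<rbrakk> \<Longrightarrow> \<psi> i (u - w) = \<psi> i u - \<psi> i w"
    and bound: "\<And>i u. u \<in> S \<Longrightarrow> (\<psi> i u)\<^sup>2 \<le> C i * q u u" and C: "\<And>i. 0 \<le> C i"
    and ineq: "\<And>e. e > 0 \<Longrightarrow> \<exists>F K. finite F \<and> (\<forall>u\<in>S. q u u \<le> K * (\<Sum>i\<in>F. (\<psi> i u)\<^sup>2) + e * d u u)"
    and v: "\<And>n. v n \<in> S" "\<And>n. q (v n) (v n) \<le> B" "\<And>n. d (v n) (v n) \<le> B"
  shows "\<exists>r. strict_mono (r :: nat \<Rightarrow> nat) \<and>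
        (\<forall>e>0. \<exists>N. \<forall>i\<ge>N. \<forall>j\<ge>N. q (v (r i) - v (r j)) (v (r i) - v (r j)) < e)"
proof -
  have B: "B \<ge> 0" using q.nonneg[OF v(1)[of 0]] v(2)[of 0] by simp
  define x where "x = (\<lambda>n i. \<psi> i (v n))"
  have "\<bar>x n i\<bar> \<le> sqrt (C i * B)" for n i
  proof -
    have "(\<psi> i (v n))\<^sup>2 \<le> C i * B"
      using bound[OF v(1)] mult_left_mono[OF v(2) C] by (rule order_trans)
    then show ?thesis using real_le_rsqrt[of "\<bar>x n i\<bar>"] by (simp add: x_def)
  qed
  then have x: "\<forall>n. x n \<in> {f. \<forall>i. \<bar>f i\<bar> \<le> sqrt (C i * B)}" by simp
  have sc: "seq_compact {f. \<forall>i::'i. \<bar>f i\<bar> \<le> sqrt (C i * B)}"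
    using compact_box_fun[of "\<lambda>i. sqrt (C i * B)"] unfolding compact_eq_seq_compact_metric .
  have "\<exists>r l. strict_mono (r :: nat \<Rightarrow> nat) \<and> (x \<circ> r) \<longlonglongrightarrow> l"
    using seq_compactE[OF sc, of x thesis for thesis, OF x] by blast
  then obtain r :: "nat \<Rightarrow> nat" and l where r: "strict_mono r" and l: "(x \<circ> r) \<longlonglongrightarrow> l"
    by blast
  have conv: "(\<lambda>n. \<psi> i (v (r n))) \<longlonglongrightarrow> l i" for i
    using continuous_on_tendsto_compose[OF continuous_on_product_coordinates[of i] l]
    by (simp add: x_def)
  have "\<exists>N. \<forall>i\<ge>N. \<forall>j\<ge>N. q (v (r i) - v (r j)) (v (r i) - v (r j)) < e" if e: "e > 0" for e
  proof -
    \<comment> \<open>Differences have \<open>d\<close> at most \<open>4 * B\<close>, so this choice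
      keeps the \<open>d\<close> term below \<open>e / 2\<close>; the summand 1 covers
      \<open>B = 0\<close>. The other half of \<open>e\<close> is left to the functionals, through
      \<open>\<epsilon>\<close>.\<close>
    define \<delta> where "\<delta> = e / (2 * (4 * B + 1))"
    have \<delta>: "\<delta> > 0" using e B by (simp add: \<delta>_def)
    obtain F K where F: "finite F"
      and FK: "\<And>u. u \<in> S \<Longrightarrow> q u u \<le> K * (\<Sum>i\<in>F. (\<psi> i u)\<^sup>2) + \<delta> * d u u"
      using ineq[OF \<delta>] by blast
    define \<epsilon> where "\<epsilon> = sqrt (e / (2 * (\<bar>K\<bar> * card F + 1)))"
    have \<epsilon>: "\<epsilon> > 0" "(\<bar>K\<bar> * card F + 1) * \<epsilon>\<^sup>2 = e / 2"
      using e by (auto simp: \<epsilon>_def intro!: divide_pos_pos add_nonneg_pos) (simp add: field_simps add_nonneg_eq_0_iff)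
    have "Cauchy (\<lambda>n. \<psi> i (v (r n)))" for i using conv by (rule LIMSEQ_imp_Cauchy)
    then have "\<forall>i. \<exists>N. \<forall>m\<ge>N. \<forall>n\<ge>N. \<bar>\<psi> i (v (r m)) - \<psi> i (v (r n))\<bar> < \<epsilon>"
      using \<epsilon>(1) by (auto simp: Cauchy_def dist_real_def)
    then obtain N where N: "\<And>i m n. \<lbrakk>m \<ge> N i; n \<ge> N i\<rbrakk> \<Longrightarrow> \<bar>\<psi> i (v (r m)) - \<psi> i (v (r n))\<bar> < \<epsilon>"
      by metis
    show ?thesis
    proof (intro exI[of _ "\<Sum>i\<in>F. N i"] allI impI)
      fix m n assume mn: "m \<ge> (\<Sum>i\<in>F. N i)" "n \<ge> (\<Sum>i\<in>F. N i)"
      let ?w = "v (r m) - v (r n)"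
      have w: "?w \<in> S" using v by auto
      have "(\<psi> i ?w)\<^sup>2 \<le> \<epsilon>\<^sup>2" if "i \<in> F" for i
      proof -
        have "N i \<le> (\<Sum>i\<in>F. N i)" using F that by (intro member_le_sum) auto
        then have "\<bar>\<psi> i ?w\<bar> < \<epsilon>" using N[of i m n] mn v by (simp add: diff)
        then have "\<bar>\<psi> i ?w\<bar> ^ 2 \<le> \<epsilon> ^ 2" by (intro power_mono) auto
        then show ?thesis by simp
      qed
      then have "(\<Sum>i\<in>F. (\<psi> i ?w)\<^sup>2) \<le> card F * \<epsilon>\<^sup>2"
        using sum_mono[of F "\<lambda>i. (\<psi> i ?w)\<^sup>2" "\<lambda>_. \<epsilon>\<^sup>2"] by simp
      then have 1: "K * (\<Sum>i\<in>F. (\<psi> i ?w)\<^sup>2) \<le> \<bar>K\<bar> * (card F * \<epsilon>\<^sup>2)"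
        by (intro mult_mono) (auto simp: sum_nonneg)
      have "d ?w ?w \<le> 4 * B" using d.square_diff_le[OF v(1) v(1), of "r m" "r n"] v(3)[of "r m"] v(3)[of "r n"] by simp
      then have 2: "\<delta> * d ?w ?w \<le> \<delta> * (4 * B)" using \<delta> by simp
      have 3: "\<delta> * (4 * B) < e / 2"
      proof -
        have "\<delta> * (4 * B) < \<delta> * (4 * B + 1)" using \<delta> by simp
        also have "\<dots> = e / 2" using B by (simp add: \<delta>_def field_simps add_nonneg_eq_0_iff)
        finally show ?thesis .
      qed
      have "q ?w ?w \<le> \<bar>K\<bar> * (card F * \<epsilon>\<^sup>2) + \<delta> * (4 * B)" using FK[OF w] 1 2 by linarith
      also have "\<dots> \<le> (\<bar>K\<bar> * card F + 1) * \<epsilon>\<^sup>2 + \<delta> * (4 * B)" by (simp add: algebra_simps)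
      also have "\<dots> < e" using \<epsilon> 3 by simp
      finally show "q ?w ?w < e" .
    qed
  qed
  then show ?thesis using r by blast
qed

end

text \<open>\<open>precompact\<close> is Rellich's theorem in Cauchy form, and
  \<open>complete\<close> is completeness for \<open>q + d\<close>. The first yields no limit by
  itself, since a \<open>q\<close>-limit may leave \<open>S\<close>.\<close>

locale compact_form_pair = form_pair +
  assumes precompact: "\<lbrakk>\<And>n. v n \<in> S; \<And>n. q (v n) (v n) \<le> B; \<And>n. d (v n) (v n) \<le> B\<rbrakk> \<Longrightarrow>
      \<exists>r. strict_mono (r :: nat \<Rightarrow> nat) \<and>
        (\<forall>e>0. \<exists>N. \<forall>i\<ge>N. \<forall>j\<ge>N. q (v (r i) - v (r j)) (v (r i) - v (r j)) < e)"
    and complete: "\<lbrakk>\<And>n. v n \<in> S; \<And>e. e > 0 \<Longrightarrow> \<exists>N. \<forall>i\<ge>N. \<forall>j\<ge>N. q (v i - v j) (v i - v j) < e;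
      \<And>e. e > 0 \<Longrightarrow> \<exists>N. \<forall>i\<ge>N. \<forall>j\<ge>N. d (v i - v j) (v i - v j) < e\<rbrakk> \<Longrightarrow>
      \<exists>w\<in>S. (\<lambda>n::nat. q (v n - w) (v n - w)) \<longlonglongrightarrow> 0 \<and> (\<lambda>n. d (v n - w) (v n - w)) \<longlonglongrightarrow> 0"
begin

text \<open>A minimizing sequence that is Cauchy for \<open>q\<close> is Cauchy for \<open>d\<close> as well, by the parallelogram
  identity and the minimality of \<open>t\<close>.\<close>

lemma minimizer_exists:
  assumes u: "\<And>j. j < k \<Longrightarrow> u j \<in> S" and x: "x \<in> S" "\<And>j. j < k \<Longrightarrow> q x (u j) = 0" "q x x \<noteq> 0"
  obtains v where "v \<in> S" "\<And>j. j < k \<Longrightarrow> q v (u j) = 0" "q v v = 1"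
    "\<And>w. \<lbrakk>w \<in> S; \<And>j. j < k \<Longrightarrow> q w (u j) = 0\<rbrakk> \<Longrightarrow> d v v * q w w \<le> d w w"
proof -
  define W where "W = {w\<in>S. \<forall>j<k. q w (u j) = 0}"
  have W: "subspace W" "W \<subseteq> S" using u by (auto simp: W_def subspace_def q.expand)
  define R where "R = {d w w | w. w \<in> W \<and> q w w = 1}"
  have bdd: "bdd_below R" using W d.nonneg by (intro bdd_belowI[of _ 0]) (auto simp: R_def)
  have unit: "(1 / sqrt (q w w)) *\<^sub>R w \<in> W"
    "q ((1 / sqrt (q w w)) *\<^sub>R w) ((1 / sqrt (q w w)) *\<^sub>R w) = 1"
    "d ((1 / sqrt (q w w)) *\<^sub>R w) ((1 / sqrt (q w w)) *\<^sub>R w) = d w w / q w w"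
    if "w \<in> W" "q w w \<noteq> 0" for w
    using that W q.nonneg[of w] by (auto simp: subspace_scale q.square_scale d.square_scale power_divide)
  have ne: "R \<noteq> {}" using unit[of x] x by (auto simp: R_def W_def)
  define t where "t = Inf R"
  have t: "t * q w w \<le> d w w" if w: "w \<in> W" for w
  proof (cases "q w w = 0")
    case True
    then show ?thesis using w W d.nonneg by auto
  next
    case False
    then have "d w w / q w w \<in> R" using unit[OF w] by (auto simp: R_def intro!: exI[of _ "(1 / sqrt (q w w)) *\<^sub>R w"])
    then have "t \<le> d w w / q w w" unfolding t_def using bdd by (rule cInf_lower)
    then show ?thesis using False q.nonneg[of w] w W by (auto simp: field_simps)
  qed
  have "\<exists>v. v \<in> W \<and> q v v = 1 \<and> d v v < t + 1 / Suc n" for n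
    using cInf_lessD[OF ne, of "t + 1 / Suc n"] by (auto simp: R_def t_def)
  then obtain v where v: "\<And>n. v n \<in> W" "\<And>n. q (v n) (v n) = 1" "\<And>n. d (v n) (v n) < t + 1 / Suc n"
    by metis
  have vS: "v n \<in> S" for n using v W by auto
  have "d (v n) (v n) \<le> max 1 (t + 1)" for n
    using v(3)[of n] by (auto simp: le_max_iff_disj intro!: disjI2 elim!: order.trans[OF less_imp_le])
  then have "\<exists>r. strict_mono (r :: nat \<Rightarrow> nat) \<and>
      (\<forall>e>0. \<exists>N. \<forall>i\<ge>N. \<forall>j\<ge>N. q (v (r i) - v (r j)) (v (r i) - v (r j)) < e)"
    by (intro precompact[of v "max 1 (t + 1)"]) (auto simp: vS v(2))
  then obtain r :: "nat \<Rightarrow> nat" where r: "strict_mono r"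
    and qC: "\<And>e. e > 0 \<Longrightarrow> \<exists>N. \<forall>i\<ge>N. \<forall>j\<ge>N. q (v (r i) - v (r j)) (v (r i) - v (r j)) < e"
    by blast
  have lim_d: "(\<lambda>n. d (v n) (v n)) \<longlonglongrightarrow> t"
  proof (rule tendsto_sandwich)
    show "\<forall>\<^sub>F n in sequentially. t \<le> d (v n) (v n)" using t v by (intro always_eventually) (metis mult.right_neutral)
    show "\<forall>\<^sub>F n in sequentially. d (v n) (v n) \<le> t + 1 / Suc n"
      using v(3) by (intro always_eventually) (auto intro: less_imp_le)
    show "(\<lambda>n. t + 1 / real (Suc n)) \<longlonglongrightarrow> t"
      using tendsto_add[OF tendsto_const LIMSEQ_inverse_real_of_nat, of t] by (simp add: inverse_eq_divide)
  qed simp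
  have dC: "\<exists>N. \<forall>i\<ge>N. \<forall>j\<ge>N. d (v (r i) - v (r j)) (v (r i) - v (r j)) < e" if e: "e > 0" for e
  proof -
    \<comment> \<open>The parallelogram identity costs four times \<open>e / 8\<close> from the
      values of \<open>d\<close>, and \<open>t\<close> times the \<open>q\<close>-distance, which
      this threshold keeps below \<open>e / 2\<close>; \<open>\<bar>t\<bar> + 1\<close> avoids a
      zero divisor.\<close>
    obtain N1 where N1: "\<And>i j. \<lbrakk>i \<ge> N1; j \<ge> N1\<rbrakk> \<Longrightarrow>
        q (v (r i) - v (r j)) (v (r i) - v (r j)) < e / (2 * (\<bar>t\<bar> + 1))"
      using qC[of "e / (2 * (\<bar>t\<bar> + 1))"] e by (auto simp: divide_pos_pos)
    obtain N2 where N2: "\<And>n. n \<ge> N2 \<Longrightarrow> \<bar>d (v n) (v n) - t\<bar> < e / 8"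
      using LIMSEQ_D[OF lim_d, of "e / 8"] e by auto
    show ?thesis
    proof (intro exI[of _ "max N1 N2"] allI impI)
      fix i j assume ij: "i \<ge> max N1 N2" "j \<ge> max N1 N2"
      let ?a = "v (r i)" and ?b = "v (r j)"
      have "r i \<ge> N2" "r j \<ge> N2" using ij r by (auto intro: order_trans[OF _ seq_suble])
      then have 1: "d ?a ?a < t + e / 8" "d ?b ?b < t + e / 8" using N2[of "r i"] N2[of "r j"] by linarith+
      have "?a + ?b \<in> W" using v W by (auto intro: subspace_add)
      from t[OF this] have 2: "t * q (?a + ?b) (?a + ?b) \<le> d (?a + ?b) (?a + ?b)" .
      have par: "q (?a + ?b) (?a + ?b) = 4 - q (?a - ?b) (?a - ?b)"
        using vS v(2) by (simp add: q.square_add q.square_diff)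
      have "d (?a - ?b) (?a - ?b) = 2 * d ?a ?a + 2 * d ?b ?b - d (?a + ?b) (?a + ?b)"
        using vS by (simp add: d.square_add d.square_diff)
      also have "\<dots> \<le> 4 * (t + e/8) - t * (4 - q (?a - ?b) (?a - ?b))" using 1 2 par by simp
      also have "\<dots> = e / 2 + t * q (?a - ?b) (?a - ?b)" by (simp add: algebra_simps)
      also have "\<dots> < e / 2 + (\<bar>t\<bar> + 1) * (e / (2 * (\<bar>t\<bar> + 1)))"
      proof -
        have "t * q (?a - ?b) (?a - ?b) \<le> (\<bar>t\<bar> + 1) * q (?a - ?b) (?a - ?b)"
          using vS by (intro mult_right_mono q.nonneg) auto
        also have "\<dots> < (\<bar>t\<bar> + 1) * (e / (2 * (\<bar>t\<bar> + 1)))"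
          using N1 ij by (intro mult_strict_left_mono) auto
        finally show ?thesis by simp
      qed
      also have "\<dots> = e" by (simp add: field_simps)
      finally show "d (?a - ?b) (?a - ?b) < e" .
    qed
  qed
  obtain w where w: "w \<in> S" "(\<lambda>n. q (v (r n) - w) (v (r n) - w)) \<longlonglongrightarrow> 0"
    "(\<lambda>n. d (v (r n) - w) (v (r n) - w)) \<longlonglongrightarrow> 0"
    using complete[of "v \<circ> r"] vS qC dC by auto
  have "(\<lambda>n. q (v (r n)) (v (r n))) \<longlonglongrightarrow> q w w"
    using w vS by (intro q.tendsto_square) auto
  then have w1: "q w w = 1" using v(2) by (simp add: LIMSEQ_const_iff)
  have "(\<lambda>n. d (v (r n)) (v (r n))) \<longlonglongrightarrow> d w w"
    using w vS by (intro d.tendsto_square) auto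
  moreover have "(\<lambda>n. d (v (r n)) (v (r n))) \<longlonglongrightarrow> t"
    using LIMSEQ_subseq_LIMSEQ[OF lim_d r] by (simp add: o_def)
  ultimately have wt: "d w w = t" using LIMSEQ_unique by blast
  have "q w (u j) = 0" if "j < k" for j
  proof -
    have "(\<lambda>n. q (v (r n)) (u j)) \<longlonglongrightarrow> q w (u j)"
      using w vS u that by (intro q.tendsto_left) auto
    moreover have "q (v (r n)) (u j) = 0" for n using v that by (simp add: W_def)
    ultimately show ?thesis by (simp add: LIMSEQ_const_iff)
  qed
  then show thesis using w w1 wt t by (intro that[of w]) (auto simp: W_def)
qed

lemma eigensystem_Suc:
  assumes e: "eigensystem n u m" and x: "x \<in> S" "\<And>j. j < n \<Longrightarrow> q x (u j) = 0" "q x x \<noteq> 0"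
  shows "\<exists>u m. eigensystem (Suc n) u m"
proof -
  have u: "\<And>j. j < n \<Longrightarrow> u j \<in> S" using e eigensystemD by auto
  obtain v where v: "v \<in> S" "\<And>j. j < n \<Longrightarrow> q v (u j) = 0" "q v v = 1"
    "\<And>w. \<lbrakk>w \<in> S; \<And>j. j < n \<Longrightarrow> q w (u j) = 0\<rbrakk> \<Longrightarrow> d v v * q w w \<le> d w w"
    using minimizer_exists[of n u x] u x by blast
  have v_eig: "v \<in> eig (d v v)"
    using v by (intro orthogonal_minimizer_eig[OF e order_refl]) auto
  have "eigensystem (Suc n) (u(n := v)) (m(n := d v v))"
    unfolding eigensystem_def
  proof (intro allI impI conjI ballI)
    fix i assume i: "i < Suc n"
    show "(u(n := v)) i \<in> eig ((m(n := d v v)) i)"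
      using i v_eig eigensystemD(1)[OF e] by (auto simp: less_Suc_eq)
    show "q ((u(n := v)) i) ((u(n := v)) j) = of_bool (i = j)" if j: "j < Suc n" for j
    proof -
      have "q (u l) v = 0" if "l < n" for l using q.sym[of "u l" v] u v that by simp
      then show ?thesis using i j v u eigensystemD(3)[OF e] by (auto simp: less_Suc_eq)
    qed
    fix w assume w: "w \<in> S" "\<forall>j<i. q w ((u(n := v)) j) = 0"
    have *: "q w (u j) = 0" if "j < i" for j
      using that w(2)[rule_format, OF that] i by (auto split: if_splits)
    show "(m(n := d v v)) i * q w w \<le> d w w"
    proof (cases "i = n")
      case True
      then show ?thesis using v(4)[of w] w(1) * by simp
    next
      case False
      then show ?thesis using eigensystemD(4)[OF e, of i w] i w(1) * by simp
    qed
  qed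
  then show ?thesis by blast
qed

text \<open>Among \<open>n + 1\<close> members of an orthogonal family some nonzero combination is
  orthogonal to the \<open>n\<close> eigenvectors found so far, so the next minimization runs over a
  nontrivial space.\<close>

lemma eigensystem_exists:
  assumes f: "\<And>i. f i \<in> S" "\<And>i. 0 < q (f i) (f i)" "\<And>i j :: nat. i \<noteq> j \<Longrightarrow> q (f i) (f j) = 0"
  shows "\<exists>u m. eigensystem n u m"
proof (induction n)
  case 0
  show ?case by (simp add: eigensystem_def)
next
  case (Suc n)
  then obtain u m where e: "eigensystem n u m" by blast
  have u: "\<And>j. j < n \<Longrightarrow> u j \<in> S" using e eigensystemD by auto
  have "\<exists>c. (\<exists>i<Suc n. c i \<noteq> 0) \<and> (\<forall>j\<in>{..<n}. q (\<Sum>i<Suc n. c i *\<^sub>R f i) (u j) = 0)"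
    by (rule combination_orthogonal) (use u f in auto)
  then obtain c where c: "\<exists>i<Suc n. c i \<noteq> 0"
    "\<And>j. j \<in> {..<n} \<Longrightarrow> q (\<Sum>i<Suc n. c i *\<^sub>R f i) (u j) = 0" by blast
  have "q (\<Sum>i<Suc n. c i *\<^sub>R f i) (\<Sum>i<Suc n. c i *\<^sub>R f i) = (\<Sum>i<Suc n. (c i)\<^sup>2 * q (f i) (f i))"
    using f by (intro q.square_orthogonal_sum) auto
  also have "\<dots> > 0"
  proof -
    obtain i where "i < Suc n" "c i \<noteq> 0" using c(1) by blast
    then show ?thesis using f(2) by (intro sum_pos2[of _ i]) (auto simp: less_imp_le)
  qed
  finally have pos: "q (\<Sum>i<Suc n. c i *\<^sub>R f i) (\<Sum>i<Suc n. c i *\<^sub>R f i) \<noteq> 0" by (rule less_imp_neq[THEN not_sym])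
  show ?case
  proof (rule eigensystem_Suc[OF e _ _ pos])
    show "(\<Sum>i<Suc n. c i *\<^sub>R f i) \<in> S" using f(1) by (intro q.closed_sum q.closed)
  qed (use c(2) in auto)
qed

end

subsection \<open>Completeness of \<open>L\<^sup>2\<close>\<close>

text \<open>From \<open>2 x \<le> x^2 + 1\<close> with \<open>x = 2^k \<bar>a k\<bar>\<close>: after
  division by \<open>2^k\<close> only a geometric error remains.\<close>

lemma summable_of_weighted_squares:
  fixes a :: "nat \<Rightarrow> real"
  assumes "summable (\<lambda>k. 2 ^ k * (a k)\<^sup>2)"
  shows "summable a"
proof (rule summable_comparison_test')
  show "summable (\<lambda>k. 2 ^ k * (a k)\<^sup>2 + (1 / 2) ^ k)"
    by (intro summable_add assms summable_geometric) auto
  fix k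
  have "0 \<le> (2 ^ k * \<bar>a k\<bar> - 1)\<^sup>2" by simp
  then have "2 * (2 ^ k * \<bar>a k\<bar>) \<le> 2 ^ k * (2 ^ k * (a k)\<^sup>2) + 1"
    by (simp add: power2_eq_square algebra_simps)
  then have "2 ^ k * \<bar>a k\<bar> \<le> 2 ^ k * (2 ^ k * (a k)\<^sup>2) + 1" by (smt (verit) zero_le_mult_iff zero_le_power abs_ge_zero)
  also have "\<dots> = 2 ^ k * (2 ^ k * (a k)\<^sup>2 + (1 / 2) ^ k)"
    by (simp add: distrib_left power_mult_distrib[symmetric])
  finally show "norm (a k) \<le> 2 ^ k * (a k)\<^sup>2 + (1 / 2) ^ k" by simp
qed

text \<open>Riesz--Fischer: along a fast subsequence the weighted squares of the increments have a finite
  sum almost everywhere, and Fatou's lemma turns the pointwise limit into a limit in the mean.\<close>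

lemma Cauchy_in_mean_square_converges:
  fixes f :: "nat \<Rightarrow> 'a \<Rightarrow> real"
  assumes meas [measurable]: "\<And>n. f n \<in> borel_measurable M"
    and int: "\<And>m n. integrable M (\<lambda>x. (f m x - f n x)\<^sup>2)"
    and Cauchy: "\<And>e. e > 0 \<Longrightarrow> \<exists>N. \<forall>m\<ge>N. \<forall>n\<ge>N. (LINT x|M. (f m x - f n x)\<^sup>2) < e"
  obtains g where "g \<in> borel_measurable M" "\<And>n. integrable M (\<lambda>x. (f n x - g x)\<^sup>2)"
    "(\<lambda>n. LINT x|M. (f n x - g x)\<^sup>2) \<longlonglongrightarrow> 0"
proof -
  \<comment> \<open>The rate 1/4 beats the weight \<open>2 ^ k\<close> of the squared increments and
    leaves a convergent geometric series.\<close>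
  have "\<forall>k. \<exists>N. \<forall>m\<ge>N. \<forall>n\<ge>N. (LINT x|M. (f m x - f n x)\<^sup>2) < (1/4) ^ k"
    by (intro allI Cauchy) simp
  then obtain s where s: "\<And>k m n. \<lbrakk>m \<ge> s k; n \<ge> s k\<rbrakk> \<Longrightarrow> (LINT x|M. (f m x - f n x)\<^sup>2) < (1/4) ^ k"
    by metis
  \<comment> \<open>Large enough for the threshold \<open>s k\<close> at both ends of the increment
    from \<open>r k\<close> to \<open>r (Suc k)\<close>, and at least \<open>k\<close>, so that the
    subsequence passes every threshold.\<close>
  define r where "r k = (\<Sum>i\<le>k. s i) + k" for k
  have r: "s k \<le> r k" "s k \<le> r (Suc k)" "k \<le> r k" for k
  proof -
    show "s k \<le> r k" unfolding r_def by (intro trans_le_add1 member_le_sum) auto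
    show "s k \<le> r (Suc k)" unfolding r_def by (intro trans_le_add1 member_le_sum) auto
  qed (simp add: r_def)
  define a where "a k x = f (r (Suc k)) x - f (r k) x" for k x
  have [measurable]: "a k \<in> borel_measurable M" for k unfolding a_def by measurable
  have int_a: "integrable M (\<lambda>x. (a k x)\<^sup>2)" for k unfolding a_def by (rule int)
  have "(\<integral>\<^sup>+x. (\<Sum>k. ennreal (2 ^ k * (a k x)\<^sup>2)) \<partial>M) = (\<Sum>k. \<integral>\<^sup>+x. ennreal (2 ^ k * (a k x)\<^sup>2) \<partial>M)"
    by (rule nn_integral_suminf) measurable
  also have "\<dots> \<le> (\<Sum>k. ennreal ((1/2) ^ k))"
  proof (rule suminf_le)
    fix k
    have "(\<integral>\<^sup>+x. ennreal (2 ^ k * (a k x)\<^sup>2) \<partial>M) = ennreal (LINT x|M. 2 ^ k * (a k x)\<^sup>2)"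
      using int_a by (intro nn_integral_eq_integral) auto
    also have "(LINT x|M. 2 ^ k * (a k x)\<^sup>2) \<le> 2 ^ k * (1/4) ^ k"
      using s[OF r(2) r(1), of k] by (simp add: a_def)
    also have "2 ^ k * (1/4 :: real) ^ k = (1/2) ^ k" by (simp flip: power_mult_distrib)
    finally show "(\<integral>\<^sup>+x. ennreal (2 ^ k * (a k x)\<^sup>2) \<partial>M) \<le> ennreal ((1/2) ^ k)" by (simp add: ennreal_leI)
  qed auto
  also have "\<dots> = ennreal (\<Sum>k. (1/2) ^ k)" by (intro suminf_ennreal2) auto
  finally have "(\<integral>\<^sup>+x. (\<Sum>k. ennreal (2 ^ k * (a k x)\<^sup>2)) \<partial>M) \<noteq> \<infinity>" by (auto simp: top_unique)
  then have "AE x in M. (\<Sum>k. ennreal (2 ^ k * (a k x)\<^sup>2)) \<noteq> \<infinity>"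
    by (intro nn_integral_PInf_AE) measurable
  then have conv: "AE x in M. convergent (\<lambda>k. f (r k) x)"
  proof (rule AE_mp, intro AE_I2 impI)
    fix x assume "(\<Sum>k. ennreal (2 ^ k * (a k x)\<^sup>2)) \<noteq> \<infinity>"
    then have "summable (\<lambda>k. 2 ^ k * (a k x)\<^sup>2)" by (intro summable_suminf_not_top) auto
    then have "summable (\<lambda>k. a k x)" by (rule summable_of_weighted_squares)
    then have "convergent (\<lambda>n. \<Sum>k<n. a k x)" by (simp add: summable_iff_convergent)
    then have "convergent (\<lambda>n. f (r n) x - f (r 0) x)" using sum_lessThan_telescope[of "\<lambda>n. f (r n) x"] by (simp add: a_def)
    then show "convergent (\<lambda>k. f (r k) x)"
      using convergent_add[OF _ convergent_const[of "f (r 0) x"]] by fastforce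
  qed
  define g where "g x = lim (\<lambda>k. f (r k) x)" for x
  have g [measurable]: "g \<in> borel_measurable M" unfolding g_def by measurable
  have lim: "AE x in M. (\<lambda>k. f (r k) x) \<longlonglongrightarrow> g x"
    using conv by (simp add: g_def convergent_LIMSEQ_iff)
  have bound: "(\<integral>\<^sup>+x. ennreal ((f n x - g x)\<^sup>2) \<partial>M) \<le> ennreal e"
    if N: "\<And>m n. \<lbrakk>m \<ge> N; n \<ge> N\<rbrakk> \<Longrightarrow> (LINT x|M. (f m x - f n x)\<^sup>2) < e" "n \<ge> N" for n N e
  proof -
    have "(\<integral>\<^sup>+x. ennreal ((f n x - g x)\<^sup>2) \<partial>M) = (\<integral>\<^sup>+x. liminf (\<lambda>k. ennreal ((f n x - f (r k) x)\<^sup>2)) \<partial>M)"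
    proof (rule nn_integral_cong_AE, use lim in eventually_elim)
      fix x assume "(\<lambda>k. f (r k) x) \<longlonglongrightarrow> g x"
      then have "(\<lambda>k. ennreal ((f n x - f (r k) x)\<^sup>2)) \<longlonglongrightarrow> ennreal ((f n x - g x)\<^sup>2)"
        by (intro tendsto_ennrealI tendsto_intros)
      then show "ennreal ((f n x - g x)\<^sup>2) = liminf (\<lambda>k. ennreal ((f n x - f (r k) x)\<^sup>2))"
        by (intro lim_imp_Liminf[symmetric]) auto
    qed
    also have "\<dots> \<le> liminf (\<lambda>k. \<integral>\<^sup>+x. ennreal ((f n x - f (r k) x)\<^sup>2) \<partial>M)"
      by (rule nn_integral_liminf) measurable
    also have "\<dots> \<le> liminf (\<lambda>k. ennreal e)"
    proof (rule Liminf_mono, rule eventually_sequentiallyI)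
      fix k assume "N \<le> k"
      then have "(LINT x|M. (f n x - f (r k) x)\<^sup>2) < e"
        using r(3)[of k] N by (intro N) auto
      then show "(\<integral>\<^sup>+x. ennreal ((f n x - f (r k) x)\<^sup>2) \<partial>M) \<le> ennreal e"
        using int by (subst nn_integral_eq_integral) (auto intro: ennreal_leI)
    qed
    finally show ?thesis by (simp add: Liminf_const)
  qed
  \<comment> \<open>So far \<open>g\<close> is only measurable. Fatou's lemma gives finite distance
    to one member of the sequence, and \<open>(x - y)^2 \<le> 2 x^2 + 2 y^2\<close> carries this to
    all the others.\<close>
  obtain N0 where N0: "\<And>m n. \<lbrakk>m \<ge> N0; n \<ge> N0\<rbrakk> \<Longrightarrow> (LINT x|M. (f m x - f n x)\<^sup>2) < 1"
    using Cauchy[of 1] by auto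
  have "(\<integral>\<^sup>+x. ennreal ((f N0 x - g x)\<^sup>2) \<partial>M) \<le> ennreal 1"
    using N0 by (intro bound[of N0]) auto
  then have int0: "integrable M (\<lambda>x. (f N0 x - g x)\<^sup>2)"
    by (intro integrableI_bounded) (auto simp: less_top[symmetric] top_unique)
  have intg: "integrable M (\<lambda>x. (f n x - g x)\<^sup>2)" for n
  proof (rule Bochner_Integration.integrable_bound)
    show "integrable M (\<lambda>x. 2 * (f n x - f N0 x)\<^sup>2 + 2 * (f N0 x - g x)\<^sup>2)" using int int0 by simp
    show "AE x in M. norm ((f n x - g x)\<^sup>2) \<le> norm (2 * (f n x - f N0 x)\<^sup>2 + 2 * (f N0 x - g x)\<^sup>2)"
    proof (rule AE_I2)
      fix x
      have "0 \<le> ((f n x - f N0 x) - (f N0 x - g x))\<^sup>2" by simp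
      then have "(f n x - g x)\<^sup>2 \<le> 2 * (f n x - f N0 x)\<^sup>2 + 2 * (f N0 x - g x)\<^sup>2"
        by (simp add: power2_eq_square algebra_simps)
      then show "norm ((f n x - g x)\<^sup>2) \<le> norm (2 * (f n x - f N0 x)\<^sup>2 + 2 * (f N0 x - g x)\<^sup>2)" by simp
    qed
  qed measurable
  have "(\<lambda>n. LINT x|M. (f n x - g x)\<^sup>2) \<longlonglongrightarrow> 0"
  proof (rule LIMSEQ_I)
    fix e :: real assume e: "e > 0"
    obtain N where N: "\<And>m n. \<lbrakk>m \<ge> N; n \<ge> N\<rbrakk> \<Longrightarrow> (LINT x|M. (f m x - f n x)\<^sup>2) < e / 2"
      using Cauchy[of "e / 2"] e by auto
    have "norm ((LINT x|M. (f n x - g x)\<^sup>2) - 0) < e" if "n \<ge> N" for n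
    proof -
      have "ennreal (LINT x|M. (f n x - g x)\<^sup>2) \<le> ennreal (e / 2)"
        using bound[of N "e / 2" n] N that intg[of n] by (simp add: nn_integral_eq_integral)
      then have "(LINT x|M. (f n x - g x)\<^sup>2) \<le> e / 2" using e by (subst (asm) ennreal_le_iff) auto
      then show ?thesis using e by simp
    qed
    then show "\<exists>N. \<forall>n\<ge>N. norm ((LINT x|M. (f n x - g x)\<^sup>2) - 0) < e" by blast
  qed
  then show thesis using g intg that by blast
qed

text \<open>Pointwise operations turn both functions and gradient fields into vectors, so that the
  abstract theory of forms applies to them.\<close>

instantiation "fun" :: (type, scaleR) scaleR
begin
definition "scaleR c f = (\<lambda>x. c *\<^sub>R f x)"
instance ..
end

lemma scaleR_fun_apply [simp]: "(c *\<^sub>R f) x = c *\<^sub>R f x"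
  by (simp add: scaleR_fun_def)

instance "fun" :: (type, real_vector) real_vector
  by standard (auto simp: fun_eq_iff scaleR_add_right scaleR_add_left)

lemma sum_fun_apply: "(\<Sum>i\<in>I. f i) x = (\<Sum>i\<in>I. f i x)"
  by (induction I rule: infinite_finite_induct) auto

section \<open>Square-integrable functions with their semidefinite form\<close>

definition L2_inner :: "'a::euclidean_space set \<Rightarrow> ('a \<Rightarrow> real) \<Rightarrow> ('a \<Rightarrow> real) \<Rightarrow> real" where
  "L2_inner \<Omega> u v = (LINT x|lebesgue_on \<Omega>. u x * v x)"

lemma L2_measurable [measurable_dest]: "u \<in> L2 \<Omega> \<Longrightarrow> u \<in> borel_measurable (lebesgue_on \<Omega>)"
  by (simp add: L2_def)

lemma L2_square_integrable: "u \<in> L2 \<Omega> \<Longrightarrow> integrable (lebesgue_on \<Omega>) (\<lambda>x. (u x)\<^sup>2)"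
  by (simp add: L2_def)

lemma L2_integrable_mult:
  assumes "u \<in> L2 \<Omega>" "v \<in> L2 \<Omega>"
  shows "integrable (lebesgue_on \<Omega>) (\<lambda>x. u x * v x)"
proof (rule Bochner_Integration.integrable_bound)
  show "integrable (lebesgue_on \<Omega>) (\<lambda>x. (u x)\<^sup>2 + (v x)\<^sup>2)"
    using assms by (simp add: L2_square_integrable)
  show "(\<lambda>x. u x * v x) \<in> borel_measurable (lebesgue_on \<Omega>)"
    using assms by (auto dest: L2_measurable)
  show "AE x in lebesgue_on \<Omega>. norm (u x * v x) \<le> norm ((u x)\<^sup>2 + (v x)\<^sup>2)"
  proof (rule AE_I2)
    fix x
    have "0 \<le> (\<bar>u x\<bar> - \<bar>v x\<bar>)\<^sup>2" by simp
    then have "2 * (\<bar>u x\<bar> * \<bar>v x\<bar>) \<le> (u x)\<^sup>2 + (v x)\<^sup>2" by (simp add: power2_eq_square algebra_simps)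
    moreover have "0 \<le> \<bar>u x\<bar> * \<bar>v x\<bar>" "0 \<le> (u x)\<^sup>2 + (v x)\<^sup>2" by auto
    ultimately show "norm (u x * v x) \<le> norm ((u x)\<^sup>2 + (v x)\<^sup>2)" unfolding real_norm_def abs_mult by linarith
  qed
qed

lemma subspace_L2: "subspace (L2 \<Omega>)"
proof (unfold subspace_def, intro conjI ballI allI)
  show "0 \<in> L2 \<Omega>" by (simp add: L2_def zero_fun_def)
  fix u v c assume uv: "u \<in> L2 \<Omega>" "v \<in> L2 \<Omega>"
  have "(\<lambda>x. (u x + v x)\<^sup>2) = (\<lambda>x. (u x)\<^sup>2 + 2 * (u x * v x) + (v x)\<^sup>2)"
    by (simp add: power2_eq_square algebra_simps)
  then show "u + v \<in> L2 \<Omega>"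
    using uv L2_integrable_mult[OF uv] by (auto simp: L2_def plus_fun_def)
  show "c *\<^sub>R u \<in> L2 \<Omega>"
    using uv(1) by (auto simp: L2_def scaleR_fun_def power_mult_distrib intro!: borel_measurable_times)
qed

interpretation L2: psd_form "L2 \<Omega>" "L2_inner \<Omega>" for \<Omega> :: "'a::euclidean_space set"
proof
  show "subspace (L2 \<Omega>)" by (rule subspace_L2)
  fix u v w :: "'a \<Rightarrow> real" and c
  show "L2_inner \<Omega> u v = L2_inner \<Omega> v u" by (simp add: L2_inner_def mult.commute)
  show "L2_inner \<Omega> (c *\<^sub>R u) v = c * L2_inner \<Omega> u v" by (simp add: L2_inner_def mult.assoc)
  show "0 \<le> L2_inner \<Omega> u u" by (simp add: L2_inner_def)
  assume "u \<in> L2 \<Omega>" "v \<in> L2 \<Omega>" "w \<in> L2 \<Omega>"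
  then show "L2_inner \<Omega> (u + v) w = L2_inner \<Omega> u w + L2_inner \<Omega> v w"
    by (simp add: L2_inner_def distrib_right L2_integrable_mult)
qed

lemma L2_inner_self_eq_0_iff:
  assumes "u \<in> L2 \<Omega>"
  shows "L2_inner \<Omega> u u = 0 \<longleftrightarrow> (AE x in lebesgue_on \<Omega>. u x = 0)"
  using integral_nonneg_eq_0_iff_AE[OF L2_square_integrable[OF assms]]
  by (simp add: L2_inner_def power2_eq_square)

lemma L2_inner_cong_AE:
  assumes "u \<in> L2 \<Omega>" "u' \<in> L2 \<Omega>" "v \<in> L2 \<Omega>" "v' \<in> L2 \<Omega>"
    and "AE x in lebesgue_on \<Omega>. u x = u' x" "AE x in lebesgue_on \<Omega>. v x = v' x"
  shows "L2_inner \<Omega> u v = L2_inner \<Omega> u' v'"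
  unfolding L2_inner_def
proof (rule integral_cong_AE)
  show "AE x in lebesgue_on \<Omega>. u x * v x = u' x * v' x"
    using assms(5,6) by eventually_elim simp
qed (use assms L2_measurable in auto)

lemma L2_complete:
  fixes f :: "nat \<Rightarrow> 'a::euclidean_space \<Rightarrow> real"
  assumes f: "\<And>n. f n \<in> L2 \<Omega>"
    and Cauchy: "\<And>e. e > 0 \<Longrightarrow> \<exists>N. \<forall>m\<ge>N. \<forall>n\<ge>N. L2_inner \<Omega> (f m - f n) (f m - f n) < e"
  shows "\<exists>g\<in>L2 \<Omega>. (\<lambda>n. L2_inner \<Omega> (f n - g) (f n - g)) \<longlonglongrightarrow> 0"
proof -
  have int: "integrable (lebesgue_on \<Omega>) (\<lambda>x. (f m x - f n x)\<^sup>2)" for m n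
    using L2_square_integrable[of "f m - f n" \<Omega>] f by simp
  have eq: "L2_inner \<Omega> (u - v) (u - v) = (LINT x|lebesgue_on \<Omega>. (u x - v x)\<^sup>2)" for u v
    by (simp add: L2_inner_def power2_eq_square)
  show ?thesis
  proof (rule Cauchy_in_mean_square_converges[of f "lebesgue_on \<Omega>"])
    show "f n \<in> borel_measurable (lebesgue_on \<Omega>)" for n using f by (rule L2_measurable)
    show "\<exists>N. \<forall>m\<ge>N. \<forall>n\<ge>N. (LINT x|lebesgue_on \<Omega>. (f m x - f n x)\<^sup>2) < e" if "e > 0" for e
      using Cauchy[OF that] unfolding eq .
  next
    fix g assume g: "g \<in> borel_measurable (lebesgue_on \<Omega>)"
      "\<And>n. integrable (lebesgue_on \<Omega>) (\<lambda>x. (f n x - g x)\<^sup>2)"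
      "(\<lambda>n. LINT x|lebesgue_on \<Omega>. (f n x - g x)\<^sup>2) \<longlonglongrightarrow> 0"
    \<comment> \<open>Only differences with \<open>g\<close> are known to be square integrable;
      \<open>g\<close> itself is recovered as \<open>f 0 - (f 0 - g)\<close>.\<close>
    have "f 0 - g \<in> L2 \<Omega>" using g f[of 0] by (auto simp: L2_def fun_diff_def)
    then have "f 0 - (f 0 - g) \<in> L2 \<Omega>" by (rule L2.closed(4)[OF f])
    moreover have "f 0 - (f 0 - g) = g" by (simp add: fun_eq_iff)
    ultimately have "g \<in> L2 \<Omega>" by metis
    then show ?thesis using g(3) unfolding eq by blast
  qed (rule int)
qed

subsection \<open>Weak gradients and the Neumann form\<close>

lemma test_function_continuous:
  assumes "test_function \<Omega> \<phi>"
  shows "continuous_on UNIV \<phi>" "\<phi> differentiable (at x)"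
    "b \<in> Basis \<Longrightarrow> continuous_on UNIV (\<lambda>x. frechet_derivative \<phi> (at x) b)"
proof -
  have "Ck 0 \<phi>" "Ck (Suc 0) \<phi>" using assms unfolding test_function_def by blast+
  then show "continuous_on UNIV \<phi>" "\<phi> differentiable (at x)"
    "b \<in> Basis \<Longrightarrow> continuous_on UNIV (\<lambda>x. frechet_derivative \<phi> (at x) b)" by auto
qed

locale bounded_domain =
  fixes \<Omega> :: "'a::euclidean_space set"
  assumes open_dom: "open \<Omega>" and bounded_dom: "bounded \<Omega>"
begin

abbreviation ip where "ip \<equiv> L2_inner \<Omega>"

lemma dom_sets [measurable]: "\<Omega> \<in> sets lebesgue" and dom_lmeasurable: "\<Omega> \<in> lmeasurable"
  using open_dom bounded_dom by (auto intro: lmeasurable_open)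

lemma finite_measure_dom: "finite_measure (lebesgue_on \<Omega>)"
  using dom_lmeasurable by (rule finite_measure_lebesgue_on)

lemma continuous_in_L2:
  fixes f :: "'a \<Rightarrow> real"
  assumes f: "continuous_on UNIV f"
  shows "f \<in> L2 \<Omega>"
proof -
  interpret finite_measure "lebesgue_on \<Omega>" by (rule finite_measure_dom)
  have m: "f \<in> borel_measurable (lebesgue_on \<Omega>)"
    using f by (intro continuous_imp_measurable_on_sets_lebesgue dom_sets)
      (auto intro: continuous_on_subset)
  have "compact (f ` closure \<Omega>)"
    using bounded_dom by (intro compact_continuous_image continuous_on_subset[OF f]) (auto simp: compact_closure)
  then obtain B where "\<And>x. x \<in> closure \<Omega> \<Longrightarrow> norm (f x) \<le> B"
    by (metis bounded_iff compact_imp_bounded imageI)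
  then have B: "\<bar>f x\<bar> \<le> B" if "x \<in> \<Omega>" for x using that closure_subset by fastforce
  have "integrable (lebesgue_on \<Omega>) (\<lambda>x. (f x)\<^sup>2)"
  proof (rule integrable_const_bound)
    show "AE x in lebesgue_on \<Omega>. norm ((f x)\<^sup>2) \<le> B\<^sup>2"
    proof (rule AE_I2)
      fix x assume "x \<in> space (lebesgue_on \<Omega>)"
      then have "\<bar>f x\<bar> ^ 2 \<le> B ^ 2" using B by (intro power_mono) auto
      then show "norm ((f x)\<^sup>2) \<le> B\<^sup>2" by simp
    qed
  qed (use m in measurable)
  then show ?thesis using m by (simp add: L2_def)
qed

lemma test_function_in_L2:
  assumes "test_function \<Omega> \<phi>"
  shows "\<phi> \<in> L2 \<Omega>" "b \<in> Basis \<Longrightarrow> (\<lambda>x. frechet_derivative \<phi> (at x) b) \<in> L2 \<Omega>"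
  using assms by (auto intro: continuous_in_L2 test_function_continuous)

lemma L2_const: "(\<lambda>x. c) \<in> L2 \<Omega>"
  by (intro continuous_in_L2 continuous_intros)

lemma L2_integrable: "u \<in> L2 \<Omega> \<Longrightarrow> integrable (lebesgue_on \<Omega>) u"
  using L2_integrable_mult[OF L2_const[of 1]] by simp

lemma has_weak_gradient_iff:
  "has_weak_gradient \<Omega> u g \<longleftrightarrow> (\<forall>b\<in>Basis. (\<lambda>x. g x \<bullet> b) \<in> L2 \<Omega> \<and>
     (\<forall>\<phi>. test_function \<Omega> \<phi> \<longrightarrow>
        ip u (\<lambda>x. frechet_derivative \<phi> (at x) b) = - ip (\<lambda>x. g x \<bullet> b) \<phi>))"
  by (simp add: has_weak_gradient_def L2_inner_def)

lemma has_weak_gradient_L2: "\<lbrakk>has_weak_gradient \<Omega> u g; b \<in> Basis\<rbrakk> \<Longrightarrow> (\<lambda>x. g x \<bullet> b) \<in> L2 \<Omega>"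
  by (simp add: has_weak_gradient_iff)

lemma has_weak_gradient_zero: "has_weak_gradient \<Omega> 0 0"
  by (auto simp: has_weak_gradient_iff L2_inner_def intro: L2_const)

lemma has_weak_gradient_add:
  assumes "u \<in> L2 \<Omega>" "v \<in> L2 \<Omega>" "has_weak_gradient \<Omega> u g" "has_weak_gradient \<Omega> v h"
  shows "has_weak_gradient \<Omega> (u + v) (g + h)"
proof -
  have "(\<lambda>x. (g + h) x \<bullet> b) = (\<lambda>x. g x \<bullet> b) + (\<lambda>x. h x \<bullet> b)" for b
    by (simp add: fun_eq_iff inner_add_left)
  then show ?thesis
    using assms unfolding has_weak_gradient_iff
    by (auto simp: L2.add_left test_function_in_L2)
qed

lemma has_weak_gradient_scale:
  assumes "u \<in> L2 \<Omega>" "has_weak_gradient \<Omega> u g"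
  shows "has_weak_gradient \<Omega> (c *\<^sub>R u) (c *\<^sub>R g)"
proof -
  have "(\<lambda>x. (c *\<^sub>R g) x \<bullet> b) = c *\<^sub>R (\<lambda>x. g x \<bullet> b)" for b
    by (simp add: fun_eq_iff)
  then show ?thesis
    using assms unfolding has_weak_gradient_iff
    by (auto simp: L2.scale_left test_function_in_L2)
qed

lemma has_weak_gradient_diff:
  assumes "u \<in> L2 \<Omega>" "v \<in> L2 \<Omega>" "has_weak_gradient \<Omega> u g" "has_weak_gradient \<Omega> v h"
  shows "has_weak_gradient \<Omega> (u - v) (g - h)"
  using has_weak_gradient_add[OF assms(1) _ assms(3) has_weak_gradient_scale[OF assms(2,4), of "-1"]]
    assms(2) by simp

lemma H1_L2: "u \<in> H1 \<Omega> \<Longrightarrow> u \<in> L2 \<Omega>"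
  by (simp add: H1_def)

lemma weak_gradient: "u \<in> H1 \<Omega> \<Longrightarrow> has_weak_gradient \<Omega> u (weak_gradient \<Omega> u)"
  unfolding H1_def weak_gradient_def by (metis (mono_tags, lifting) mem_Collect_eq someI_ex)

lemma subspace_H1: "subspace (H1 \<Omega>)"
  unfolding subspace_def H1_def
  using has_weak_gradient_zero has_weak_gradient_add has_weak_gradient_scale by fastforce

text \<open>The defining identity pairs the function and its gradient with fixed test functions, and
  both pairings are continuous in \<open>L2\<close>: the weak gradient is a closed operator.\<close>

lemma has_weak_gradient_limit:
  assumes u: "\<And>n. u n \<in> L2 \<Omega>" "\<And>n. has_weak_gradient \<Omega> (u n) (g n)" "w \<in> L2 \<Omega>"
    and G: "\<And>b. b \<in> Basis \<Longrightarrow> G b \<in> L2 \<Omega>"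
    and lim: "(\<lambda>n. ip (u n - w) (u n - w)) \<longlonglongrightarrow> 0"
      "\<And>b. b \<in> Basis \<Longrightarrow> (\<lambda>n. ip ((\<lambda>x. g n x \<bullet> b) - G b) ((\<lambda>x. g n x \<bullet> b) - G b)) \<longlonglongrightarrow> 0"
  shows "has_weak_gradient \<Omega> w (\<lambda>x. \<Sum>b\<in>Basis. G b x *\<^sub>R b)"
  unfolding has_weak_gradient_iff
proof (intro ballI conjI allI impI)
  fix b :: 'a assume b: "b \<in> Basis"
  have e: "(\<lambda>x. (\<Sum>b\<in>Basis. G b x *\<^sub>R b) \<bullet> b) = G b" using b by simp
  show "(\<lambda>x. (\<Sum>b\<in>Basis. G b x *\<^sub>R b) \<bullet> b) \<in> L2 \<Omega>" unfolding e using G b .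
  fix \<phi> assume \<phi>: "test_function \<Omega> \<phi>"
  have "(\<lambda>n. ip (u n) (\<lambda>x. frechet_derivative \<phi> (at x) b)) \<longlonglongrightarrow> ip w (\<lambda>x. frechet_derivative \<phi> (at x) b)"
    using u lim test_function_in_L2(2)[OF \<phi> b] by (intro L2.tendsto_left)
  moreover have "(\<lambda>n. - ip (\<lambda>x. g n x \<bullet> b) \<phi>) \<longlonglongrightarrow> - ip (G b) \<phi>"
    using G lim b has_weak_gradient_L2[OF u(2) b] test_function_in_L2(1)[OF \<phi>]
    by (intro tendsto_minus L2.tendsto_left)
  moreover have "ip (u n) (\<lambda>x. frechet_derivative \<phi> (at x) b) = - ip (\<lambda>x. g n x \<bullet> b) \<phi>" for n
    using u(2)[of n] b \<phi> by (simp add: has_weak_gradient_iff)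
  ultimately show "ip w (\<lambda>x. frechet_derivative \<phi> (at x) b) = - ip (\<lambda>x. (\<Sum>b\<in>Basis. G b x *\<^sub>R b) \<bullet> b) \<phi>"
    unfolding e using LIMSEQ_unique by simp
qed

end

text \<open>\<open>weak_gradient\<close> is an arbitrary choice, so bilinearity of the Dirichlet
  form and its computation from explicit gradients rest on uniqueness almost everywhere. For
  parallelograms it is proved below from orthogonality to test functions.\<close>

locale neumann_domain = bounded_domain +
  assumes weak_gradient_unique:
    "\<lbrakk>has_weak_gradient \<Omega> u g; has_weak_gradient \<Omega> u h\<rbrakk> \<Longrightarrow> AE x in lebesgue_on \<Omega>. g x = h x"
begin

abbreviation D where "D \<equiv> dirichlet_form \<Omega>"

lemma dirichlet_form_eq:
  assumes u: "u \<in> L2 \<Omega>" "has_weak_gradient \<Omega> u g" and v: "v \<in> L2 \<Omega>" "has_weak_gradient \<Omega> v h"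
  shows "D u v = (\<Sum>b\<in>Basis. ip (\<lambda>x. g x \<bullet> b) (\<lambda>x. h x \<bullet> b))"
proof -
  let ?g = "weak_gradient \<Omega> u" and ?h = "weak_gradient \<Omega> v"
  have wg: "has_weak_gradient \<Omega> u ?g" "has_weak_gradient \<Omega> v ?h"
    using u v by (auto intro!: weak_gradient simp: H1_def)
  have "D u v = (LINT x|lebesgue_on \<Omega>. (\<Sum>b\<in>Basis. (?g x \<bullet> b) * (?h x \<bullet> b)))"
    unfolding dirichlet_form_def by (subst euclidean_inner) simp
  also have "\<dots> = (\<Sum>b\<in>Basis. ip (\<lambda>x. ?g x \<bullet> b) (\<lambda>x. ?h x \<bullet> b))"
    using wg unfolding L2_inner_def
    by (intro Bochner_Integration.integral_sum L2_integrable_mult has_weak_gradient_L2)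
  also have "\<dots> = (\<Sum>b\<in>Basis. ip (\<lambda>x. g x \<bullet> b) (\<lambda>x. h x \<bullet> b))"
  proof (rule sum.cong[OF refl], rule L2_inner_cong_AE)
    fix b :: 'a assume b: "b \<in> Basis"
    show "AE x in lebesgue_on \<Omega>. ?g x \<bullet> b = g x \<bullet> b"
      using weak_gradient_unique[OF wg(1) u(2)] by eventually_elim simp
    show "AE x in lebesgue_on \<Omega>. ?h x \<bullet> b = h x \<bullet> b"
      using weak_gradient_unique[OF wg(2) v(2)] by eventually_elim simp
  qed (use wg u v has_weak_gradient_L2 in auto)
  finally show ?thesis .
qed

lemma dirichlet_form_H1:
  assumes "u \<in> H1 \<Omega>" "v \<in> H1 \<Omega>"
  shows "D u v = (\<Sum>b\<in>Basis. ip (\<lambda>x. weak_gradient \<Omega> u x \<bullet> b) (\<lambda>x. weak_gradient \<Omega> v x \<bullet> b))"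
  using assms by (intro dirichlet_form_eq weak_gradient H1_L2)

sublocale form_pair "H1 \<Omega>" ip D
proof
  show "subspace (H1 \<Omega>)" by (rule subspace_H1)
next
  fix u v assume uv: "u \<in> H1 \<Omega>" "v \<in> H1 \<Omega>"
  show "ip u v = ip v u" using uv by (intro L2.sym H1_L2)
  show "ip (c *\<^sub>R u) v = c * ip u v" for c using uv by (intro L2.scale_left H1_L2)
  show "ip (u + v) w = ip u w + ip v w" if "w \<in> H1 \<Omega>" for w
    using uv that by (intro L2.add_left H1_L2)
  show "D u v = D v u" by (simp add: dirichlet_form_def inner_commute)
  have L: "(\<lambda>x. weak_gradient \<Omega> w x \<bullet> b) \<in> L2 \<Omega>" if "b \<in> Basis" "w \<in> H1 \<Omega>" for b w
    using that by (intro has_weak_gradient_L2[OF weak_gradient])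
  show "D (c *\<^sub>R u) v = c * D u v" for c
  proof -
    have "D (c *\<^sub>R u) v = (\<Sum>b\<in>Basis. ip (\<lambda>x. (c *\<^sub>R weak_gradient \<Omega> u) x \<bullet> b) (\<lambda>x. weak_gradient \<Omega> v x \<bullet> b))"
      using uv by (intro dirichlet_form_eq has_weak_gradient_scale weak_gradient H1_L2 L2.closed)
    also have "\<dots> = (\<Sum>b\<in>Basis. c * ip (\<lambda>x. weak_gradient \<Omega> u x \<bullet> b) (\<lambda>x. weak_gradient \<Omega> v x \<bullet> b))"
      by (intro sum.cong) (auto simp: L2_inner_def mult.assoc)
    finally show ?thesis using uv by (simp add: dirichlet_form_H1 sum_distrib_left)
  qed
  show "D (u + v) w = D u w + D v w" if w: "w \<in> H1 \<Omega>" for w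
  proof -
    have "D (u + v) w = (\<Sum>b\<in>Basis. ip (\<lambda>x. (weak_gradient \<Omega> u + weak_gradient \<Omega> v) x \<bullet> b) (\<lambda>x. weak_gradient \<Omega> w x \<bullet> b))"
      using uv w by (intro dirichlet_form_eq has_weak_gradient_add weak_gradient H1_L2 L2.closed)
    also have "\<dots> = (\<Sum>b\<in>Basis. ip (\<lambda>x. weak_gradient \<Omega> u x \<bullet> b) (\<lambda>x. weak_gradient \<Omega> w x \<bullet> b) +
        ip (\<lambda>x. weak_gradient \<Omega> v x \<bullet> b) (\<lambda>x. weak_gradient \<Omega> w x \<bullet> b))"
    proof (rule sum.cong[OF refl])
      fix b :: 'a assume b: "b \<in> Basis"
      have "(\<lambda>x. (weak_gradient \<Omega> u + weak_gradient \<Omega> v) x \<bullet> b) =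
          (\<lambda>x. weak_gradient \<Omega> u x \<bullet> b) + (\<lambda>x. weak_gradient \<Omega> v x \<bullet> b)"
        by (simp add: fun_eq_iff inner_add_left)
      then show "ip (\<lambda>x. (weak_gradient \<Omega> u + weak_gradient \<Omega> v) x \<bullet> b) (\<lambda>x. weak_gradient \<Omega> w x \<bullet> b) =
        ip (\<lambda>x. weak_gradient \<Omega> u x \<bullet> b) (\<lambda>x. weak_gradient \<Omega> w x \<bullet> b) +
        ip (\<lambda>x. weak_gradient \<Omega> v x \<bullet> b) (\<lambda>x. weak_gradient \<Omega> w x \<bullet> b)"
        using uv w b by (simp add: L2.add_left L)
    qed
    finally show ?thesis using uv w by (simp add: dirichlet_form_H1 sum.distrib)
  qed
next
  fix u assume u: "u \<in> H1 \<Omega>"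
  show "0 \<le> ip u u" using u by (intro L2.nonneg H1_L2)
  show "0 \<le> D u u" by (simp add: dirichlet_form_def)
qed

text \<open>Cauchy for \<open>D\<close> means Cauchy in each gradient component. The limits of the
  components form the weak gradient of the \<open>L2\<close> limit, since the weak gradient is
  closed.\<close>

lemma H1_complete:
  assumes v: "\<And>n. v n \<in> H1 \<Omega>"
    and q: "\<And>e. e > 0 \<Longrightarrow> \<exists>N. \<forall>i\<ge>N. \<forall>j\<ge>N. ip (v i - v j) (v i - v j) < e"
    and d: "\<And>e. e > 0 \<Longrightarrow> \<exists>N. \<forall>i\<ge>N. \<forall>j\<ge>N. D (v i - v j) (v i - v j) < e"
  shows "\<exists>w\<in>H1 \<Omega>. (\<lambda>n::nat. ip (v n - w) (v n - w)) \<longlonglongrightarrow> 0 \<and> (\<lambda>n. D (v n - w) (v n - w)) \<longlonglongrightarrow> 0"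
proof -
  obtain w where w: "w \<in> L2 \<Omega>" "(\<lambda>n. ip (v n - w) (v n - w)) \<longlonglongrightarrow> 0"
    using L2_complete[of v \<Omega>] v q H1_L2 by blast
  define g where "g n = weak_gradient \<Omega> (v n)" for n
  have g: "has_weak_gradient \<Omega> (v n) (g n)" for n unfolding g_def using v by (rule weak_gradient)
  have L: "(\<lambda>x. g n x \<bullet> b) \<in> L2 \<Omega>" if "b \<in> Basis" for n b
    using has_weak_gradient_L2[OF g that] .
  have Deq: "D (v i - v j) (v i - v j) =
      (\<Sum>b\<in>Basis. ip ((\<lambda>x. g i x \<bullet> b) - (\<lambda>x. g j x \<bullet> b)) ((\<lambda>x. g i x \<bullet> b) - (\<lambda>x. g j x \<bullet> b)))" for i j
  proof -
    have "D (v i - v j) (v i - v j) = (\<Sum>b\<in>Basis. ip (\<lambda>x. (g i - g j) x \<bullet> b) (\<lambda>x. (g i - g j) x \<bullet> b))"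
      using v g by (intro dirichlet_form_eq has_weak_gradient_diff L2.closed H1_L2)
    then show ?thesis by (simp add: fun_diff_def inner_diff_left)
  qed
  have "\<exists>G\<in>L2 \<Omega>. (\<lambda>n. ip ((\<lambda>x. g n x \<bullet> b) - G) ((\<lambda>x. g n x \<bullet> b) - G)) \<longlonglongrightarrow> 0" if b: "b \<in> Basis" for b
  proof (rule L2_complete)
    fix e :: real assume "e > 0"
    then obtain N where N: "\<forall>i\<ge>N. \<forall>j\<ge>N. D (v i - v j) (v i - v j) < e" using d by blast
    have "ip ((\<lambda>x. g i x \<bullet> b) - (\<lambda>x. g j x \<bullet> b)) ((\<lambda>x. g i x \<bullet> b) - (\<lambda>x. g j x \<bullet> b)) \<le> D (v i - v j) (v i - v j)" for i j
      unfolding Deq using b L by (intro member_le_sum) (auto intro!: L2.nonneg L2.closed)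
    then show "\<exists>N. \<forall>i\<ge>N. \<forall>j\<ge>N. ip ((\<lambda>x. g i x \<bullet> b) - (\<lambda>x. g j x \<bullet> b)) ((\<lambda>x. g i x \<bullet> b) - (\<lambda>x. g j x \<bullet> b)) < e"
      using N by (intro exI[of _ N]) (meson le_less_trans)
  qed (use b L in auto)
  then have "\<exists>G. \<forall>b\<in>Basis. G b \<in> L2 \<Omega> \<and>
      (\<lambda>n. ip ((\<lambda>x. g n x \<bullet> b) - G b) ((\<lambda>x. g n x \<bullet> b) - G b)) \<longlonglongrightarrow> 0"
    by (intro bchoice ballI) blast
  then obtain G where G: "\<And>b. b \<in> Basis \<Longrightarrow> G b \<in> L2 \<Omega>"
    "\<And>b. b \<in> Basis \<Longrightarrow> (\<lambda>n. ip ((\<lambda>x. g n x \<bullet> b) - G b) ((\<lambda>x. g n x \<bullet> b) - G b)) \<longlonglongrightarrow> 0"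
    by blast
  define h where "h = (\<lambda>x. \<Sum>b\<in>Basis. G b x *\<^sub>R b)"
  have h: "has_weak_gradient \<Omega> w h"
    unfolding h_def using v g w G H1_L2 by (intro has_weak_gradient_limit[of v g]) auto
  have hb: "h x \<bullet> b = G b x" if "b \<in> Basis" for b x using that by (simp add: h_def)
  have "D (v n - w) (v n - w) = (\<Sum>b\<in>Basis. ip ((\<lambda>x. g n x \<bullet> b) - G b) ((\<lambda>x. g n x \<bullet> b) - G b))" for n
  proof -
    have "D (v n - w) (v n - w) = (\<Sum>b\<in>Basis. ip (\<lambda>x. (g n - h) x \<bullet> b) (\<lambda>x. (g n - h) x \<bullet> b))"
      using v[THEN H1_L2] g h w by (intro dirichlet_form_eq has_weak_gradient_diff L2.closed(4))
    then show ?thesis by (simp add: fun_diff_def inner_diff_left hb)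
  qed
  moreover have "(\<lambda>n. \<Sum>b\<in>Basis. ip ((\<lambda>x. g n x \<bullet> b) - G b) ((\<lambda>x. g n x \<bullet> b) - G b)) \<longlonglongrightarrow> (\<Sum>b\<in>(Basis :: 'a set). 0)"
    by (intro tendsto_sum G)
  ultimately have "(\<lambda>n. D (v n - w) (v n - w)) \<longlonglongrightarrow> 0" by simp
  then show ?thesis using w h by (auto simp: H1_def)
qed

lemma neumann_eigenspace_eq: "neumann_eigenspace \<Omega> t = eig t"
proof -
  have "(\<lambda>x. t * u x) \<in> L2 \<Omega>" if "u \<in> H1 \<Omega>" for u
    using L2.closed(3)[OF H1_L2[OF that], of t] by (simp add: scaleR_fun_def)
  then show ?thesis
    by (auto simp: neumann_eigenspace_def neumann_laplacian_def eig_def L2_inner_def mult.assoc)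
qed

lemma L2_independent_iff:
  assumes "\<And>i. i < n \<Longrightarrow> u i \<in> H1 \<Omega>"
  shows "L2_independent \<Omega> n u \<longleftrightarrow> q_independent n u"
proof -
  have "(\<Sum>i<n. c i *\<^sub>R u i) \<in> L2 \<Omega>" for c using assms H1_L2 by (intro L2.closed_sum L2.closed) auto
  from L2_inner_self_eq_0_iff[OF this] show ?thesis
    by (simp add: L2_independent_def q_independent_def sum_fun_apply)
qed

lemma neumann_multiplicity_eq: "neumann_multiplicity \<Omega> t = multiplicity t"
proof -
  have "{n. \<exists>u. (\<forall>i<n. u i \<in> neumann_eigenspace \<Omega> t) \<and> L2_independent \<Omega> n u} =
      {n. \<exists>u. (\<forall>i<n. u i \<in> eig t) \<and> q_independent n u}"
    unfolding neumann_eigenspace_eq using L2_independent_iff eig_in_S by blast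
  then show ?thesis by (simp add: neumann_multiplicity_def multiplicity_def)
qed

lemma neumann_mu_eigensystem:
  assumes "eigensystem n u m" "k < n"
  shows "neumann_mu \<Omega> (Suc k) = m k"
  using eigensystem_Inf_count[OF assms]
  by (simp add: neumann_mu_def neumann_count_def eigenvalue_count_def neumann_multiplicity_eq)

end

subsection \<open>Smooth cutoffs\<close>

lemma frechet_derivative_Basis_expansion:
  fixes f :: "'a::euclidean_space \<Rightarrow> real"
  assumes "f differentiable (at x)"
  shows "frechet_derivative f (at x) v = (\<Sum>b\<in>Basis. (v \<bullet> b) * frechet_derivative f (at x) b)"
proof -
  have "linear (frechet_derivative f (at x))" using assms by (rule linear_frechet_derivative)
  then have "frechet_derivative f (at x) (\<Sum>b\<in>Basis. (v \<bullet> b) *\<^sub>R b) =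
      (\<Sum>b\<in>Basis. (v \<bullet> b) * frechet_derivative f (at x) b)"
    by (simp add: linear_sum linear_scale)
  then show ?thesis by (simp add: euclidean_representation)
qed

lemma Ck_Suc_D: "Ck (Suc k) f \<Longrightarrow> Ck k f"
proof (induction k arbitrary: f)
  case 0
  then show ?case
    by (auto intro!: continuous_at_imp_continuous_on differentiable_imp_continuous_within)
qed auto

lemma Ck_const: "Ck k (\<lambda>x. c)"
  by (induction k arbitrary: c) auto

lemma Ck_add: "\<lbrakk>Ck k f; Ck k g\<rbrakk> \<Longrightarrow> Ck k (\<lambda>x. f x + g x)"
proof (induction k arbitrary: f g)
  case 0
  then show ?case by (auto intro: continuous_intros)
next
  case (Suc k)
  then have "frechet_derivative (\<lambda>x. f x + g x) (at x) =
      (\<lambda>b. frechet_derivative f (at x) b + frechet_derivative g (at x) b)" for x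
    by (auto intro!: frechet_derivative_at[symmetric] has_derivative_add simp: frechet_derivative_works[symmetric])
  then show ?case using Suc by auto
qed

lemma Ck_mult: "\<lbrakk>Ck k f; Ck k g\<rbrakk> \<Longrightarrow> Ck k (\<lambda>x. f x * g x)"
proof (induction k arbitrary: f g)
  case 0
  then show ?case by (auto intro: continuous_intros)
next
  case (Suc k)
  then have "frechet_derivative (\<lambda>x. f x * g x) (at x) =
      (\<lambda>b. f x * frechet_derivative g (at x) b + frechet_derivative f (at x) b * g x)" for x
    by (auto intro!: frechet_derivative_at[symmetric] has_derivative_mult simp: frechet_derivative_works[symmetric])
  moreover have "Ck k f" "Ck k g" using Suc Ck_Suc_D by auto
  ultimately show ?case using Suc by (auto intro: Ck_add)
qed

text \<open>The coordinates of a parallelogram have the form \<open>c + v \<bullet> x\<close>, so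
  every profile of one coordinate used below is such a ridge function, with gradient along
  \<open>v\<close>.\<close>

lemma has_derivative_ridge:
  fixes v :: "'a::euclidean_space"
  assumes "(h has_real_derivative h') (at (c + v \<bullet> x))"
  shows "((\<lambda>x. h (c + v \<bullet> x)) has_derivative (\<lambda>b. (v \<bullet> b) * h')) (at x)"
proof -
  have "((\<lambda>x. c + v \<bullet> x) has_derivative (\<lambda>b. v \<bullet> b)) (at x)"
    by (auto intro!: derivative_eq_intros)
  note has_derivative_compose[where g = h, OF this assms[unfolded has_field_derivative_def]]
  moreover have "(\<lambda>b. h' * (v \<bullet> b)) = (\<lambda>b. (v \<bullet> b) * h')" by (simp add: mult.commute)
  ultimately show ?thesis by simp
qed

text \<open>Stated for a whole chain of derivatives \<open>h n\<close>, so that the induction on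
  \<open>k\<close> can pass to the next member.\<close>

lemma Ck_ridge:
  fixes v :: "'a::euclidean_space"
  assumes "\<And>n x. (h n has_real_derivative h (Suc n) x) (at x)"
  shows "Ck k (\<lambda>x. h n (c + v \<bullet> x))"
proof (induction k arbitrary: n)
  case 0
  have "continuous_on UNIV (h n)" by (intro DERIV_continuous_on[OF assms[THEN DERIV_subset]]) auto
  then have "continuous_on UNIV (\<lambda>x. h n (c + v \<bullet> x))"
    by (rule continuous_on_compose2) (auto intro!: continuous_intros)
  then show ?case by simp
next
  case (Suc k)
  have d: "((\<lambda>x. h n (c + v \<bullet> x)) has_derivative (\<lambda>b. (v \<bullet> b) * h (Suc n) (c + v \<bullet> x))) (at x)" for x
    using assms by (rule has_derivative_ridge)
  then show ?case using Suc Ck_mult[OF Ck_const Suc.IH]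
    by (auto simp: frechet_derivative_at[OF d, symmetric] intro!: differentiableI)
qed

text \<open>The span of these functions is closed under differentiation.\<close>

definition flat :: "nat \<Rightarrow> real \<Rightarrow> real" where
  "flat k x = (if x > 0 then exp (- (1 / x)) / x ^ k else 0)"

lemma flat_tendsto_0: "(flat k \<longlongrightarrow> 0) (at 0)"
proof -
  have "((\<lambda>y. y ^ k / exp y) \<longlongrightarrow> (0::real)) at_top" by (rule tendsto_power_div_exp_0)
  then have "((\<lambda>x. inverse x ^ k / exp (inverse x)) \<longlongrightarrow> (0::real)) (at_right 0)"
    using filterlim_compose[OF _ filterlim_inverse_at_top_right] by blast
  then have "(flat k \<longlongrightarrow> 0) (at_right 0)"
    by (rule tendsto_cong[THEN iffD1, rotated])
      (auto simp: flat_def eventually_at_right_field exp_minus field_simps intro!: exI[of _ 1])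
  moreover have "(flat k \<longlongrightarrow> 0) (at_left 0)"
    by (rule tendsto_eventually) (auto simp: flat_def eventually_at_left_field intro!: exI[of _ "-1"])
  ultimately show ?thesis by (simp add: filterlim_split_at)
qed

lemma flat_has_derivative:
  "(flat k has_real_derivative flat (k + 2) x - real k * flat (k + 1) x) (at x)"
proof -
  consider "x > 0" | "x < 0" | "x = 0" by linarith
  then show ?thesis
  proof cases
    case 1
    have "((\<lambda>x. exp (- (1 / x)) / x ^ k) has_real_derivative flat (k + 2) x - real k * flat (k + 1) x) (at x)"
    proof -
      have e: "((\<lambda>x. exp (- (1 / x))) has_real_derivative exp (- (1 / x)) * (1 / x\<^sup>2)) (at x)"
        using 1 by (auto intro!: derivative_eq_intros simp: power2_eq_square)
      have p: "((\<lambda>x. x ^ k) has_real_derivative real k * x ^ k / x) (at x)"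
        using DERIV_pow[of k x] 1 by (cases k) auto
      show ?thesis
        using 1 by (intro DERIV_cong[OF DERIV_divide[OF e p]])
          (auto simp: flat_def power_add field_simps power2_eq_square)
    qed
    then show ?thesis
      by (rule has_field_derivative_transform_within_open[of _ _ _ "{0<..}"]) (use 1 in \<open>auto simp: flat_def\<close>)
  next
    case 2
    have "((\<lambda>x. 0) has_real_derivative 0) (at x)" by simp
    then have "(flat k has_real_derivative 0) (at x)"
      by (rule has_field_derivative_transform_within_open[of _ _ _ "{..<0}"]) (use 2 in \<open>auto simp: flat_def\<close>)
    then show ?thesis using 2 by (simp add: flat_def)
  next
    case 3
    \<comment> \<open>The difference quotient at 0 is again a member of the family, so the
      derivative there is the limit of that member. At \<open>h = 0\<close> the default value of
      division agrees with its value 0.\<close>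
    have "(\<lambda>h. (flat k (0 + h) - flat k 0) / h) = flat (k + 1)"
      by (auto simp: flat_def fun_eq_iff)
    then have "(flat k has_real_derivative 0) (at 0)"
      unfolding DERIV_def using flat_tendsto_0[of "k + 1"] by simp
    then show ?thesis using 3 by (simp add: flat_def)
  qed
qed

lemma Ck_flat: "Ck k (\<lambda>x::'a::euclidean_space. flat m (c + v \<bullet> x))"
proof (induction k arbitrary: m)
  case 0
  have "continuous_on UNIV (flat m)" by (intro DERIV_continuous_on[OF flat_has_derivative[THEN DERIV_subset]]) auto
  then have "continuous_on UNIV (\<lambda>x. flat m (c + v \<bullet> x))"
    by (rule continuous_on_compose2) (auto intro!: continuous_intros)
  then show ?case by simp
next
  case (Suc k)
  have d: "((\<lambda>x. flat m (c + v \<bullet> x)) has_derivative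
      (\<lambda>b. (v \<bullet> b) * (flat (m + 2) (c + v \<bullet> x) - real m * flat (m + 1) (c + v \<bullet> x)))) (at x)" for x
    using flat_has_derivative by (rule has_derivative_ridge)
  show ?case
    unfolding Ck.simps
  proof (intro conjI allI ballI)
    show "(\<lambda>x. flat m (c + v \<bullet> x)) differentiable (at x)" for x using d by (rule differentiableI)
    fix b :: 'a
    have "Ck k (\<lambda>x. (v \<bullet> b) * (flat (m + 2) (c + v \<bullet> x) + (- real m) * flat (m + 1) (c + v \<bullet> x)))"
      by (intro Ck_mult Ck_add Ck_const Suc.IH)
    moreover have "(\<lambda>x. frechet_derivative (\<lambda>x. flat m (c + v \<bullet> x)) (at x) b) =
        (\<lambda>x. (v \<bullet> b) * (flat (m + 2) (c + v \<bullet> x) + (- real m) * flat (m + 1) (c + v \<bullet> x)))"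
      unfolding frechet_derivative_at[OF d, symmetric] by simp
    ultimately show "Ck k (\<lambda>x. frechet_derivative (\<lambda>x. flat m (c + v \<bullet> x)) (at x) b)" by (simp only:)
  qed
qed

lemma Ck_cos: "Ck k (\<lambda>x::'a::euclidean_space. cos (w * (c + v \<bullet> x) + e))"
proof -
  \<comment> \<open>Each differentiation of the cosine is a quarter-turn of the phase, which gives
    one formula for all derivatives.\<close>
  have "((\<lambda>y. w ^ n * cos (w * y + e + real n * (pi / 2))) has_real_derivative
      w ^ Suc n * cos (w * y + e + real (Suc n) * (pi / 2))) (at y)" for n y
  proof -
    have "cos (w * y + e + real (Suc n) * (pi / 2)) = - sin (w * y + e + real n * (pi / 2))"
      using cos_add[of "w * y + e + real n * (pi / 2)" "pi / 2"] by (simp add: algebra_simps add_divide_distrib)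
    then show ?thesis by (auto intro!: derivative_eq_intros)
  qed
  from Ck_ridge[of "\<lambda>n y. w ^ n * cos (w * y + e + real n * (pi / 2))", OF this, of k 0 c v]
  show ?thesis by simp
qed

lemma Ck_sin: "Ck k (\<lambda>x::'a::euclidean_space. sin (w * (c + v \<bullet> x)))"
proof -
  have "sin (w * (c + v \<bullet> x)) = cos (w * (c + v \<bullet> x) + (- pi / 2))" for x
    by (simp add: cos_diff)
  then show ?thesis using Ck_cos[of k w c v "- pi / 2"] by simp
qed

text \<open>No plateau is needed: \<open>exp(-1/x)\<close> itself tends to 1 at infinity, hence so does the cutoff
  at every point of \<open>(0,1)\<close>.\<close>

definition cutoff :: "nat \<Rightarrow> real \<Rightarrow> real" where
  "cutoff n s = flat 0 (real n * s - 1) * flat 0 (real n * (1 - s) - 1)"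

definition cutoff' :: "nat \<Rightarrow> real \<Rightarrow> real" where
  "cutoff' n s = real n * flat 2 (real n * s - 1) * flat 0 (real n * (1 - s) - 1)
     - real n * flat 0 (real n * s - 1) * flat 2 (real n * (1 - s) - 1)"

lemma cutoff_has_derivative: "(cutoff n has_real_derivative cutoff' n s) (at s)"
proof -
  have f: "(flat 0 has_real_derivative flat 2 x) (at x)" for x
    using flat_has_derivative[of 0 x] by (simp add: numeral_2_eq_2)
  have 1: "((\<lambda>s. flat 0 (real n * s - 1)) has_real_derivative flat 2 (real n * s - 1) * real n) (at s)"
    by (rule DERIV_chain2[OF f]) (auto intro!: derivative_eq_intros)
  have 2: "((\<lambda>s. flat 0 (real n * (1 - s) - 1)) has_real_derivative flat 2 (real n * (1 - s) - 1) * - real n) (at s)"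
    by (rule DERIV_chain2[OF f]) (auto intro!: derivative_eq_intros)
  show ?thesis
    unfolding cutoff_def[abs_def] cutoff'_def using DERIV_mult[OF 1 2] by (simp add: algebra_simps)
qed

lemma cutoff_eq_0: "\<not> (1 / real n \<le> s \<and> s \<le> 1 - 1 / real n) \<Longrightarrow> cutoff n s = 0"
  by (cases "n = 0") (auto simp: cutoff_def flat_def field_simps)

lemma flat_0_bounds: "0 \<le> flat 0 x" "flat 0 x \<le> 1"
  by (auto simp: flat_def)

lemma cutoff_bounds: "0 \<le> cutoff n s" "cutoff n s \<le> 1"
  using flat_0_bounds by (auto simp: cutoff_def intro: mult_le_one)

lemma flat_bounds: "flat 1 x \<le> 1" "flat 2 x \<le> 2" "0 \<le> flat k x"
proof -
  have "flat 1 x \<le> 1 \<and> flat 2 x \<le> 2"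
  proof (cases "x > 0")
    case True
    define y where "y = 1 / x"
    have y: "y > 0" using True by (simp add: y_def)
    have "y + y\<^sup>2 / 2 \<le> exp y" using exp_lower_Taylor_quadratic[of y] y by simp
    then have "y \<le> exp y" "y\<^sup>2 \<le> 2 * exp y" using y by (auto intro: order_trans[rotated])
    then show ?thesis using True
      by (auto simp: flat_def y_def exp_minus field_simps power2_eq_square)
  qed (auto simp: flat_def)
  then show "flat 1 x \<le> 1" "flat 2 x \<le> 2" by auto
qed (auto simp: flat_def)

text \<open>The derivative of the cutoff carries a factor \<open>n\<close>. The distance
  \<open>s\<close> to the boundary absorbs it: with \<open>y = n s - 1\<close> the product
  \<open>n s\<close> is \<open>y + 1\<close>, which lowers the pole of
  \<open>flat 2 y\<close>.\<close>

lemma scaled_flat: "real n * s * flat 2 (real n * s - 1) = flat 1 (real n * s - 1) + flat 2 (real n * s - 1)"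
proof -
  have "(y + 1) * flat 2 y = flat 1 y + flat 2 y" for y
    by (simp add: flat_def power2_eq_square divide_simps) (simp add: algebra_simps)
  from this[of "real n * s - 1"] show ?thesis by simp
qed

lemma scaled_flat_le: "real n * s * flat 2 (real n * s - 1) \<le> 3"
  unfolding scaled_flat using flat_bounds(1,2)[of "real n * s - 1"] by simp

lemma flat_at_top: "(flat k \<longlongrightarrow> (if k = 0 then 1 else 0)) at_top"
proof -
  have inv: "((\<lambda>x::real. inverse x) \<longlongrightarrow> 0) at_top" by (rule tendsto_inverse_0_at_top) (rule filterlim_ident)
  have "((\<lambda>x::real. exp (- inverse x) * inverse x ^ k) \<longlongrightarrow> exp (- 0) * 0 ^ k) at_top"
    by (intro tendsto_intros inv)
  then have "((\<lambda>x::real. exp (- inverse x) * inverse x ^ k) \<longlongrightarrow> (if k = 0 then 1 else 0)) at_top"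
    by (auto simp: power_0_left)
  then show ?thesis
    by (rule tendsto_cong[THEN iffD1, rotated])
      (auto simp: flat_def eventually_at_top_linorder field_simps inverse_eq_divide intro!: exI[of _ 1])
qed

lemma flat_seq: "s > 0 \<Longrightarrow> (\<lambda>n. flat k (real n * s - 1)) \<longlonglongrightarrow> (if k = 0 then 1 else 0)"
proof (rule filterlim_compose[OF flat_at_top])
  assume s: "s > 0"
  have "filterlim (\<lambda>n. - 1 + s * real n) at_top sequentially"
    by (rule filterlim_tendsto_add_at_top[OF tendsto_const
          filterlim_tendsto_pos_mult_at_top[OF tendsto_const s filterlim_real_sequentially]])
  then show "filterlim (\<lambda>n. real n * s - 1) at_top sequentially" by (simp add: mult.commute)
qed

lemma cutoff_tendsto_1:
  assumes "0 < s" "s < 1"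
  shows "(\<lambda>n. cutoff n s) \<longlonglongrightarrow> 1"
  using tendsto_mult[OF flat_seq[of s 0] flat_seq[of "1 - s" 0]] assms by (simp add: cutoff_def)

text \<open>Linear vanishing of \<open>h\<close> at both ends compensates the growth of
  \<open>cutoff'\<close>, uniformly in \<open>n\<close>. Each of the two factors of the cutoff
  contributes \<open>3 * L\<close>.\<close>

lemma abs_cutoff'_mult_le:
  assumes s: "0 < s" "s < 1" and h: "\<bar>h\<bar> \<le> L * s" "\<bar>h\<bar> \<le> L * (1 - s)"
  shows "\<bar>cutoff' n s * h\<bar> \<le> 6 * L"
proof -
  have L: "0 \<le> L" using h(1) s by (smt (verit) zero_le_mult_iff)
  let ?a = "flat 2 (real n * s - 1)" and ?b = "flat 2 (real n * (1 - s) - 1)"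
  have a: "real n * ?a * \<bar>h\<bar> \<le> 3 * L"
  proof -
    have "real n * ?a * \<bar>h\<bar> \<le> real n * ?a * (L * s)" using h flat_bounds(3) by (intro mult_left_mono) auto
    also have "\<dots> = L * (real n * s * ?a)" by simp
    also have "\<dots> \<le> L * 3" using L scaled_flat_le by (intro mult_left_mono)
    finally show ?thesis by simp
  qed
  have b: "real n * ?b * \<bar>h\<bar> \<le> 3 * L"
  proof -
    have "real n * ?b * \<bar>h\<bar> \<le> real n * ?b * (L * (1 - s))" using h flat_bounds(3) by (intro mult_left_mono) auto
    also have "\<dots> = L * (real n * (1 - s) * ?b)" by simp
    also have "\<dots> \<le> L * 3" using L scaled_flat_le by (intro mult_left_mono)
    finally show ?thesis by simp
  qed
  have "\<bar>cutoff' n s * h\<bar> \<le> real n * ?a * flat 0 (real n * (1 - s) - 1) * \<bar>h\<bar> + real n * flat 0 (real n * s - 1) * ?b * \<bar>h\<bar>"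
    unfolding cutoff'_def left_diff_distrib
    by (rule order_trans[OF abs_triangle_ineq4]) (simp add: abs_mult flat_bounds(3))
  also have "\<dots> \<le> real n * ?a * 1 * \<bar>h\<bar> + real n * 1 * ?b * \<bar>h\<bar>"
    using flat_bounds(3) flat_0_bounds by (intro add_mono mult_right_mono mult_left_mono) auto
  finally show ?thesis using a b by simp
qed

lemma cutoff'_mult_tendsto_0:
  assumes s: "0 < s" "s < 1"
  shows "(\<lambda>n. cutoff' n s) \<longlonglongrightarrow> 0"
proof -
  have 0: "(\<lambda>n. real n * flat 2 (real n * s - 1)) \<longlonglongrightarrow> 0" if "s > 0" for s
  proof -
    have "(\<lambda>n. (flat 1 (real n * s - 1) + flat 2 (real n * s - 1)) / s) \<longlonglongrightarrow> (0 + 0) / s"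
      using flat_seq[OF that, of 1] flat_seq[OF that, of 2] that by (intro tendsto_intros) auto
    moreover have "(flat 1 (real n * s - 1) + flat 2 (real n * s - 1)) / s = real n * flat 2 (real n * s - 1)" for n
      using that by (simp only: scaled_flat[symmetric]) simp
    ultimately show ?thesis by (simp only:) simp
  qed
  have "(\<lambda>n. real n * flat 2 (real n * s - 1) * flat 0 (real n * (1 - s) - 1) -
      flat 0 (real n * s - 1) * (real n * flat 2 (real n * (1 - s) - 1))) \<longlonglongrightarrow> 0 * 1 - 1 * 0"
    using 0[of s] 0[of "1 - s"] flat_seq[of s 0] flat_seq[of "1 - s" 0] s by (intro tendsto_intros) auto
  then show ?thesis by (simp add: cutoff'_def[abs_def] algebra_simps)
qed

lemma Ck_cutoff: "Ck k (\<lambda>x::'a::euclidean_space. cutoff n (c + v \<bullet> x))"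
proof -
  have "(\<lambda>x. cutoff n (c + v \<bullet> x)) = (\<lambda>x. flat 0 ((real n * c - 1) + (real n *\<^sub>R v) \<bullet> x) *
      flat 0 ((real n * (1 - c) - 1) + (- real n *\<^sub>R v) \<bullet> x))"
    by (simp add: cutoff_def fun_eq_iff algebra_simps)
  then show ?thesis by (simp only:) (intro Ck_mult Ck_flat)
qed

subsection \<open>Cosine polynomials on a parallelogram\<close>

text \<open>Fubini in the coordinates of \<open>real^2\<close>, whose Lebesgue measure is the image
  of a product over the two basis vectors. The restriction to the square enters later, through
  indicator factors in \<open>f\<close> and \<open>g\<close>.\<close>

lemma integral_product_unit_square:
  fixes f g :: "real \<Rightarrow> real"
  assumes f: "integrable lborel f" and g: "integrable lborel g"
  shows "integrable lborel (\<lambda>y::real^2. f (y$1) * g (y$2))"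
    "(LINT y::real^2|lborel. f (y$1) * g (y$2)) = (LINT s|lborel. f s) * (LINT s|lborel. g s)"
proof -
  interpret product_sigma_finite "\<lambda>b :: real^2. lborel :: real measure"
    by standard
  let ?T = "\<lambda>h :: real^2 \<Rightarrow> real. \<Sum>b\<in>Basis. h b *\<^sub>R b"
  let ?M = "\<Pi>\<^sub>M b\<in>(Basis :: (real^2) set). (lborel :: real measure)"
  have ne: "axis 1 1 \<noteq> (axis 2 1 :: real^2)" by (simp add: axis_eq_axis)
  have Basis: "(Basis :: (real^2) set) = {axis 1 1, axis 2 1}"
    by (auto simp: Basis_vec_def UNIV_2)
  define H where "H b = (if b = (axis 1 1 :: real^2) then f else g)" for b
  have comp: "?T h $ 1 = h (axis 1 1)" "?T h $ 2 = h (axis 2 1)" for h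
    unfolding Basis using ne by (auto simp: axis_def)
  have prod: "f (?T h $ 1) * g (?T h $ 2) = (\<Prod>b\<in>Basis. H b (h b))" for h
    unfolding comp using ne by (simp add: Basis H_def)
  have int: "integrable lborel (H b)" for b using f g by (simp add: H_def)
  have [measurable]: "f \<in> borel_measurable borel" "g \<in> borel_measurable borel"
    using f g by (auto dest: borel_measurable_integrable)
  have meas: "(\<lambda>y::real^2. f (y$1) * g (y$2)) \<in> borel_measurable borel" by measurable
  have T: "?T \<in> ?M \<rightarrow>\<^sub>M borel" by measurable
  show "integrable lborel (\<lambda>y::real^2. f (y$1) * g (y$2))"
    by (subst lborel_eq, subst integrable_distr_eq[OF T meas], subst prod)
      (intro product_integrable_prod int finite_Basis)
  have "(LINT y::real^2|lborel. f (y$1) * g (y$2)) = (LINT h|?M. (\<Prod>b\<in>Basis. H b (h b)))"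
    by (subst lborel_eq, subst integral_distr[OF T meas], subst prod) simp
  also have "\<dots> = (\<Prod>b\<in>Basis. LINT s|lborel. H b s)"
    by (intro product_integral_prod int finite_Basis)
  also have "\<dots> = (LINT s|lborel. f s) * (LINT s|lborel. g s)"
    using ne by (simp add: Basis H_def)
  finally show "(LINT y::real^2|lborel. f (y$1) * g (y$2)) = (LINT s|lborel. f s) * (LINT s|lborel. g s)" .
qed

lemma unit_interval_integral:
  fixes f :: "real \<Rightarrow> real"
  assumes f: "continuous_on UNIV f"
  shows "integrable lborel (\<lambda>s. indicator {0<..<1} s * f s)"
    "(LINT s|lborel. indicator {0<..<1} s * f s) = integral {0..1} f"
proof -
  have "set_integrable lborel {0..1} f"
    using f by (intro borel_integrable_atLeastAtMost') (auto intro: continuous_on_subset)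
  then have int: "set_integrable lborel {0<..<1} f"
    by (rule set_integrable_subset) auto
  then show "integrable lborel (\<lambda>s. indicator {0<..<1} s * f s)"
    by (simp add: set_integrable_def)
  show "(LINT s|lborel. indicator {0<..<1} s * f s) = integral {0..1} f"
    using set_borel_integral_eq_integral(2)[OF int]
    by (simp add: set_lebesgue_integral_def integral_open_interval_real)
qed

text \<open>Nondegeneracy is encoded by the dual basis, which also supplies the gradients of the two
  coordinates. The base point \<open>p\<close> stays free: the locale predicate speaks of
  \<open>a\<close>, \<open>b\<close>, \<open>\<alpha>\<close>, \<open>\<beta>\<close> only.\<close>

locale parallelogram =
  fixes p a b \<alpha> \<beta> :: "real^2"
  assumes dual: "\<alpha> \<bullet> a = 1" "\<alpha> \<bullet> b = 0" "\<beta> \<bullet> a = 0" "\<beta> \<bullet> b = 1"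
begin

definition \<sigma> :: "real^2 \<Rightarrow> real" where "\<sigma> x = - (\<alpha> \<bullet> p) + \<alpha> \<bullet> x"
definition \<tau> :: "real^2 \<Rightarrow> real" where "\<tau> x = - (\<beta> \<bullet> p) + \<beta> \<bullet> x"
definition P :: "(real^2) set" where "P = {x. 0 < \<sigma> x \<and> \<sigma> x < 1 \<and> 0 < \<tau> x \<and> \<tau> x < 1}"
definition J :: real where "J = \<bar>a$1 * b$2 - a$2 * b$1\<bar>"

lemma dual_coords:
  "\<alpha>$1 * a$1 + \<alpha>$2 * a$2 = 1" "\<alpha>$1 * b$1 + \<alpha>$2 * b$2 = 0"
  "\<beta>$1 * a$1 + \<beta>$2 * a$2 = 0" "\<beta>$1 * b$1 + \<beta>$2 * b$2 = 1"
  using dual by (simp_all add: inner_vec_def sum_2)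

text \<open>A left inverse of a 2 by 2 matrix is also a right inverse.\<close>

lemma dual_coords':
  "\<alpha>$1 * a$1 + \<beta>$1 * b$1 = 1" "\<alpha>$1 * a$2 + \<beta>$1 * b$2 = 0"
  "\<alpha>$2 * a$1 + \<beta>$2 * b$1 = 0" "\<alpha>$2 * a$2 + \<beta>$2 * b$2 = 1"
  using dual_coords by algebra+

lemma expansion: "(\<alpha> \<bullet> v) *\<^sub>R a + (\<beta> \<bullet> v) *\<^sub>R b = v"
proof (simp add: vec_eq_iff forall_2 inner_vec_def sum_2, intro conjI)
  show "(\<alpha>$1 * v$1 + \<alpha>$2 * v$2) * a$1 + (\<beta>$1 * v$1 + \<beta>$2 * v$2) * b$1 = v$1"
    using dual_coords' by algebra
  show "(\<alpha>$1 * v$1 + \<alpha>$2 * v$2) * a$2 + (\<beta>$1 * v$1 + \<beta>$2 * v$2) * b$2 = v$2"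
    using dual_coords' by algebra
qed

lemma expansion_dual: "(a \<bullet> g) *\<^sub>R \<alpha> + (b \<bullet> g) *\<^sub>R \<beta> = g"
proof (simp add: vec_eq_iff forall_2 inner_vec_def sum_2, intro conjI)
  show "(a$1 * g$1 + a$2 * g$2) * \<alpha>$1 + (b$1 * g$1 + b$2 * g$2) * \<beta>$1 = g$1"
    using dual_coords' by algebra
  show "(a$1 * g$1 + a$2 * g$2) * \<alpha>$2 + (b$1 * g$1 + b$2 * g$2) * \<beta>$2 = g$2"
    using dual_coords' by algebra
qed

lemma point_expansion: "p + \<sigma> x *\<^sub>R a + \<tau> x *\<^sub>R b = x"
proof -
  have "\<sigma> x = \<alpha> \<bullet> (x - p)" "\<tau> x = \<beta> \<bullet> (x - p)" by (auto simp: \<sigma>_def \<tau>_def inner_diff_right)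
  then show ?thesis using expansion[of "x - p"] by (simp add: add.assoc)
qed

lemma \<sigma>_affine: "\<sigma> (p + s *\<^sub>R a + t *\<^sub>R b) = s" and \<tau>_affine: "\<tau> (p + s *\<^sub>R a + t *\<^sub>R b) = t"
  by (auto simp: \<sigma>_def \<tau>_def inner_add_right dual)

lemma P_eq: "P = open_parallelogram p a b"
  unfolding P_def open_parallelogram_def
  by (auto simp: \<sigma>_affine \<tau>_affine) (metis point_expansion)

lemma swap: "parallelogram b a \<beta> \<alpha>"
  using dual by unfold_locales auto

lemma continuous_\<sigma> [continuous_intros]: "continuous_on S \<sigma>"
  and continuous_\<tau> [continuous_intros]: "continuous_on S \<tau>"
  unfolding \<sigma>_def[abs_def] \<tau>_def[abs_def] by (auto intro!: continuous_intros)

lemma continuous_comp_\<sigma>: "continuous_on UNIV f \<Longrightarrow> continuous_on S (\<lambda>x. f (\<sigma> x))"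
  and continuous_comp_\<tau>: "continuous_on UNIV f \<Longrightarrow> continuous_on S (\<lambda>x. f (\<tau> x))"
  by (auto intro: continuous_on_compose2 continuous_\<sigma> continuous_\<tau>)

definition K :: "(real^2) set" where "K = {x. 0 \<le> \<sigma> x \<and> \<sigma> x \<le> 1 \<and> 0 \<le> \<tau> x \<and> \<tau> x \<le> 1}"

lemma P_subset_K: "P \<subseteq> K"
  by (auto simp: P_def K_def)

lemma compact_K: "compact K"
  unfolding compact_eq_bounded_closed
proof
  have "norm x \<le> norm p + norm a + norm b" if "x \<in> K" for x
  proof -
    have "norm (p + \<sigma> x *\<^sub>R a + \<tau> x *\<^sub>R b) \<le> norm p + norm (\<sigma> x *\<^sub>R a) + norm (\<tau> x *\<^sub>R b)"
      by (meson norm_triangle_ineq norm_triangle_mono order_refl)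
    also have "\<dots> \<le> norm p + norm a + norm b"
      using that by (auto simp: K_def intro!: add_mono mult_left_le_one_le)
    finally show ?thesis by (simp add: point_expansion)
  qed
  then show "bounded K" by (auto simp: bounded_iff)
  show "closed K" unfolding K_def
    by (intro closed_Collect_conj closed_Collect_le continuous_intros)
qed

sublocale bounded_domain P
proof
  show "open P" unfolding P_def
    by (intro open_Collect_conj open_Collect_less continuous_intros)
  show "bounded P" using compact_K P_subset_K bounded_subset compact_imp_bounded by blast
qed

lemma J_pos: "J > 0"
proof -
  have "(\<alpha>$1 * \<beta>$2 - \<alpha>$2 * \<beta>$1) * (a$1 * b$2 - a$2 * b$1) = 1"
    using dual_coords by algebra
  then show ?thesis by (auto simp: J_def)
qed

lemma integral_product:
  assumes f: "continuous_on UNIV f" and g: "continuous_on UNIV g"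
  shows "(LINT x|lebesgue_on P. f (\<sigma> x) * g (\<tau> x)) = J * integral {0..1} f * integral {0..1} g"
proof -
  define T where "T y = p + (y$1) *\<^sub>R a + (y$2) *\<^sub>R b" for y :: "real^2"
  define h where "h y = f (y$1) * g (y$2)" for y :: "real^2"
  have mem: "y \<in> box 0 1 \<longleftrightarrow> y$1 \<in> {0<..<1} \<and> y$2 \<in> {0<..<1}" for y :: "real^2"
    by (auto simp: mem_box_cart forall_2)
  have img: "T ` box 0 1 = P"
  proof (intro set_eqI iffI)
    fix x assume "x \<in> T ` box 0 1"
    then show "x \<in> P" by (auto simp: mem T_def P_def \<sigma>_affine \<tau>_affine)
  next
    fix x assume x: "x \<in> P"
    have "x = T (vector [\<sigma> x, \<tau> x])" by (simp add: T_def point_expansion)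
    then show "x \<in> T ` box 0 1" using x by (intro image_eqI[of _ _ "vector [\<sigma> x, \<tau> x]"]) (auto simp: mem P_def)
  qed
  have der: "(T has_derivative (\<lambda>h. (h$1) *\<^sub>R a + (h$2) *\<^sub>R b)) (at y within box 0 1)" for y
  proof -
    have "((\<lambda>y::real^2. y$i) has_derivative (\<lambda>h. h$i)) (at y within box 0 1)" for i
      by (rule bounded_linear_imp_has_derivative[OF bounded_linear_vec_nth])
    then show ?thesis unfolding T_def by (auto intro!: derivative_eq_intros)
  qed
  have det: "\<bar>det (matrix (\<lambda>h::real^2. (h$1) *\<^sub>R a + (h$2) *\<^sub>R b))\<bar> = J"
    by (simp add: det_2 matrix_def axis_def J_def mult.commute)
  have hT: "f (\<sigma> (T y)) * g (\<tau> (T y)) = h y" for y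
    by (simp add: T_def h_def \<sigma>_affine \<tau>_affine)
  have inj: "inj_on T (box 0 1)"
    by (rule inj_on_inverseI[of _ "\<lambda>x. vector [\<sigma> x, \<tau> x]"])
      (auto simp: T_def \<sigma>_affine \<tau>_affine vec_eq_iff forall_2)
  have ind: "indicator (box 0 1) y *\<^sub>R h y =
      (indicator {0<..<1} (y$1) * f (y$1)) * (indicator {0<..<1} (y$2) * g (y$2))" for y
    by (auto simp: indicator_def mem h_def)
  note F = unit_interval_integral[OF f] and G = unit_interval_integral[OF g]
  have meas: "(\<lambda>y. indicator (box 0 1) y *\<^sub>R h y) \<in> borel_measurable borel"
    using integral_product_unit_square(1)[OF F(1) G(1)] unfolding ind
    by (auto dest: borel_measurable_integrable)
  have lint: "integrable lborel (\<lambda>y. indicator (box 0 1) y *\<^sub>R h y)"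
    unfolding ind by (rule integral_product_unit_square(1)[OF F(1) G(1)])
  then have ai: "h absolutely_integrable_on box 0 1"
    unfolding set_integrable_def using meas by (simp add: integrable_completion)
  have "integral (box 0 1) h = (LINT y|lebesgue. indicator (box 0 1) y *\<^sub>R h y)"
    using set_lebesgue_integral_eq_integral(2)[OF ai] by (simp add: set_lebesgue_integral_def)
  also have "\<dots> = (LINT y|lborel. indicator (box 0 1) y *\<^sub>R h y)"
    using meas by (simp add: integral_completion)
  also have "\<dots> = integral {0..1} f * integral {0..1} g"
    unfolding ind using integral_product_unit_square(2)[OF F(1) G(1)] F(2) G(2) by simp
  finally have hI: "integral (box 0 1) h = integral {0..1} f * integral {0..1} g" .
  define u where "u x = f (\<sigma> x) * g (\<tau> x)" for x
  \<comment> \<open>The substitution formula is applied to functions read with values in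
    \<open>real^1\<close>; \<open>J\<close> is the modulus of the determinant of the affine map
    \<open>T\<close>.\<close>
  have cv: "integral P (\<lambda>x. vec (u x) :: real^1) = integral (box 0 1) (\<lambda>y. J *\<^sub>R (vec (h y) :: real^1))"
  proof -
    have "(\<lambda>y. J *\<^sub>R (vec (h y) :: real^1)) absolutely_integrable_on box 0 1"
      using ai by (intro absolutely_integrable_scaleR_left) (simp add: absolutely_integrable_on_1_iff)
    then show ?thesis
      using integral_change_of_variables[OF _ der inj, of "\<lambda>x. vec (u x) :: real^1"]
      by (simp add: img det u_def hT)
  qed
  have ui: "integrable (lebesgue_on P) u"
    unfolding u_def using f g
    by (intro L2_integrable continuous_in_L2 continuous_intros continuous_comp_\<sigma> continuous_comp_\<tau>)
  have "(LINT x|lebesgue_on P. u x) = integral P u"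
    using ui by (rule lebesgue_integral_eq_integral) simp
  also have "\<dots> = integral P (\<lambda>x. vec (u x) :: real^1) $ 1"
    using integral_on_1_eq[of P "\<lambda>x. vec (u x) :: real^1"] by simp
  also have "\<dots> = J * integral (box 0 1) h"
  proof -
    have "(\<lambda>y. J *\<^sub>R (vec (h y) :: real^1)) = (\<lambda>y. vec (J * h y))" by (simp add: vec_eq_iff fun_eq_iff)
    then show ?thesis unfolding cv using integral_on_1_eq[of "box 0 1" "\<lambda>y. vec (J * h y) :: real^1"] by simp
  qed
  finally show ?thesis by (simp add: hI u_def)
qed

lemma measure_P: "measure lebesgue P = J"
proof -
  have "(LINT x|lebesgue_on P. 1) = measure (lebesgue_on P) (space (lebesgue_on P))"
    by simp
  also have "\<dots> = measure lebesgue P" by (simp add: measure_restrict_space)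
  finally show ?thesis using integral_product[of "\<lambda>_. 1" "\<lambda>_. 1"] by (simp add: continuous_intros)
qed

section \<open>Completeness of the cosine products\<close>

inductive trigonometric_polynomial :: "(real^2 \<Rightarrow> real) \<Rightarrow> bool" where
  base: "trigonometric_polynomial (\<lambda>x. cos (of_int j * pi * \<sigma> x) * cos (of_int k * pi * \<tau> x))"
| add: "\<lbrakk>trigonometric_polynomial f; trigonometric_polynomial g\<rbrakk> \<Longrightarrow> trigonometric_polynomial (\<lambda>x. f x + g x)"
| scale: "trigonometric_polynomial f \<Longrightarrow> trigonometric_polynomial (\<lambda>x. c * f x)"

lemma trigonometric_polynomial_const: "trigonometric_polynomial (\<lambda>x. c)"
  using scale[OF base[of 0 0], of c] by simp

text \<open>Integer frequencies make the span closed under products: the product formula for cosines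
  produces \<open>j - l\<close> and \<open>j + l\<close>, and the difference may be
  negative.\<close>

lemma trigonometric_polynomial_mult_base:
  "trigonometric_polynomial f \<Longrightarrow>
    trigonometric_polynomial (\<lambda>x. f x * (cos (of_int l * pi * \<sigma> x) * cos (of_int m * pi * \<tau> x)))"
proof (induction rule: trigonometric_polynomial.induct)
  case (base j k)
  have c: "cos (of_int j * y) * cos (of_int l * y) = (cos (of_int (j - l) * y) + cos (of_int (j + l) * y)) / 2"
    for j l and y :: real by (simp add: cos_times_cos algebra_simps)
  have q: "(A + B) / 2 * ((C + D) / 2) = 1 / 4 * ((A * C + A * D) + (B * C + B * D))"
    for A B C D :: real by (simp add: field_simps)
  have "(\<lambda>x. cos (of_int j * pi * \<sigma> x) * cos (of_int k * pi * \<tau> x) *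
        (cos (of_int l * pi * \<sigma> x) * cos (of_int m * pi * \<tau> x))) =
      (\<lambda>x. 1 / 4 * ((cos (of_int (j - l) * pi * \<sigma> x) * cos (of_int (k - m) * pi * \<tau> x) +
          cos (of_int (j - l) * pi * \<sigma> x) * cos (of_int (k + m) * pi * \<tau> x)) +
        (cos (of_int (j + l) * pi * \<sigma> x) * cos (of_int (k - m) * pi * \<tau> x) +
          cos (of_int (j + l) * pi * \<sigma> x) * cos (of_int (k + m) * pi * \<tau> x))))"
    (is "?l = ?r")
  proof
    fix x
    have "?l x = (cos (of_int j * (pi * \<sigma> x)) * cos (of_int l * (pi * \<sigma> x))) *
        (cos (of_int k * (pi * \<tau> x)) * cos (of_int m * (pi * \<tau> x)))" by (simp add: mult_ac)
    also have "\<dots> = ?r x" unfolding c q by (simp only: mult.assoc)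
    finally show "?l x = ?r x" .
  qed
  then show ?case by (simp only:) (intro trigonometric_polynomial.intros)
next
  case (add f g)
  then show ?case by (simp only: distrib_right) (rule trigonometric_polynomial.add)
next
  case (scale f c)
  from trigonometric_polynomial.scale[OF scale.IH, of c] show ?case by (simp add: mult.assoc)
qed

lemma trigonometric_polynomial_mult:
  assumes "trigonometric_polynomial f" "trigonometric_polynomial g"
  shows "trigonometric_polynomial (\<lambda>x. f x * g x)"
  using assms(2)
proof (induction rule: trigonometric_polynomial.induct)
  case (base j k)
  then show ?case using assms(1) by (rule trigonometric_polynomial_mult_base)
next
  case (add f g)
  then show ?case by (simp only: distrib_left) (rule trigonometric_polynomial.add)
next
  case (scale g c)
  from trigonometric_polynomial.scale[OF scale.IH, of c] show ?case by (simp add: mult.left_commute)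
qed

lemma continuous_trigonometric_polynomial: "trigonometric_polynomial f \<Longrightarrow> continuous_on S f"
  by (induction rule: trigonometric_polynomial.induct) (auto intro!: continuous_intros)

text \<open>Stone-Weierstrass on the closed parallelogram. Cosines alone separate its points,
  because the cosine is injective on the interval from 0 to pi, through which
  \<open>pi * \<sigma> x\<close> and \<open>pi * \<tau> x\<close> run.\<close>

lemma trigonometric_polynomial_dense:
  assumes f: "continuous_on UNIV f" and e: "e > 0"
  shows "\<exists>g. trigonometric_polynomial g \<and> (\<forall>x\<in>K. \<bar>f x - g x\<bar> < e)"
proof (rule Stone_Weierstrass_HOL[OF compact_K])
  fix x y assume xy: "x \<in> K \<and> y \<in> K \<and> x \<noteq> y"
  then have "\<sigma> x \<noteq> \<sigma> y \<or> \<tau> x \<noteq> \<tau> y" using point_expansion by metis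
  then show "\<exists>f. trigonometric_polynomial f \<and> f x \<noteq> f y"
  proof
    assume "\<sigma> x \<noteq> \<sigma> y"
    then have "cos (pi * \<sigma> x) \<noteq> cos (pi * \<sigma> y)"
      using xy cos_inj_pi[of "pi * \<sigma> x" "pi * \<sigma> y"] by (auto simp: K_def mult_le_cancel_left2)
    then show ?thesis using base[of 1 0] by auto
  next
    assume "\<tau> x \<noteq> \<tau> y"
    then have "cos (pi * \<tau> x) \<noteq> cos (pi * \<tau> y)"
      using xy cos_inj_pi[of "pi * \<tau> x" "pi * \<tau> y"] by (auto simp: K_def mult_le_cancel_left2)
    then show ?thesis using base[of 0 1] by auto
  qed
qed (use e f continuous_on_subset[OF f] trigonometric_polynomial_const trigonometric_polynomial_mult
    trigonometric_polynomial.add continuous_trigonometric_polynomial in auto)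

definition e :: "nat \<Rightarrow> nat \<Rightarrow> real^2 \<Rightarrow> real" where
  "e j k x = cos (real j * pi * \<sigma> x) * cos (real k * pi * \<tau> x)"

lemma continuous_e: "continuous_on S (e j k)"
  unfolding e_def[abs_def] by (auto intro!: continuous_intros)

lemma e_L2: "e j k \<in> L2 P"
  by (intro continuous_in_L2 continuous_e)

lemma integrable_mult_continuous:
  fixes f h :: "real^2 \<Rightarrow> real"
  assumes "integrable (lebesgue_on P) f" "continuous_on UNIV h"
  shows "integrable (lebesgue_on P) (\<lambda>x. f x * h x)"
proof -
  have "compact (h ` K)" using compact_K assms(2) by (intro compact_continuous_image) (auto intro: continuous_on_subset)
  then obtain B where B: "\<And>x. x \<in> K \<Longrightarrow> norm (h x) \<le> B"
    by (metis bounded_iff compact_imp_bounded imageI)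
  show ?thesis
  proof (rule Bochner_Integration.integrable_bound)
    show "integrable (lebesgue_on P) (\<lambda>x. B * f x)" using assms by simp
    have "h \<in> borel_measurable (lebesgue_on P)"
      using assms(2) by (intro L2_measurable continuous_in_L2)
    then show "(\<lambda>x. f x * h x) \<in> borel_measurable (lebesgue_on P)" using assms by auto
    show "AE x in lebesgue_on P. norm (f x * h x) \<le> norm (B * f x)"
    proof (rule AE_I2)
      fix x assume "x \<in> space (lebesgue_on P)"
      then have "\<bar>h x\<bar> \<le> \<bar>B\<bar>" using B[of x] P_subset_K by auto
      then have "\<bar>f x\<bar> * \<bar>h x\<bar> \<le> \<bar>f x\<bar> * \<bar>B\<bar>" by (rule mult_left_mono) simp
      then show "norm (f x * h x) \<le> norm (B * f x)"
        unfolding real_norm_def abs_mult by (simp only: mult.commute)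
    qed
  qed
qed

context
  fixes f :: "real^2 \<Rightarrow> real"
  assumes f: "integrable (lebesgue_on P) f"
    and orth: "\<And>j k. (LINT x|lebesgue_on P. f x * e j k x) = 0"
begin

lemma orthogonal_to_trigonometric_polynomials:
  "trigonometric_polynomial g \<Longrightarrow> (LINT x|lebesgue_on P. f x * g x) = 0"
proof (induction rule: trigonometric_polynomial.induct)
  case (base j k)
  have c: "cos (of_int i * pi * y) = cos (real (nat \<bar>i\<bar>) * pi * y)" for i y
    by (cases "i \<ge> 0") (auto simp: of_nat_nat)
  show ?case using orth[of "nat \<bar>j\<bar>" "nat \<bar>k\<bar>"] by (simp add: e_def c)
next
  case (add g h)
  then have "continuous_on UNIV g" "continuous_on UNIV h"
    by (auto intro: continuous_trigonometric_polynomial)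
  then show ?case using add integrable_mult_continuous[OF f] by (simp add: distrib_left)
next
  case (scale g c)
  have "(\<lambda>x. f x * (c * g x)) = (\<lambda>x. c * (f x * g x))" by (simp add: mult.left_commute)
  then show ?case using scale by simp
qed

text \<open>The approximation is uniform on \<open>K\<close>, since \<open>f\<close> is only
  integrable: the error is at most the uniform distance times the integral of
  \<open>\<bar>f\<bar>\<close>.\<close>

lemma orthogonal_to_continuous:
  assumes h: "continuous_on UNIV h"
  shows "(LINT x|lebesgue_on P. f x * h x) = 0"
proof -
  let ?A = "LINT x|lebesgue_on P. \<bar>f x\<bar>"
  have A: "?A \<ge> 0" by simp
  have "\<bar>LINT x|lebesgue_on P. f x * h x\<bar> \<le> \<epsilon>" if \<epsilon>: "\<epsilon> > 0" for \<epsilon>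
  proof -
    obtain g where g: "trigonometric_polynomial g" "\<And>x. x \<in> K \<Longrightarrow> \<bar>h x - g x\<bar> < \<epsilon> / (?A + 1)"
      using trigonometric_polynomial_dense[OF h, of "\<epsilon> / (?A + 1)"] \<epsilon> A by (auto simp: add_nonneg_pos)
    have cg: "continuous_on UNIV g" using g(1) by (rule continuous_trigonometric_polynomial)
    have "(LINT x|lebesgue_on P. f x * h x) = (LINT x|lebesgue_on P. f x * (h x - g x))"
      using orthogonal_to_trigonometric_polynomials[OF g(1)] integrable_mult_continuous[OF f] h cg
      by (simp add: right_diff_distrib)
    also have "\<bar>\<dots>\<bar> \<le> (LINT x|lebesgue_on P. \<bar>f x * (h x - g x)\<bar>)"
      by (rule integral_abs_bound)
    also have "\<dots> \<le> (LINT x|lebesgue_on P. \<epsilon> / (?A + 1) * \<bar>f x\<bar>)"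
    proof (rule integral_mono)
      show "integrable (lebesgue_on P) (\<lambda>x. \<bar>f x * (h x - g x)\<bar>)"
        using f h cg by (intro integrable_abs integrable_mult_continuous continuous_intros)
      fix x assume "x \<in> space (lebesgue_on P)"
      then have "\<bar>h x - g x\<bar> \<le> \<epsilon> / (?A + 1)" using g(2)[of x] P_subset_K by force
      then have "\<bar>f x\<bar> * \<bar>h x - g x\<bar> \<le> \<bar>f x\<bar> * (\<epsilon> / (?A + 1))" by (rule mult_left_mono) simp
      then show "\<bar>f x * (h x - g x)\<bar> \<le> \<epsilon> / (?A + 1) * \<bar>f x\<bar>"
        unfolding abs_mult by (simp only: mult.commute)
    qed (use f in simp)
    also have "\<dots> = \<epsilon> * (?A / (?A + 1))" by simp
    also have "\<dots> \<le> \<epsilon> * 1"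
    proof (rule mult_left_mono)
      have "t / (t + 1) \<le> 1" if "t \<ge> 0" for t :: real using that by simp
      then show "?A / (?A + 1) \<le> 1" using A .
    qed (use \<epsilon> in simp)
    finally show ?thesis by simp
  qed
  then have "\<bar>LINT x|lebesgue_on P. f x * h x\<bar> \<le> 0" by (rule field_le_epsilon[of _ 0, simplified])
  then show ?thesis by simp
qed

text \<open>The functions \<open>max 0 (1 - n dist(x, C))\<close> decrease to the indicator of
  \<open>C\<close>, and \<open>\<bar>f\<bar>\<close> dominates. The empty set is separated because
  its \<open>infdist\<close> is 0 by default.\<close>

lemma orthogonal_to_closed_indicator:
  assumes C: "closed C"
  shows "(LINT x|lebesgue_on P. f x * indicator C x) = 0"
proof (cases "C = {}")
  case False
  define h where "h n x = max 0 (1 - real n * infdist x C)" for n x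
  have ch: "continuous_on UNIV (h n)" for n
    unfolding h_def[abs_def] by (intro continuous_intros)
  have fm: "f \<in> borel_measurable (lebesgue_on P)" using f by auto
  have "(\<lambda>n. LINT x|lebesgue_on P. f x * h n x) \<longlonglongrightarrow> (LINT x|lebesgue_on P. f x * indicator C x)"
  proof (rule integral_dominated_convergence[where w = "\<lambda>x. \<bar>f x\<bar>"])
    have "C \<inter> P \<in> sets lebesgue" using C by (auto intro: borel_closed)
    then have "(indicator C :: _ \<Rightarrow> real) \<in> borel_measurable (lebesgue_on P)"
      by (simp add: borel_measurable_indicator_iff Int_commute sets_restrict_space_iff)
    then show "(\<lambda>x. f x * indicator C x) \<in> borel_measurable (lebesgue_on P)"
      using fm by auto
    show "(\<lambda>x. f x * h n x) \<in> borel_measurable (lebesgue_on P)" for n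
      using integrable_mult_continuous[OF f ch[of n]] by auto
    show "AE x in lebesgue_on P. norm (f x * h n x) \<le> \<bar>f x\<bar>" for n
      by (rule AE_I2) (auto simp: abs_mult h_def infdist_nonneg intro!: mult_right_le_one_le)
    show "AE x in lebesgue_on P. (\<lambda>n. f x * h n x) \<longlonglongrightarrow> f x * indicator C x"
    proof (rule AE_I2, intro tendsto_intros)
      fix x
      show "(\<lambda>n. h n x) \<longlonglongrightarrow> indicator C x"
      proof (cases "x \<in> C")
        case True
        then show ?thesis by (simp add: h_def)
      next
        case x: False
        then have d: "infdist x C > 0" using C False by (simp add: infdist_pos_not_in_closed)
        obtain N where N: "real N * infdist x C > 1" using reals_Archimedean3[OF d] by blast
        have "h n x = 0" if "n \<ge> N" for n
        proof -
          have "real N * infdist x C \<le> real n * infdist x C" using that d by (intro mult_right_mono) auto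
          then show ?thesis using N by (simp add: h_def)
        qed
        then have "eventually (\<lambda>n. h n x = 0) sequentially" by (rule eventually_sequentiallyI)
        then show ?thesis using x by (simp add: tendsto_eventually)
      qed
    qed
  qed (use f in simp)
  then show ?thesis using orthogonal_to_continuous[OF ch] by (simp add: LIMSEQ_const_iff)
qed simp

text \<open>Over a closed subset of the set where \<open>f\<close> is positive the integral of
  \<open>f\<close> vanishes, so that subset is null; inner regularity carries this to the whole
  set.\<close>

lemma positive_part_null: "{x\<in>P. f x > 0} \<in> null_sets lebesgue"
proof -
  let ?S = "{x\<in>P. f x > 0}"
  have "f \<in> borel_measurable (lebesgue_on P)" using f by auto
  then have "f -` {0<..} \<inter> space (lebesgue_on P) \<in> sets (lebesgue_on P)" by (rule measurable_sets) simp
  moreover have "f -` {0<..} \<inter> space (lebesgue_on P) = ?S" by auto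
  ultimately have S: "?S \<in> sets lebesgue" by (simp add: sets_restrict_space_iff)
  have null: "T \<in> null_sets lebesgue" if T: "closed T" "T \<subseteq> ?S" for T
  proof -
    have "AE x in lebesgue_on P. f x * indicator T x = 0"
    proof (rule integral_nonneg_eq_0_iff_AE[THEN iffD1])
      show "(LINT x|lebesgue_on P. f x * indicator T x) = 0" by (rule orthogonal_to_closed_indicator[OF T(1)])
      have "T \<inter> P \<in> sets lebesgue" using T by (auto intro: borel_closed)
      then show "integrable (lebesgue_on P) (\<lambda>x. f x * indicator T x)"
        using f T(2) by (intro integrable_real_mult_indicator) (auto simp: sets_restrict_space_iff Int_absorb2 subset_iff)
      show "AE x in lebesgue_on P. 0 \<le> f x * indicator T x"
        using T by (intro AE_I2) (auto simp: indicator_def)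
    qed
    then have "AE x in lebesgue. x \<in> P \<longrightarrow> f x * indicator T x = 0"
      by (simp add: AE_restrict_space_iff)
    then have "AE x in lebesgue. x \<notin> T"
      by eventually_elim (use T in \<open>auto simp: indicator_def\<close>)
    then show ?thesis using T by (subst AE_iff_null_sets) (auto intro: borel_closed)
  qed
  have "emeasure lebesgue ?S \<le> ennreal \<epsilon>" if "\<epsilon> > 0" for \<epsilon>
  proof -
    obtain T where T: "closed T" "T \<subseteq> ?S" "?S - T \<in> lmeasurable" "emeasure lebesgue (?S - T) < ennreal \<epsilon>"
      using sets_lebesgue_inner_closed[OF S \<open>\<epsilon> > 0\<close>] by blast
    have "emeasure lebesgue ?S = emeasure lebesgue (?S - T)"
      using null[OF T(1,2)] S by (simp add: emeasure_Diff_null_set)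
    then show ?thesis using T(4) by (simp add: less_imp_le)
  qed
  then have "emeasure lebesgue ?S = 0"
    using ennreal_le_epsilon[of 0 "emeasure lebesgue ?S"] by simp
  then show ?thesis using S by auto
qed

end

lemma AE_zero_if_orthogonal_to_e:
  assumes f: "integrable (lebesgue_on P) f"
    and orth: "\<And>j k. (LINT x|lebesgue_on P. f x * e j k x) = 0"
  shows "AE x in lebesgue_on P. f x = 0"
proof -
  have "{x\<in>P. f x > 0} \<in> null_sets lebesgue" using assms by (rule positive_part_null)
  moreover have "{x\<in>P. - f x > 0} \<in> null_sets lebesgue"
    using assms by (intro positive_part_null) auto
  ultimately have "{x\<in>P. f x > 0} \<union> {x\<in>P. - f x > 0} \<in> null_sets lebesgue" by (rule null_sets.Un)
  moreover have "{x\<in>P. f x > 0} \<union> {x\<in>P. - f x > 0} = {x. \<not> (x \<in> P \<longrightarrow> f x = 0)}" by auto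
  ultimately have "AE x in lebesgue. x \<in> P \<longrightarrow> f x = 0"
    by (intro AE_I'[of "{x. \<not> (x \<in> P \<longrightarrow> f x = 0)}"]) auto
  then show ?thesis by (simp add: AE_restrict_space_iff)
qed

end

subsection \<open>Integration by parts\<close>

text \<open>Differentiate the translation invariance of the integral of \<open>\<psi>\<close>.\<close>

lemma integral_directional_derivative_eq_0:
  fixes \<psi> \<psi>' :: "'a::euclidean_space \<Rightarrow> real"
  assumes der: "\<And>x. ((\<lambda>t. \<psi> (x + t *\<^sub>R b)) has_real_derivative \<psi>' x) (at 0)"
    and cont: "continuous_on UNIV \<psi>" "continuous_on UNIV \<psi>'"
    and C: "compact C" "\<And>x. x \<notin> C \<Longrightarrow> \<psi> x = 0" "\<And>x. x \<notin> C \<Longrightarrow> \<psi>' x = 0"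
  shows "integrable lborel \<psi>'" "(LINT x|lborel. \<psi>' x) = 0"
proof -
  have int: "integrable lborel f" if f: "continuous_on UNIV f" "\<And>x. x \<notin> C \<Longrightarrow> f x = 0" for f :: "'a \<Rightarrow> real"
  proof -
    have "integrable lborel (\<lambda>x. indicator C x *\<^sub>R f x)"
      using C(1) f(1) by (intro borel_integrable_compact) (auto intro: continuous_on_subset)
    moreover have "(\<lambda>x. indicator C x *\<^sub>R f x) = f" using f(2) by (auto simp: indicator_def fun_eq_iff)
    ultimately show ?thesis by simp
  qed
  show "integrable lborel \<psi>'" using cont C by (intro int)
  have i\<psi>: "integrable lborel \<psi>" using cont C by (intro int)
  have der': "((\<lambda>t. \<psi> (x + t *\<^sub>R b)) has_real_derivative \<psi>' (x + t *\<^sub>R b)) (at t)" for x t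
  proof -
    have "((\<lambda>s. \<psi> ((x + t *\<^sub>R b) + s *\<^sub>R b)) has_real_derivative \<psi>' (x + t *\<^sub>R b)) (at (t + - t))"
      using der[of "x + t *\<^sub>R b"] by simp
    from DERIV_shift[THEN iffD1, OF this] show ?thesis by (simp add: algebra_simps)
  qed
  have "compact (\<psi>' ` C)" using C cont by (intro compact_continuous_image) (auto intro: continuous_on_subset)
  then obtain B0 where B0: "\<And>x. x \<in> C \<Longrightarrow> norm (\<psi>' x) \<le> B0"
    by (metis bounded_iff compact_imp_bounded imageI)
  define B where "B = \<bar>B0\<bar>"
  have B: "\<bar>\<psi>' x\<bar> \<le> B" for x
    using B0[of x] C(3)[of x] by (cases "x \<in> C") (auto simp: B_def)
  obtain R where R: "\<And>x. x \<in> C \<Longrightarrow> norm x \<le> R"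
    using compact_imp_bounded[OF C(1)] by (auto simp: bounded_iff)
  define h where "h n = 1 / real (Suc n)" for n
  have h: "0 < h n" "h n \<le> 1" for n by (auto simp: h_def)
  have h0: "h \<longlonglongrightarrow> 0" unfolding h_def using LIMSEQ_inverse_real_of_nat by (simp add: inverse_eq_divide)
  define q where "q n x = (\<psi> (x + h n *\<^sub>R b) - \<psi> x) / h n" for n x
  have c\<psi>: "continuous_on UNIV (\<lambda>x. \<psi> (x + c))" for c
    by (rule continuous_on_compose2[OF cont(1)]) (auto intro!: continuous_intros)
  have shift: "integrable lborel (\<lambda>x. \<psi> (x + c))" "(LINT x|lborel. \<psi> (x + c)) = (LINT x|lborel. \<psi> x)" for c
  proof -
    have "integrable (distr lborel borel ((+) c)) \<psi>" "integral\<^sup>L (distr lborel borel ((+) c)) \<psi> = integral\<^sup>L lborel \<psi>"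
      using i\<psi> by (auto simp: lborel_distr_plus)
    then show "integrable lborel (\<lambda>x. \<psi> (x + c))" "(LINT x|lborel. \<psi> (x + c)) = (LINT x|lborel. \<psi> x)"
      using borel_measurable_continuous_onI[OF cont(1)]
      by (auto simp: integrable_distr_eq integral_distr add.commute)
  qed
  have q0: "(LINT x|lborel. q n x) = 0" for n
    unfolding q_def using shift i\<psi> by simp
  \<comment> \<open>The mean value theorem bounds the quotient by the maximum of the derivative. As
    the steps are at most 1, the ball of radius \<open>R + norm b\<close> contains the supports of
    all quotients.\<close>
  have bound: "norm (q n x) \<le> indicator (cball 0 (R + norm b)) x *\<^sub>R B" for n x
  proof (cases "x \<in> cball 0 (R + norm b)")
    case True
    obtain z where "z > 0" "z < h n"
      "\<psi> (x + h n *\<^sub>R b) - \<psi> (x + 0 *\<^sub>R b) = (h n - 0) * \<psi>' (x + z *\<^sub>R b)"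
      using MVT2[of 0 "h n" "\<lambda>t. \<psi> (x + t *\<^sub>R b)" "\<lambda>t. \<psi>' (x + t *\<^sub>R b)"] h der' by blast
    then have "q n x = \<psi>' (x + z *\<^sub>R b)" using h(1)[of n] by (simp add: q_def)
    then show ?thesis using True B by simp
  next
    case False
    have "x \<notin> C" using R[of x] False norm_ge_zero[of b] by force
    moreover have "x + h n *\<^sub>R b \<notin> C"
    proof
      assume "x + h n *\<^sub>R b \<in> C"
      then have "norm (x + h n *\<^sub>R b) \<le> R" by (rule R)
      moreover have "norm x \<le> norm (x + h n *\<^sub>R b) + norm (h n *\<^sub>R b)"
        using norm_triangle_ineq4[of "x + h n *\<^sub>R b" "h n *\<^sub>R b"] by simp
      moreover have "norm (h n *\<^sub>R b) \<le> norm b" using h[of n] by (simp add: mult_left_le_one_le)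
      ultimately show False using False by simp
    qed
    ultimately show ?thesis using C(2) False by (simp add: q_def)
  qed
  have "(\<lambda>n. LINT x|lborel. q n x) \<longlonglongrightarrow> (LINT x|lborel. \<psi>' x)"
  proof (rule integral_dominated_convergence[where w = "\<lambda>x. indicator (cball 0 (R + norm b)) x *\<^sub>R B"])
    show "\<psi>' \<in> borel_measurable lborel" using borel_measurable_continuous_onI[OF cont(2)] by simp
    show "q n \<in> borel_measurable lborel" for n
      using borel_measurable_continuous_onI[OF cont(1)] borel_measurable_continuous_onI[OF c\<psi>]
      unfolding q_def[abs_def] by simp
    show "integrable lborel (\<lambda>x. indicator (cball 0 (R + norm b)) x *\<^sub>R B :: real)"
      by (intro borel_integrable_compact) auto
    show "AE x in lborel. (\<lambda>n. q n x) \<longlonglongrightarrow> \<psi>' x"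
    proof (rule AE_I2)
      fix x
      have "((\<lambda>t. (\<psi> (x + t *\<^sub>R b) - \<psi> x) / t) \<longlongrightarrow> \<psi>' x) (at 0)"
        using der[of x] by (simp add: DERIV_def)
      moreover have "filterlim h (at 0) sequentially"
        unfolding filterlim_at using h0 h(1) by (metis (mono_tags, lifting) UNIV_I always_eventually less_irrefl)
      ultimately have "((\<lambda>n. (\<psi> (x + h n *\<^sub>R b) - \<psi> x) / h n) \<longlongrightarrow> \<psi>' x) sequentially"
        by (rule filterlim_compose)
      then show "(\<lambda>n. q n x) \<longlonglongrightarrow> \<psi>' x" by (simp add: q_def)
    qed
  qed (use bound in auto)
  then show "(LINT x|lborel. \<psi>' x) = 0" unfolding q0 by (simp add: LIMSEQ_const_iff)
qed

lemma test_function_outside: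
  assumes \<phi>: "test_function \<Omega> \<phi>" and x: "x \<notin> closure {x. \<phi> x \<noteq> 0}"
  shows "\<phi> x = 0" "frechet_derivative \<phi> (at x) = (\<lambda>_. 0)"
proof -
  have z: "\<phi> y = 0" if "y \<notin> closure {x. \<phi> x \<noteq> 0}" for y
    using that closure_subset[of "{x. \<phi> x \<noteq> 0}"] by auto
  then show "\<phi> x = 0" using x by blast
  have "(\<phi> has_derivative (\<lambda>_. 0)) (at x)"
  proof (rule has_derivative_transform_within_open)
    show "((\<lambda>_. 0) has_derivative (\<lambda>_. 0)) (at x)" by (rule has_derivative_const)
    show "open (- closure {x. \<phi> x \<noteq> 0})" by (rule open_Compl[OF closed_closure])
    show "x \<in> - closure {x. \<phi> x \<noteq> 0}" using x by simp
    show "0 = \<phi> y" if "y \<in> - closure {x. \<phi> x \<noteq> 0}" for y using z[OF ComplD[OF that]] by (rule sym)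
  qed
  then show "frechet_derivative \<phi> (at x) = (\<lambda>_. 0)" by (rule frechet_derivative_at[symmetric])
qed

context bounded_domain
begin

lemma weak_gradient_direction_L2: "has_weak_gradient \<Omega> u g \<Longrightarrow> (\<lambda>x. g x \<bullet> v) \<in> L2 \<Omega>"
proof -
  assume h: "has_weak_gradient \<Omega> u g"
  have "(\<lambda>x. g x \<bullet> v) = (\<Sum>b\<in>Basis. (v \<bullet> b) *\<^sub>R (\<lambda>x. g x \<bullet> b))"
    by (simp add: fun_eq_iff sum_fun_apply euclidean_inner[of _ v] mult.commute)
  then show ?thesis using has_weak_gradient_L2[OF h] by (simp only:) (intro L2.closed_sum L2.closed)
qed

lemma weak_gradient_direction:
  assumes u: "u \<in> L2 \<Omega>" "has_weak_gradient \<Omega> u g" and \<phi>: "test_function \<Omega> \<phi>"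
  shows "ip u (\<lambda>x. frechet_derivative \<phi> (at x) v) = - ip (\<lambda>x. g x \<bullet> v) \<phi>"
proof -
  have L: "(\<lambda>x. g x \<bullet> b) \<in> L2 \<Omega>" "(\<lambda>x. frechet_derivative \<phi> (at x) b) \<in> L2 \<Omega>" if "b \<in> Basis" for b
    using that u \<phi> by (auto intro: has_weak_gradient_L2 test_function_in_L2)
  have g: "(\<lambda>x. g x \<bullet> v) = (\<Sum>b\<in>Basis. (v \<bullet> b) *\<^sub>R (\<lambda>x. g x \<bullet> b))"
    by (simp add: fun_eq_iff sum_fun_apply euclidean_inner[of _ v] mult.commute)
  have d: "(\<lambda>x. frechet_derivative \<phi> (at x) v) = (\<Sum>b\<in>Basis. (v \<bullet> b) *\<^sub>R (\<lambda>x. frechet_derivative \<phi> (at x) b))"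
    using frechet_derivative_Basis_expansion[OF test_function_continuous(2)[OF \<phi>], of _ v]
    by (simp add: fun_eq_iff sum_fun_apply)
  have "ip u (\<lambda>x. frechet_derivative \<phi> (at x) v) = (\<Sum>b\<in>Basis. (v \<bullet> b) * ip u (\<lambda>x. frechet_derivative \<phi> (at x) b))"
    unfolding d using L u by (intro L2.sum_right)
  also have "\<dots> = (\<Sum>b\<in>Basis. (v \<bullet> b) * - ip (\<lambda>x. g x \<bullet> b) \<phi>)"
    using u(2) \<phi> by (intro sum.cong) (auto simp: has_weak_gradient_iff)
  also have "\<dots> = - (\<Sum>b\<in>Basis. (v \<bullet> b) * ip (\<lambda>x. g x \<bullet> b) \<phi>)" by (simp add: sum_negf)
  also have "(\<Sum>b\<in>Basis. (v \<bullet> b) * ip (\<lambda>x. g x \<bullet> b) \<phi>) = ip (\<lambda>x. g x \<bullet> v) \<phi>"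
    unfolding g using L test_function_in_L2(1)[OF \<phi>] by (intro L2.sum_left[symmetric])
  finally show ?thesis .
qed

text \<open>The product of \<open>w\<close> with a test function is compactly supported, so its
  derivative along \<open>b\<close> has integral zero; the product rule splits this into the two
  sides of the weak formulation.\<close>

lemma has_weak_gradient_classical:
  assumes w: "\<And>x. (w has_derivative (\<lambda>h. W x \<bullet> h)) (at x)"
    and W: "\<And>b. b \<in> Basis \<Longrightarrow> continuous_on UNIV (\<lambda>x. W x \<bullet> b)"
  shows "has_weak_gradient \<Omega> w W" "w \<in> H1 \<Omega>"
proof -
  have cw: "continuous_on UNIV w"
    using w by (auto intro!: continuous_at_imp_continuous_on has_derivative_continuous)
  show "has_weak_gradient \<Omega> w W"
    unfolding has_weak_gradient_iff
  proof (intro ballI conjI allI impI)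
    fix b :: 'a assume b: "b \<in> Basis"
    show "(\<lambda>x. W x \<bullet> b) \<in> L2 \<Omega>" using W[OF b] by (rule continuous_in_L2)
    fix \<phi> assume \<phi>: "test_function \<Omega> \<phi>"
    let ?d = "\<lambda>x. frechet_derivative \<phi> (at x) b"
    let ?C = "closure {x. \<phi> x \<noteq> 0}"
    let ?\<psi>' = "\<lambda>x. w x * ?d x + (W x \<bullet> b) * \<phi> x"
    have C: "compact ?C" "?C \<subseteq> \<Omega>" using \<phi> by (auto simp: test_function_def)
    note out = test_function_outside[OF \<phi>]
    have der: "((\<lambda>t. w (x + t *\<^sub>R b) * \<phi> (x + t *\<^sub>R b)) has_real_derivative ?\<psi>' x) (at 0)" for x
    proof -
      have line: "((\<lambda>t. x + t *\<^sub>R b) has_derivative (\<lambda>t. t *\<^sub>R b)) (at 0)"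
        by (auto intro!: derivative_eq_intros)
      have "\<phi> differentiable (at x)" using \<phi> by (rule test_function_continuous)
      then have "(\<phi> has_derivative frechet_derivative \<phi> (at x)) (at x)" by (simp add: frechet_derivative_works)
      from has_derivative_mult[OF w this]
      have "((\<lambda>x. w x * \<phi> x) has_derivative (\<lambda>h. w x * frechet_derivative \<phi> (at x) h + (W x \<bullet> h) * \<phi> x)) (at (x + 0 *\<^sub>R b))"
        by simp
      from has_derivative_compose[OF line this]
      have "((\<lambda>t. w (x + t *\<^sub>R b) * \<phi> (x + t *\<^sub>R b)) has_derivative
          (\<lambda>t. w x * frechet_derivative \<phi> (at x) (t *\<^sub>R b) + (W x \<bullet> t *\<^sub>R b) * \<phi> x)) (at 0)" .
      moreover have "frechet_derivative \<phi> (at x) (t *\<^sub>R b) = t * ?d x" for t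
        using linear_scale[OF linear_frechet_derivative[OF test_function_continuous(2)[OF \<phi>]], of x t b] by simp
      moreover have "(\<lambda>t. w x * (t * ?d x) + (W x \<bullet> t *\<^sub>R b) * \<phi> x) = (*) (?\<psi>' x)"
        by (simp add: fun_eq_iff algebra_simps)
      ultimately show ?thesis by (simp add: has_field_derivative_def)
    qed
    have c\<psi>': "continuous_on UNIV ?\<psi>'"
      using b by (intro continuous_intros cw W test_function_continuous[OF \<phi>])
    have c\<psi>: "continuous_on UNIV (\<lambda>x. w x * \<phi> x)"
      by (intro continuous_intros cw test_function_continuous(1)[OF \<phi>])
    have z: "w x * \<phi> x = 0" "?\<psi>' x = 0" if "x \<notin> ?C" for x
      using out[OF that] by auto
    note I = integral_directional_derivative_eq_0[where \<psi> = "\<lambda>x. w x * \<phi> x" and \<psi>' = ?\<psi>',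
        OF der c\<psi> c\<psi>' C(1) z]
    have "(LINT x|lebesgue_on \<Omega>. ?\<psi>' x) = (LINT x|lebesgue. indicator \<Omega> x *\<^sub>R ?\<psi>' x)"
      by (rule integral_restrict_space) simp
    also have "(\<lambda>x. indicator \<Omega> x *\<^sub>R ?\<psi>' x) = ?\<psi>'"
    proof
      show "indicator \<Omega> x *\<^sub>R ?\<psi>' x = ?\<psi>' x" for x
        using z(2)[of x] C(2) by (cases "x \<in> \<Omega>") auto
    qed
    also have "(LINT x|lebesgue. ?\<psi>' x) = (LINT x|lborel. ?\<psi>' x)"
      using borel_measurable_integrable[OF I(1)] by (intro integral_completion) simp
    finally have "(LINT x|lebesgue_on \<Omega>. ?\<psi>' x) = 0" using I by simp
    moreover have "(LINT x|lebesgue_on \<Omega>. ?\<psi>' x) = ip w ?d + ip (\<lambda>x. W x \<bullet> b) \<phi>"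
      unfolding L2_inner_def
      by (intro Bochner_Integration.integral_add L2_integrable_mult test_function_in_L2[OF \<phi>] b
          continuous_in_L2[OF cw] continuous_in_L2[OF W])
    ultimately show "ip w ?d = - ip (\<lambda>x. W x \<bullet> b) \<phi>" by simp
  qed
  then show "w \<in> H1 \<Omega>" using continuous_in_L2[OF cw] by (auto simp: H1_def)
qed

lemma L2_inner_tendsto_bounded:
  assumes u: "u \<in> L2 \<Omega>" and f: "\<And>n. f n \<in> L2 \<Omega>" "h \<in> L2 \<Omega>"
    and bound: "\<And>n x. x \<in> \<Omega> \<Longrightarrow> \<bar>f n x\<bar> \<le> B" and lim: "\<And>x. x \<in> \<Omega> \<Longrightarrow> (\<lambda>n. f n x) \<longlonglongrightarrow> h x"
  shows "(\<lambda>n. ip u (f n)) \<longlonglongrightarrow> ip u h"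
  unfolding L2_inner_def
proof (rule integral_dominated_convergence[where w = "\<lambda>x. B * \<bar>u x\<bar>"])
  show "integrable (lebesgue_on \<Omega>) (\<lambda>x. B * \<bar>u x\<bar>)" using L2_integrable[OF u] by simp
  show "AE x in lebesgue_on \<Omega>. norm (u x * f n x) \<le> B * \<bar>u x\<bar>" for n
    by (rule AE_I2) (auto simp: abs_mult mult.commute[of B] intro!: mult_left_mono bound)
  show "AE x in lebesgue_on \<Omega>. (\<lambda>n. u x * f n x) \<longlonglongrightarrow> u x * h x"
    by (rule AE_I2, rule tendsto_mult[OF tendsto_const lim]) simp
qed (use u f L2_measurable in auto)

end

context parallelogram
begin

lemma test_function_cutoff:
  assumes U: "\<And>k. Ck k U"
  shows "test_function P (\<lambda>x. cutoff n (\<sigma> x) * cutoff n (\<tau> x) * U x)" (is "test_function P ?\<phi>")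
proof (cases "n = 0")
  \<comment> \<open>For \<open>n = 0\<close> the default \<open>1 / 0 = 0\<close> would turn the set
    \<open>?C\<close> below into the closed parallelogram; the cutoff itself is identically zero
    then.\<close>
  case True
  have "cutoff 0 s = 0" for s by (simp add: cutoff_def flat_def)
  then show ?thesis using True by (simp add: test_function_def Ck_const)
next
  case False
  let ?C = "{x. 1 / real n \<le> \<sigma> x \<and> \<sigma> x \<le> 1 - 1 / real n \<and> 1 / real n \<le> \<tau> x \<and> \<tau> x \<le> 1 - 1 / real n}"
  have pos: "1 / real n > 0" using False by simp
  have "closed ?C" by (intro closed_Collect_conj closed_Collect_le continuous_intros)
  moreover have "{x. ?\<phi> x \<noteq> 0} \<subseteq> ?C" using cutoff_eq_0 by auto
  ultimately have cl: "closure {x. ?\<phi> x \<noteq> 0} \<subseteq> ?C" by (rule closure_minimal[rotated])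
  also have "?C \<subseteq> P" using pos unfolding P_def by (intro Collect_mono) linarith
  finally have "closure {x. ?\<phi> x \<noteq> 0} \<subseteq> P" .
  moreover from this have "compact (closure {x. ?\<phi> x \<noteq> 0})"
    by (auto simp: compact_eq_bounded_closed intro: bounded_subset[OF bounded_dom])
  moreover have "Ck k ?\<phi>" for k
    unfolding \<sigma>_def \<tau>_def by (intro Ck_mult Ck_cutoff U)
  ultimately show ?thesis by (simp add: test_function_def)
qed

lemma cutoff_limit:
  assumes u: "u \<in> L2 P" and U: "\<And>k. Ck k U" "\<And>x. x \<in> P \<Longrightarrow> \<bar>U x\<bar> \<le> B"
  shows "(\<lambda>n. ip u (\<lambda>x. cutoff n (\<sigma> x) * cutoff n (\<tau> x) * U x)) \<longlonglongrightarrow> ip u U"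
proof (rule L2_inner_tendsto_bounded[OF u])
  show "(\<lambda>x. cutoff n (\<sigma> x) * cutoff n (\<tau> x) * U x) \<in> L2 P" for n
    using test_function_cutoff[OF U(1)] by (rule test_function_in_L2)
  show "U \<in> L2 P" using U(1)[of 0] by (intro continuous_in_L2) simp
  fix x assume x: "x \<in> P"
  show "\<bar>cutoff n (\<sigma> x) * cutoff n (\<tau> x) * U x\<bar> \<le> B" for n
  proof -
    have "\<bar>cutoff n (\<sigma> x) * cutoff n (\<tau> x)\<bar> * \<bar>U x\<bar> \<le> 1 * B"
      using cutoff_bounds U(2)[OF x] by (intro mult_mono) (auto simp: abs_mult intro!: mult_le_one)
    then show ?thesis by (simp add: abs_mult)
  qed
  have "(\<lambda>n. cutoff n (\<sigma> x) * cutoff n (\<tau> x) * U x) \<longlonglongrightarrow> 1 * 1 * U x"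
    using x by (intro tendsto_intros cutoff_tendsto_1) (auto simp: P_def)
  then show "(\<lambda>n. cutoff n (\<sigma> x) * cutoff n (\<tau> x) * U x) \<longlonglongrightarrow> U x" by simp
qed

lemma Ck_e: "Ck k (e i j)"
  using Ck_mult[OF Ck_cos[of k "real i * pi" "- (\<alpha> \<bullet> p)" \<alpha> 0] Ck_cos[of k "real j * pi" "- (\<beta> \<bullet> p)" \<beta> 0]]
  by (simp add: e_def[abs_def] \<sigma>_def \<tau>_def)

lemma abs_e_le_1: "\<bar>e i j x\<bar> \<le> 1"
  unfolding e_def abs_mult by (intro mult_le_one) auto

text \<open>Cutting off \<open>e j k\<close> gives test functions that converge boundedly to it, so
  \<open>f\<close> is orthogonal to the complete system of cosine products.\<close>

lemma L2_zero_if_orthogonal_to_test_functions: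
  assumes f: "f \<in> L2 P" and orth: "\<And>\<phi>. test_function P \<phi> \<Longrightarrow> ip f \<phi> = 0"
  shows "AE x in lebesgue_on P. f x = 0"
proof (rule AE_zero_if_orthogonal_to_e)
  show "integrable (lebesgue_on P) f" using f by (rule L2_integrable)
  fix j k
  have "(\<lambda>n. ip f (\<lambda>x. cutoff n (\<sigma> x) * cutoff n (\<tau> x) * e j k x)) \<longlonglongrightarrow> ip f (e j k)"
    using f Ck_e abs_e_le_1 by (rule cutoff_limit)
  then show "(LINT x|lebesgue_on P. f x * e j k x) = 0"
    unfolding orth[OF test_function_cutoff[OF Ck_e]] by (simp add: LIMSEQ_const_iff L2_inner_def)
qed

sublocale neumann_domain P
proof
  fix u g h assume g: "has_weak_gradient P u g" and h: "has_weak_gradient P u h"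
  have "AE x in lebesgue_on P. g x \<bullet> b - h x \<bullet> b = 0" if b: "b \<in> Basis" for b
  proof (rule L2_zero_if_orthogonal_to_test_functions)
    have L: "(\<lambda>x. g x \<bullet> b) \<in> L2 P" "(\<lambda>x. h x \<bullet> b) \<in> L2 P"
      using g h b by (auto intro: has_weak_gradient_L2)
    have eq: "(\<lambda>x. g x \<bullet> b - h x \<bullet> b) = (\<lambda>x. g x \<bullet> b) - (\<lambda>x. h x \<bullet> b)" by (simp add: fun_diff_def)
    show "(\<lambda>x. g x \<bullet> b - h x \<bullet> b) \<in> L2 P" unfolding eq using L by (rule L2.closed(4))
    fix \<phi> assume \<phi>: "test_function P \<phi>"
    have "ip (\<lambda>x. g x \<bullet> b) \<phi> = ip (\<lambda>x. h x \<bullet> b) \<phi>" using g h b \<phi> by (simp add: has_weak_gradient_iff)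
    then show "ip (\<lambda>x. g x \<bullet> b - h x \<bullet> b) \<phi> = 0"
      unfolding eq using L test_function_in_L2(1)[OF \<phi>] by (simp add: L2.diff_left)
  qed
  then have "AE x in lebesgue_on P. \<forall>b\<in>Basis. g x \<bullet> b - h x \<bullet> b = 0"
    by (intro AE_finite_allI) auto
  then show "AE x in lebesgue_on P. g x = h x"
    by eventually_elim (auto intro: euclidean_eqI)
qed

text \<open>The derivative along \<open>a\<close> is \<open>j pi\<close> times \<open>e j k\<close>.
  The sine vanishes on the two sides crossed by \<open>a\<close>; to the other two sides
  \<open>a\<close> is tangential, so the cosine may stay nonzero there.\<close>

definition sin_cos :: "nat \<Rightarrow> nat \<Rightarrow> real^2 \<Rightarrow> real" where
  "sin_cos j k x = sin (real j * pi * \<sigma> x) * cos (real k * pi * \<tau> x)"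

lemma Ck_sin_cos: "Ck m (sin_cos j k)"
  using Ck_mult[OF Ck_sin[of m "real j * pi" "- (\<alpha> \<bullet> p)" \<alpha>] Ck_cos[of m "real k * pi" "- (\<beta> \<bullet> p)" \<beta> 0]]
  by (simp add: sin_cos_def[abs_def] \<sigma>_def \<tau>_def)

lemma abs_sin_cos_le_1: "\<bar>sin_cos i j x\<bar> \<le> 1"
  unfolding sin_cos_def abs_mult by (intro mult_le_one) auto

lemma sin_cos_L2: "sin_cos j k \<in> L2 P"
  using Ck_sin_cos[of 0] by (intro continuous_in_L2) simp

lemma derivative_cutoff_sin_cos:
  "frechet_derivative (\<lambda>x. cutoff n (\<sigma> x) * cutoff n (\<tau> x) * sin_cos j k x) (at x) a =
    cutoff n (\<tau> x) * cos (real k * pi * \<tau> x) *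
      (cutoff' n (\<sigma> x) * sin (real j * pi * \<sigma> x) + cutoff n (\<sigma> x) * (real j * pi * cos (real j * pi * \<sigma> x)))"
proof -
  let ?\<phi> = "\<lambda>x. cutoff n (\<sigma> x) * cutoff n (\<tau> x) * sin_cos j k x"
  have "?\<phi> differentiable (at x)"
    using test_function_cutoff[OF Ck_sin_cos] by (rule test_function_continuous)
  then have d: "(?\<phi> has_derivative frechet_derivative ?\<phi> (at x)) (at (x + 0 *\<^sub>R a))"
    by (simp add: frechet_derivative_works)
  have "((\<lambda>t. x + t *\<^sub>R a) has_derivative (\<lambda>t. t *\<^sub>R a)) (at 0)"
    by (auto intro!: derivative_eq_intros)
  from has_derivative_compose[OF this d]
  have 1: "((\<lambda>t. ?\<phi> (x + t *\<^sub>R a)) has_derivative (\<lambda>t. frechet_derivative ?\<phi> (at x) (t *\<^sub>R a))) (at 0)" .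
  have st: "\<sigma> (x + t *\<^sub>R a) = \<sigma> x + t" "\<tau> (x + t *\<^sub>R a) = \<tau> x" for t
    by (auto simp: \<sigma>_def \<tau>_def inner_add_right dual)
  have c: "((\<lambda>t. cutoff n (\<sigma> x + t)) has_real_derivative cutoff' n (\<sigma> x)) (at 0)"
    by (rule DERIV_chain2[where g = "\<lambda>t. \<sigma> x + t" and Db = 1, simplified])
      (auto intro!: derivative_eq_intros cutoff_has_derivative)
  have s: "((\<lambda>t. sin (real j * pi * (\<sigma> x + t))) has_real_derivative (real j * pi * cos (real j * pi * \<sigma> x))) (at 0)"
    by (auto intro!: derivative_eq_intros)
  have "((\<lambda>t. (cutoff n (\<tau> x) * cos (real k * pi * \<tau> x)) * (cutoff n (\<sigma> x + t) * sin (real j * pi * (\<sigma> x + t))))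
      has_real_derivative (cutoff n (\<tau> x) * cos (real k * pi * \<tau> x)) *
        (cutoff' n (\<sigma> x) * sin (real j * pi * (\<sigma> x + 0)) + (real j * pi * cos (real j * pi * \<sigma> x)) * cutoff n (\<sigma> x + 0))) (at 0)"
    by (intro DERIV_cmult DERIV_mult c s)
  then have "((\<lambda>t. ?\<phi> (x + t *\<^sub>R a)) has_derivative (*) ((cutoff n (\<tau> x) * cos (real k * pi * \<tau> x)) *
        (cutoff' n (\<sigma> x) * sin (real j * pi * (\<sigma> x + 0)) + (real j * pi * cos (real j * pi * \<sigma> x)) * cutoff n (\<sigma> x + 0)))) (at 0)"
    by (simp add: has_field_derivative_def st sin_cos_def mult_ac)
  from fun_cong[OF has_derivative_unique[OF 1 this], of 1] have "frechet_derivative ?\<phi> (at x) (1 *\<^sub>R a) =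
      (cutoff n (\<tau> x) * cos (real k * pi * \<tau> x)) *
        (cutoff' n (\<sigma> x) * sin (real j * pi * (\<sigma> x + 0)) + (real j * pi * cos (real j * pi * \<sigma> x)) * cutoff n (\<sigma> x + 0)) * 1"
    by (simp only:)
  then show ?thesis by (simp add: mult_ac)
qed

text \<open>Since \<open>sin_cos j k\<close> vanishes on two sides of the parallelogram, the cutoff in the direction
  of \<open>a\<close> contributes nothing in the limit.\<close>

lemma weak_derivative_sin_cos:
  assumes u: "u \<in> L2 P" "has_weak_gradient P u g"
  shows "ip (\<lambda>x. g x \<bullet> a) (sin_cos j k) = - (real j * pi) * ip u (e j k)"
proof -
  let ?\<phi> = "\<lambda>n x. cutoff n (\<sigma> x) * cutoff n (\<tau> x) * sin_cos j k x"
  let ?d = "\<lambda>n x. frechet_derivative (?\<phi> n) (at x) a"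
  note test = test_function_cutoff[OF Ck_sin_cos, of _ j k]
  have "(\<lambda>n. ip (\<lambda>x. g x \<bullet> a) (?\<phi> n)) \<longlonglongrightarrow> ip (\<lambda>x. g x \<bullet> a) (sin_cos j k)"
    using weak_gradient_direction_L2[OF u(2)] Ck_sin_cos abs_sin_cos_le_1 by (rule cutoff_limit)
  then have 1: "(\<lambda>n. - ip u (?d n)) \<longlonglongrightarrow> ip (\<lambda>x. g x \<bullet> a) (sin_cos j k)"
    unfolding weak_gradient_direction[OF u test] by simp
  have "(\<lambda>n. ip u (?d n)) \<longlonglongrightarrow> ip u ((real j * pi) *\<^sub>R e j k)"
  proof (rule L2_inner_tendsto_bounded[OF u(1)])
    show "?d n \<in> L2 P" for n
    proof -
      have "?d n = (\<Sum>b\<in>Basis. (a \<bullet> b) *\<^sub>R (\<lambda>x. frechet_derivative (?\<phi> n) (at x) b))"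
        using frechet_derivative_Basis_expansion[OF test_function_continuous(2)[OF test], where v = a]
        by (simp add: fun_eq_iff sum_fun_apply)
      then show ?thesis
        using test_function_in_L2(2)[OF test] by (simp only:) (intro L2.closed_sum L2.closed)
    qed
    show "(real j * pi) *\<^sub>R e j k \<in> L2 P" using e_L2 by auto
    fix x assume "x \<in> P"
    then have x: "0 < \<sigma> x" "\<sigma> x < 1" "0 < \<tau> x" "\<tau> x < 1" by (auto simp: P_def)
    let ?s = "sin (real j * pi * \<sigma> x)"
    have s1: "\<bar>?s\<bar> \<le> (real j * pi) * \<sigma> x"
      using abs_sin_x_le_abs_x[of "real j * pi * \<sigma> x"] x by (simp add: abs_mult)
    \<comment> \<open>Reflecting \<open>\<sigma> x\<close> to \<open>1 - \<sigma> x\<close> changes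
      the sine at most by a sign, so the far side is treated like the near one.\<close>
    have s2: "\<bar>?s\<bar> \<le> (real j * pi) * (1 - \<sigma> x)"
    proof -
      have "sin (real j * pi * (1 - \<sigma> x)) = - cos (real j * pi) * ?s"
        by (simp add: right_diff_distrib sin_diff sin_npi)
      then have "\<bar>sin (real j * pi * (1 - \<sigma> x))\<bar> = \<bar>?s\<bar>" by (simp add: abs_mult cos_npi)
      then show ?thesis
        using abs_sin_x_le_abs_x[of "real j * pi * (1 - \<sigma> x)"] x by (simp add: abs_mult)
    qed
    show "\<bar>?d n x\<bar> \<le> 6 * (real j * pi) + real j * pi" for n
    proof -
      have c: "\<bar>cutoff n (\<sigma> x) * (real j * pi * cos (real j * pi * \<sigma> x))\<bar> \<le> 1 * (real j * pi)"
      proof -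
        have "\<bar>cutoff n (\<sigma> x)\<bar> * \<bar>cos (real j * pi * \<sigma> x)\<bar> \<le> 1"
          using cutoff_bounds by (intro mult_le_one) auto
        then have "(\<bar>cutoff n (\<sigma> x)\<bar> * \<bar>cos (real j * pi * \<sigma> x)\<bar>) * (real j * pi) \<le> 1 * (real j * pi)"
          by (rule mult_right_mono) simp
        then show ?thesis by (simp add: abs_mult mult_ac)
      qed
      have "\<bar>cutoff' n (\<sigma> x) * ?s + cutoff n (\<sigma> x) * (real j * pi * cos (real j * pi * \<sigma> x))\<bar>
          \<le> 6 * (real j * pi) + real j * pi"
        using abs_cutoff'_mult_le[OF x(1,2) s1 s2, of n] c by linarith
      moreover have "\<bar>cutoff n (\<tau> x) * cos (real k * pi * \<tau> x)\<bar> \<le> 1"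
        unfolding abs_mult using cutoff_bounds by (intro mult_le_one) auto
      ultimately have "\<bar>?d n x\<bar> \<le> 1 * (6 * (real j * pi) + real j * pi)"
        unfolding derivative_cutoff_sin_cos abs_mult[of "_ * cos (real k * pi * \<tau> x)"] by (intro mult_mono) auto
      then show ?thesis by simp
    qed
    have "(\<lambda>n. ?d n x) \<longlonglongrightarrow> 1 * cos (real k * pi * \<tau> x) *
        (0 * ?s + 1 * (real j * pi * cos (real j * pi * \<sigma> x)))"
      unfolding derivative_cutoff_sin_cos
      using x by (intro tendsto_intros cutoff_tendsto_1 cutoff'_mult_tendsto_0)
    then show "(\<lambda>n. ?d n x) \<longlonglongrightarrow> ((real j * pi) *\<^sub>R e j k) x" by (simp add: e_def mult_ac)
  qed
  then have "(\<lambda>n. - ip u (?d n)) \<longlonglongrightarrow> - ip u ((real j * pi) *\<^sub>R e j k)" by (rule tendsto_minus)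
  from LIMSEQ_unique[OF 1 this] show ?thesis using u(1) e_L2 by (simp add: L2.scale_right)
qed

end

subsection \<open>The Rellich inequality\<close>

lemma has_integral_cos_int:
  "((\<lambda>s. cos (of_int n * pi * s)) has_integral of_bool (n = 0)) {0..1}"
proof (cases "n = 0")
  case True
  then show ?thesis using has_integral_const_real[of 1 0 1] by simp
next
  case False
  have "((\<lambda>s. cos (of_int n * pi * s)) has_integral
      (sin (of_int n * pi * 1) / (of_int n * pi) - sin (of_int n * pi * 0) / (of_int n * pi))) {0..1}"
    using False
    by (intro fundamental_theorem_of_calculus)
      (auto intro!: derivative_eq_intros simp: has_real_derivative_iff_has_vector_derivative[symmetric])
  moreover have "sin (of_int n * pi) = 0" using sin_npi_int[of n] by (simp add: mult.commute)
  ultimately show ?thesis using False by simp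
qed

text \<open>The Gram matrix of the functions \<open>cos (j pi s)\<close> on the unit interval; for
  positive indices it is that of the sines as well.\<close>

definition cos_inner :: "nat \<Rightarrow> nat \<Rightarrow> real" where
  "cos_inner j k = (if j \<noteq> k then 0 else if j = 0 then 1 else 1 / 2)"

lemma has_integral_cos_cos:
  "((\<lambda>s. cos (real j * pi * s) * cos (real k * pi * s)) has_integral cos_inner j k) {0..1}"
proof -
  have "((\<lambda>s. (cos (of_int (int j - int k) * pi * s) + cos (of_int (int j + int k) * pi * s)) / 2)
      has_integral (of_bool (int j - int k = 0) + of_bool (int j + int k = 0)) / 2) {0..1}"
    by (intro has_integral_divide has_integral_add has_integral_cos_int)
  moreover have "(of_bool (int j - int k = 0) + of_bool (int j + int k = 0)) / 2 = cos_inner j k"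
    by (auto simp: cos_inner_def)
  ultimately show ?thesis by (simp add: cos_times_cos algebra_simps)
qed

lemma has_integral_sin_sin:
  assumes "j > 0" "k > 0"
  shows "((\<lambda>s. sin (real j * pi * s) * sin (real k * pi * s)) has_integral cos_inner j k) {0..1}"
proof -
  have "((\<lambda>s. (cos (of_int (int j - int k) * pi * s) - cos (of_int (int j + int k) * pi * s)) / 2)
      has_integral (of_bool (int j - int k = 0) - of_bool (int j + int k = 0)) / 2) {0..1}"
    by (intro has_integral_divide has_integral_diff has_integral_cos_int)
  moreover have "(of_bool (int j - int k = 0) - of_bool (int j + int k = 0)) / 2 = cos_inner j k"
    using assms by (auto simp: cos_inner_def)
  ultimately show ?thesis by (simp add: sin_times_sin algebra_simps)
qed

context parallelogram
begin

lemma ip_e: "ip (e j k) (e l m) = J * cos_inner j l * cos_inner k m"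
proof -
  have "ip (e j k) (e l m) = (LINT x|lebesgue_on P.
      (\<lambda>s. cos (real j * pi * s) * cos (real l * pi * s)) (\<sigma> x) *
      (\<lambda>s. cos (real k * pi * s) * cos (real m * pi * s)) (\<tau> x))"
    by (simp add: L2_inner_def e_def mult_ac)
  also have "\<dots> = J * cos_inner j l * cos_inner k m"
    by (subst integral_product)
      (auto intro!: continuous_intros simp: integral_unique[OF has_integral_cos_cos])
  finally show ?thesis .
qed

lemma ip_sin_cos:
  assumes "j > 0" "l > 0"
  shows "ip (sin_cos j k) (sin_cos l m) = J * cos_inner j l * cos_inner k m"
proof -
  have "ip (sin_cos j k) (sin_cos l m) = (LINT x|lebesgue_on P.
      (\<lambda>s. sin (real j * pi * s) * sin (real l * pi * s)) (\<sigma> x) *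
      (\<lambda>s. cos (real k * pi * s) * cos (real m * pi * s)) (\<tau> x))"
    by (simp add: L2_inner_def sin_cos_def mult_ac)
  also have "\<dots> = J * cos_inner j l * cos_inner k m"
    by (subst integral_product)
      (auto intro!: continuous_intros
        simp: integral_unique[OF has_integral_cos_cos] integral_unique[OF has_integral_sin_sin[OF assms]])
  finally show ?thesis .
qed

definition E :: "nat \<times> nat \<Rightarrow> real^2 \<Rightarrow> real" where
  "E i = e (fst i) (snd i)"

lemma E_L2 [simp, intro]: "E i \<in> L2 P"
  by (simp add: E_def e_L2)

lemma ip_E_orthogonal: "i \<noteq> i' \<Longrightarrow> ip (E i) (E i') = 0"
  by (cases i; cases i') (auto simp: E_def ip_e cos_inner_def)

lemma ip_E_ge: "J / 4 \<le> ip (E i) (E i)"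
  using J_pos by (auto simp: E_def ip_e cos_inner_def)

lemma ip_E_pos: "0 < ip (E i) (E i)"
  using ip_E_ge[of i] J_pos by simp

text \<open>The squared \<open>L2\<close> norm of the projection of \<open>u\<close> to the line
  spanned by \<open>E i\<close>.\<close>

definition weight :: "(real^2 \<Rightarrow> real) \<Rightarrow> nat \<times> nat \<Rightarrow> real" where
  "weight u i = (ip u (E i))\<^sup>2 / ip (E i) (E i)"

lemma weight_nonneg: "0 \<le> weight u i"
  using ip_E_pos[of i] by (simp add: weight_def)

text \<open>For \<open>fst i > 0\<close> the sine-cosine products are orthogonal with the same norms
  as the cosine products, and the coefficients of the derivative along \<open>a\<close> are those of
  \<open>u\<close> times \<open>- (j pi)\<close>. Bessel's inequality for the derivative thus bounds
  the weighted coefficients of \<open>u\<close>.\<close>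

lemma Bessel_gradient_\<sigma>:
  assumes u: "u \<in> L2 P" "has_weak_gradient P u g" and F: "finite F"
  shows "(\<Sum>i\<in>F. (real (fst i) * pi)\<^sup>2 * weight u i) \<le> ip (\<lambda>x. g x \<bullet> a) (\<lambda>x. g x \<bullet> a)"
proof -
  let ?S = "\<lambda>i. sin_cos (fst i) (snd i)"
  let ?F = "{i\<in>F. fst i > 0}"
  have "(\<Sum>i\<in>F. (real (fst i) * pi)\<^sup>2 * weight u i) = (\<Sum>i\<in>?F. (real (fst i) * pi)\<^sup>2 * weight u i)"
    using F by (intro sum.mono_neutral_right) auto
  also have "\<dots> = (\<Sum>i\<in>?F. (ip (\<lambda>x. g x \<bullet> a) (?S i))\<^sup>2 / ip (?S i) (?S i))"
    by (intro sum.cong)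
      (auto simp: weight_def E_def weak_derivative_sin_cos[OF u] ip_sin_cos ip_e power_mult_distrib)
  also have "\<dots> \<le> ip (\<lambda>x. g x \<bullet> a) (\<lambda>x. g x \<bullet> a)"
  proof (rule L2.Bessel)
    show "(\<lambda>x. g x \<bullet> a) \<in> L2 P" using u(2) by (rule weak_gradient_direction_L2)
    show "ip (?S i) (?S j) = 0" if "i \<in> ?F" "j \<in> ?F" "i \<noteq> j" for i j
      using that by (cases i; cases j) (auto simp: ip_sin_cos cos_inner_def)
    show "ip (?S i) (?S i) > 0" if "i \<in> ?F" for i
      using that J_pos by (auto simp: ip_sin_cos cos_inner_def)
  qed (use F sin_cos_L2 in auto)
  finally show ?thesis .
qed

text \<open>By symmetry: exchanging \<open>a\<close> and \<open>b\<close> exchanges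
  \<open>\<sigma>\<close> and \<open>\<tau>\<close> and keeps \<open>P\<close>.\<close>

lemma Bessel_gradient_\<tau>:
  assumes u: "u \<in> L2 P" "has_weak_gradient P u g" and F: "finite F"
  shows "(\<Sum>i\<in>F. (real (snd i) * pi)\<^sup>2 * weight u i) \<le> ip (\<lambda>x. g x \<bullet> b) (\<lambda>x. g x \<bullet> b)"
proof -
  interpret sw: parallelogram p b a \<beta> \<alpha> by (rule swap)
  have st: "sw.\<sigma> = \<tau>" "sw.\<tau> = \<sigma>" by (auto simp: fun_eq_iff sw.\<sigma>_def sw.\<tau>_def \<sigma>_def \<tau>_def)
  have P: "sw.P = P" by (auto simp: sw.P_def P_def st)
  have "sw.E (snd i, fst i) = E i" for i
    by (simp add: fun_eq_iff sw.E_def E_def sw.e_def e_def st)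
  then have w: "sw.weight u (snd i, fst i) = weight u i" for i
    by (simp add: sw.weight_def weight_def P)
  have "(\<Sum>i\<in>F. (real (snd i) * pi)\<^sup>2 * weight u i) =
      (\<Sum>i\<in>prod.swap ` F. (real (fst i) * pi)\<^sup>2 * sw.weight u i)"
    by (subst sum.reindex) (auto simp: w prod.swap_def)
  also have "\<dots> \<le> ip (\<lambda>x. g x \<bullet> b) (\<lambda>x. g x \<bullet> b)"
    using sw.Bessel_gradient_\<sigma>[of u g "prod.swap ` F"] u F by (simp add: P)
  finally show ?thesis .
qed

text \<open>The partial sums are Cauchy because the sums of weights increase and are bounded. Their
  limit has the coefficients of \<open>u\<close>, hence equals \<open>u\<close> almost everywhere by
  completeness of the cosine products.\<close>

lemma Parseval:
  assumes u: "u \<in> L2 P"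
  shows "(\<lambda>N. \<Sum>i\<in>{..<N} \<times> {..<N}. weight u i) \<longlonglongrightarrow> ip u u"
proof -
  let ?F = "\<lambda>N::nat. {..<N} \<times> {..<N}"
  define c where "c i = ip u (E i) / ip (E i) (E i)" for i
  define s where "s N = (\<Sum>i\<in>?F N. c i *\<^sub>R E i)" for N
  define t where "t N = (\<Sum>i\<in>?F N. weight u i)" for N
  have sL: "s N \<in> L2 P" for N unfolding s_def by (intro L2.closed_sum L2.closed E_L2)
  have cw: "(c i)\<^sup>2 * ip (E i) (E i) = weight u i" for i
    using ip_E_pos[of i] by (simp add: c_def weight_def power2_eq_square)
  have err: "ip (u - s N) (u - s N) = ip u u - t N" for N
    unfolding s_def c_def t_def weight_def
    using u by (intro L2.projection_error) (auto simp: ip_E_orthogonal ip_E_pos)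
  have diff: "ip (s M - s N) (s M - s N) = t M - t N" if "N \<le> M" for M N
  proof -
    have sub: "?F N \<subseteq> ?F M" using that by auto
    have "s M - s N = (\<Sum>i\<in>?F M - ?F N. c i *\<^sub>R E i)"
      unfolding s_def using sub by (subst sum_diff) auto
    then have "ip (s M - s N) (s M - s N) = (\<Sum>i\<in>?F M - ?F N. (c i)\<^sup>2 * ip (E i) (E i))"
      by (simp only:) (intro L2.square_orthogonal_sum, auto simp: ip_E_orthogonal)
    also have "\<dots> = t M - t N" unfolding t_def cw using sub by (intro sum_diff) auto
    finally show ?thesis .
  qed
  have "incseq t" unfolding t_def by (intro monoI sum_mono2) (auto simp: weight_nonneg)
  moreover have "t N \<le> ip u u" for N
    using err[of N] L2.nonneg[of "u - s N" P] L2.closed(4)[OF u sL] by simp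
  ultimately have "convergent t" using incseq_convergent by (metis convergent_def)
  then have "Cauchy t" by (rule convergent_Cauchy)
  have "\<exists>N. \<forall>m\<ge>N. \<forall>n\<ge>N. ip (s m - s n) (s m - s n) < \<epsilon>" if \<epsilon>: "\<epsilon> > 0" for \<epsilon>
  proof -
    obtain N where N: "\<And>m n. \<lbrakk>m \<ge> N; n \<ge> N\<rbrakk> \<Longrightarrow> \<bar>t m - t n\<bar> < \<epsilon>"
      using \<open>Cauchy t\<close> \<epsilon> unfolding Cauchy_def dist_real_def by metis
    have "ip (s m - s n) (s m - s n) < \<epsilon>" if "m \<ge> N" "n \<ge> N" for m n
    proof (cases "n \<le> m")
      case True
      then show ?thesis using diff[OF True] N[OF that] by simp
    next
      case False
      then show ?thesis using diff[of m n] N[OF that] L2.square_diff_swap[OF sL sL, of m n] by simp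
    qed
    then show ?thesis by blast
  qed
  then obtain w where w: "w \<in> L2 P" "(\<lambda>n. ip (s n - w) (s n - w)) \<longlonglongrightarrow> 0"
    using L2_complete[of s P] sL by blast
  have "ip w (E i) = ip u (E i)" for i
  proof -
    have "(\<lambda>n. ip (s n) (E i)) \<longlonglongrightarrow> ip w (E i)" using sL w by (intro L2.tendsto_left) auto
    moreover have "ip (s n) (E i) = ip u (E i)" if "n \<ge> max (Suc (fst i)) (Suc (snd i))" for n
    proof -
      have i: "i \<in> ?F n" using that by (cases i) auto
      have "ip (s n) (E i) = (\<Sum>j\<in>?F n. c j * ip (E j) (E i))"
        unfolding s_def by (intro L2.sum_left E_L2)
      also have "\<dots> = (\<Sum>j\<in>?F n. if j = i then c i * ip (E i) (E i) else 0)"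
        by (intro sum.cong) (auto simp: ip_E_orthogonal)
      also have "\<dots> = c i * ip (E i) (E i)" using i by (simp add: sum.delta)
      finally show ?thesis using ip_E_pos[of i] by (simp add: c_def)
    qed
    then have "(\<lambda>n. ip (s n) (E i)) \<longlonglongrightarrow> ip u (E i)"
      by (intro tendsto_eventually eventually_sequentiallyI) auto
    ultimately show ?thesis by (rule LIMSEQ_unique)
  qed
  then have "ip (u - w) (E i) = 0" for i using u w by (simp add: L2.diff_left)
  then have "ip (u - w) (e j k) = 0" for j k by (metis E_def fst_conv snd_conv)
  then have "AE x in lebesgue_on P. (u - w) x = 0"
    using L2_integrable[OF L2.closed(4)[OF u w(1)]]
    by (intro AE_zero_if_orthogonal_to_e[of "u - w"]) (simp_all only: L2_inner_def)
  then have uw: "ip (u - w) (u - w) = 0"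
    using L2.closed(4)[OF u w(1)] by (simp add: L2_inner_self_eq_0_iff)
  have "(\<lambda>N. ip (u - s N) (u - s N)) \<longlonglongrightarrow> 0"
  proof (rule tendsto_sandwich)
    show "\<forall>\<^sub>F N in sequentially. 0 \<le> ip (u - s N) (u - s N)"
      using u sL by (intro always_eventually allI L2.nonneg L2.closed(4))
    show "\<forall>\<^sub>F N in sequentially. ip (u - s N) (u - s N) \<le> 2 * ip (s N - w) (s N - w)"
    proof (intro always_eventually allI)
      fix N
      have "ip ((u - w) - (s N - w)) ((u - w) - (s N - w)) \<le> 2 * ip (u - w) (u - w) + 2 * ip (s N - w) (s N - w)"
        using u sL w by (intro L2.square_diff_le L2.closed(4))
      moreover have "(u - w) - (s N - w) = u - s N" by simp
      ultimately show "ip (u - s N) (u - s N) \<le> 2 * ip (s N - w) (s N - w)" using uw by simp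
    qed
    show "(\<lambda>N. 2 * ip (s N - w) (s N - w)) \<longlonglongrightarrow> 0" using tendsto_mult_left[OF w(2), of 2] by simp
  qed simp
  then have "(\<lambda>N. ip u u - ip (u - s N) (u - s N)) \<longlonglongrightarrow> ip u u - 0" by (intro tendsto_intros)
  then show ?thesis by (simp add: err t_def)
qed

text \<open>Parseval's sum is split at \<open>F0\<close>: outside it \<open>t\<close> is at most
  \<open>\<omega> i\<close>, and the sum weighted by \<open>\<omega>\<close> is bounded by
  \<open>X\<close>. The set \<open>F0\<close> is a square of frequencies for compactness and one or
  two frequencies for rectangles.\<close>

lemma high_frequency_bound:
  assumes u: "u \<in> L2 P" and X: "\<And>F. finite F \<Longrightarrow> (\<Sum>i\<in>F. \<omega> i * weight u i) \<le> X"
    and F0: "finite F0" and \<omega>: "\<And>i. 0 \<le> \<omega> i" "\<And>i. i \<notin> F0 \<Longrightarrow> t \<le> \<omega> i" and t: "0 \<le> t"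
  shows "t * ip u u \<le> t * (\<Sum>i\<in>F0. weight u i) + X"
proof (rule LIMSEQ_le_const2)
  let ?F = "\<lambda>N::nat. {..<N} \<times> {..<N}"
  show "(\<lambda>N. t * (\<Sum>i\<in>?F N. weight u i)) \<longlonglongrightarrow> t * ip u u"
    by (intro tendsto_intros Parseval u)
  have "t * (\<Sum>i\<in>?F N. weight u i) \<le> t * (\<Sum>i\<in>F0. weight u i) + X" for N
  proof -
    have "(\<Sum>i\<in>?F N. weight u i) = (\<Sum>i\<in>?F N \<inter> F0. weight u i) + (\<Sum>i\<in>?F N - F0. weight u i)"
      by (subst sum.Int_Diff[of _ _ F0]) auto
    also have "(\<Sum>i\<in>?F N \<inter> F0. weight u i) \<le> (\<Sum>i\<in>F0. weight u i)"
      using F0 by (intro sum_mono2) (auto simp: weight_nonneg)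
    finally have "t * (\<Sum>i\<in>?F N. weight u i) \<le> t * ((\<Sum>i\<in>F0. weight u i) + (\<Sum>i\<in>?F N - F0. weight u i))"
      using t by (simp add: mult_left_mono)
    also have "\<dots> = t * (\<Sum>i\<in>F0. weight u i) + (\<Sum>i\<in>?F N - F0. t * weight u i)"
      by (simp add: distrib_left sum_distrib_left)
    also have "(\<Sum>i\<in>?F N - F0. t * weight u i) \<le> (\<Sum>i\<in>?F N - F0. \<omega> i * weight u i)"
      using \<omega>(2) by (intro sum_mono mult_right_mono) (auto simp: weight_nonneg)
    also have "\<dots> \<le> X" by (rule X) simp
    finally show ?thesis by simp
  qed
  then show "\<exists>N. \<forall>n\<ge>N. t * (\<Sum>i\<in>?F n. weight u i) \<le> t * (\<Sum>i\<in>F0. weight u i) + X" by blast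
qed

lemma dirichlet_form_direction_le:
  assumes u: "u \<in> H1 P"
  shows "ip (\<lambda>x. weak_gradient P u x \<bullet> v) (\<lambda>x. weak_gradient P u x \<bullet> v) \<le> (v \<bullet> v) * D u u"
proof -
  let ?g = "weak_gradient P u"
  have L: "(\<lambda>x. ?g x \<bullet> v) \<in> L2 P" for v by (rule weak_gradient_direction_L2[OF weak_gradient[OF u]])
  have int: "integrable (lebesgue_on P) (\<lambda>x. ?g x \<bullet> ?g x)"
  proof -
    have "(\<lambda>x. ?g x \<bullet> ?g x) = (\<lambda>x. \<Sum>b\<in>Basis. (?g x \<bullet> b) * (?g x \<bullet> b))"
      by (rule ext) (rule euclidean_inner)
    then show ?thesis
      by (simp only:) (intro Bochner_Integration.integrable_sum L2_integrable_mult L)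
  qed
  have "ip (\<lambda>x. ?g x \<bullet> v) (\<lambda>x. ?g x \<bullet> v) \<le> (LINT x|lebesgue_on P. (v \<bullet> v) * (?g x \<bullet> ?g x))"
    unfolding L2_inner_def
  proof (rule integral_mono)
    show "?g x \<bullet> v * (?g x \<bullet> v) \<le> v \<bullet> v * (?g x \<bullet> ?g x)" for x
      using Cauchy_Schwarz_ineq[of "?g x" v] by (simp add: power2_eq_square mult.commute)
  qed (use int L2_integrable_mult[OF L L] in auto)
  also have "\<dots> = (v \<bullet> v) * D u u" by (simp add: dirichlet_form_def)
  finally show ?thesis .
qed

text \<open>Outside the square of side \<open>N\<close> one index is at least \<open>N\<close>, so
  the two squared frequencies add up to at least \<open>(N pi)^2\<close>; the two Bessel
  inequalities bound the sum weighted in this way by the Dirichlet form.\<close>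

lemma Rellich_inequality:
  assumes u: "u \<in> H1 P" and N: "N > 0"
  shows "ip u u \<le> (\<Sum>i\<in>{..<N} \<times> {..<N}. weight u i) + (a \<bullet> a + b \<bullet> b) / (real N * pi)\<^sup>2 * D u u"
proof -
  let ?g = "weak_gradient P u" and ?t = "(real N * pi)\<^sup>2"
  note u' = H1_L2[OF u] weak_gradient[OF u]
  have t: "?t > 0" using N by simp
  have "?t * ip u u \<le> ?t * (\<Sum>i\<in>{..<N} \<times> {..<N}. weight u i) + (a \<bullet> a + b \<bullet> b) * D u u"
  proof (rule high_frequency_bound[where \<omega> = "\<lambda>i. (real (fst i) * pi)\<^sup>2 + (real (snd i) * pi)\<^sup>2", OF u'(1)])
    fix F :: "(nat \<times> nat) set" assume F: "finite F"
    show "(\<Sum>i\<in>F. ((real (fst i) * pi)\<^sup>2 + (real (snd i) * pi)\<^sup>2) * weight u i) \<le> (a \<bullet> a + b \<bullet> b) * D u u"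
      using Bessel_gradient_\<sigma>[OF u' F] Bessel_gradient_\<tau>[OF u' F]
        dirichlet_form_direction_le[OF u, of a] dirichlet_form_direction_le[OF u, of b]
      by (simp add: distrib_right sum.distrib)
  next
    fix i :: "nat \<times> nat" assume "i \<notin> {..<N} \<times> {..<N}"
    then have "N \<le> fst i \<or> N \<le> snd i" by (cases i) auto
    then show "?t \<le> (real (fst i) * pi)\<^sup>2 + (real (snd i) * pi)\<^sup>2"
    proof
      assume "N \<le> fst i"
      then have "?t \<le> (real (fst i) * pi)\<^sup>2" by (intro power_mono mult_right_mono) auto
      then show ?thesis using zero_le_power2[of "real (snd i) * pi"] by linarith
    next
      assume "N \<le> snd i"
      then have "?t \<le> (real (snd i) * pi)\<^sup>2" by (intro power_mono mult_right_mono) auto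
      then show ?thesis using zero_le_power2[of "real (fst i) * pi"] by linarith
    qed
  qed auto
  moreover have "x \<le> W + c / t * y" if "t * x \<le> t * W + c * y" "t > 0" for x W c t y :: real
    using that by (simp add: field_simps)
  ultimately show ?thesis using t by blast
qed

sublocale compact_form_pair "H1 P" ip D
proof
  fix v :: "nat \<Rightarrow> real^2 \<Rightarrow> real" and B
  assume v: "\<And>n. v n \<in> H1 P" "\<And>n. ip (v n) (v n) \<le> B" "\<And>n. D (v n) (v n) \<le> B"
  show "\<exists>r. strict_mono (r :: nat \<Rightarrow> nat) \<and>
        (\<forall>e>0. \<exists>N. \<forall>i\<ge>N. \<forall>j\<ge>N. ip (v (r i) - v (r j)) (v (r i) - v (r j)) < e)"
  proof (rule precompact_by_functionals[where \<psi> = "\<lambda>i u. ip u (E i)" and C = "\<lambda>i. ip (E i) (E i)"])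
    fix i u w assume "u \<in> H1 P" "w \<in> H1 P"
    then show "ip (u - w) (E i) = ip u (E i) - ip w (E i)" by (intro L2.diff_left H1_L2 E_L2)
  next
    fix i u assume "u \<in> H1 P"
    then show "(ip u (E i))\<^sup>2 \<le> ip (E i) (E i) * ip u u"
      using L2.Cauchy_Schwarz[of u P "E i"] H1_L2 by (simp add: mult.commute)
  next
    fix \<epsilon> :: real assume \<epsilon>: "\<epsilon> > 0"
    let ?c = "a \<bullet> a + b \<bullet> b"
    \<comment> \<open>Chosen so that \<open>?c \<le> \<epsilon> * N\<close>; then
      \<open>(N pi)^2 \<ge> N\<close> brings the factor in front of \<open>D\<close> down to
      \<open>\<epsilon>\<close>. The constant \<open>4 / J\<close> below comes from the lower bound
      \<open>J / 4\<close> in \<open>ip_E_ge\<close>.\<close>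
    obtain N :: nat where N: "real N > ?c / \<epsilon> + 1" using reals_Archimedean2 by blast
    have c: "0 \<le> ?c" by simp
    then have N1: "real N \<ge> 1" using N \<epsilon> by (smt (verit) divide_nonneg_pos)
    have "?c / (real N * pi)\<^sup>2 \<le> \<epsilon>"
    proof -
      have "1 * real N \<le> pi\<^sup>2 * (real N * real N)"
        using N1 pi_ge_two by (intro mult_mono) (auto simp: power2_eq_square intro: order_trans[OF _ mult_mono[of 1 pi 1 pi]])
      then have "?c \<le> \<epsilon> * (real N * pi)\<^sup>2"
      proof -
        have "?c \<le> \<epsilon> * real N" using N \<epsilon> by (simp add: field_simps)
        also have "\<dots> \<le> \<epsilon> * (real N * pi)\<^sup>2"
          using \<epsilon> \<open>1 * real N \<le> _\<close> by (intro mult_left_mono) (auto simp: power2_eq_square mult_ac)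
        finally show ?thesis .
      qed
      then show ?thesis using N1 by (simp add: divide_le_eq)
    qed
    note cN = this
    have "ip u u \<le> 4 / J * (\<Sum>i\<in>{..<N} \<times> {..<N}. (ip u (E i))\<^sup>2) + \<epsilon> * D u u" if u: "u \<in> H1 P" for u
    proof -
      have "(\<Sum>i\<in>{..<N} \<times> {..<N}. weight u i) \<le> (\<Sum>i\<in>{..<N} \<times> {..<N}. 4 / J * (ip u (E i))\<^sup>2)"
      proof (rule sum_mono)
        fix i
        have "(ip u (E i))\<^sup>2 / ip (E i) (E i) \<le> (ip u (E i))\<^sup>2 / (J / 4)"
          using ip_E_ge[of i] ip_E_pos[of i] J_pos by (intro divide_left_mono) auto
        then show "weight u i \<le> 4 / J * (ip u (E i))\<^sup>2" by (simp add: weight_def mult.commute)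
      qed
      moreover have "?c / (real N * pi)\<^sup>2 * D u u \<le> \<epsilon> * D u u"
        using cN d.nonneg[OF u] by (rule mult_right_mono)
      ultimately show ?thesis
        using Rellich_inequality[OF u, of N] N1 by (simp add: sum_distrib_left)
    qed
    then show "\<exists>F K. finite F \<and> (\<forall>u\<in>H1 P. ip u u \<le> K * (\<Sum>i\<in>F. (ip u (E i))\<^sup>2) + \<epsilon> * D u u)"
      by (intro exI[of _ "{..<N} \<times> {..<N}"] exI[of _ "4 / J"]) auto
  qed (use v ip_E_pos[THEN less_imp_le] in auto)
next
  fix v :: "nat \<Rightarrow> real^2 \<Rightarrow> real"
  assume "\<And>n. v n \<in> H1 P" "\<And>e. e > 0 \<Longrightarrow> \<exists>N. \<forall>i\<ge>N. \<forall>j\<ge>N. ip (v i - v j) (v i - v j) < e"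
    "\<And>e. e > 0 \<Longrightarrow> \<exists>N. \<forall>i\<ge>N. \<forall>j\<ge>N. D (v i - v j) (v i - v j) < e"
  then show "\<exists>w\<in>H1 P. (\<lambda>n. ip (v n - w) (v n - w)) \<longlonglongrightarrow> 0 \<and> (\<lambda>n. D (v n - w) (v n - w)) \<longlonglongrightarrow> 0"
    by (rule H1_complete)
qed

text \<open>For orthogonal sides the squared gradient is exactly the sum of its squared products
  with \<open>a\<close> and \<open>b\<close>, divided by the squared side lengths. Hence Bessel's
  inequality gives the sharp numbers
  \<open>(j pi)^2 / (a \<bullet> a) + (k pi)^2 / (b \<bullet> b)\<close> once the frequencies in
  \<open>F0\<close> are removed.\<close>

lemma rectangle_spectral_bound:
  assumes ab: "a \<bullet> b = 0" and u: "u \<in> H1 P" and F0: "finite F0" "\<And>i. i \<in> F0 \<Longrightarrow> ip u (E i) = 0"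
    and t: "0 \<le> t" "\<And>i. i \<notin> F0 \<Longrightarrow> t \<le> (real (fst i) * pi)\<^sup>2 / (a \<bullet> a) + (real (snd i) * pi)\<^sup>2 / (b \<bullet> b)"
  shows "t * ip u u \<le> D u u"
proof -
  let ?g = "weak_gradient P u"
  note u' = H1_L2[OF u] weak_gradient[OF u]
  have pos: "a \<bullet> a > 0" "b \<bullet> b > 0" using dual by auto
  have L: "(\<lambda>x. ?g x \<bullet> v) \<in> L2 P" for v by (rule weak_gradient_direction_L2[OF u'(2)])
  have "(a \<bullet> a) *\<^sub>R \<alpha> = a" "(b \<bullet> b) *\<^sub>R \<beta> = b"
    using expansion_dual[of a] expansion_dual[of b] ab by (simp_all add: inner_commute[of b a])
  then have al: "\<alpha> = (1 / (a \<bullet> a)) *\<^sub>R a" and be: "\<beta> = (1 / (b \<bullet> b)) *\<^sub>R b"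
    using pos by (metis scaleR_scaleR nonzero_eq_divide_eq scaleR_one less_irrefl)+
  have "y \<bullet> y = (1 / (a \<bullet> a)) * ((y \<bullet> a) * (y \<bullet> a)) + (1 / (b \<bullet> b)) * ((y \<bullet> b) * (y \<bullet> b))" for y
  proof -
    have "y \<bullet> \<alpha> = (1 / (a \<bullet> a)) * (y \<bullet> a)" "y \<bullet> \<beta> = (1 / (b \<bullet> b)) * (y \<bullet> b)"
      by (metis al inner_scaleR_right, metis be inner_scaleR_right)
    moreover have "y \<bullet> y = (a \<bullet> y) * (y \<bullet> \<alpha>) + (b \<bullet> y) * (y \<bullet> \<beta>)"
      using arg_cong[OF expansion_dual[of y, symmetric], of "\<lambda>z. y \<bullet> z"]
      by (simp only: inner_add_right inner_scaleR_right)
    ultimately show ?thesis by (simp add: inner_commute[of a y] inner_commute[of b y] mult_ac)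
  qed
  then have g: "?g x \<bullet> ?g x = (1 / (a \<bullet> a)) * ((?g x \<bullet> a) * (?g x \<bullet> a)) +
      (1 / (b \<bullet> b)) * ((?g x \<bullet> b) * (?g x \<bullet> b))" for x .
  have D: "D u u = (1 / (a \<bullet> a)) * ip (\<lambda>x. ?g x \<bullet> a) (\<lambda>x. ?g x \<bullet> a) + (1 / (b \<bullet> b)) * ip (\<lambda>x. ?g x \<bullet> b) (\<lambda>x. ?g x \<bullet> b)"
    unfolding dirichlet_form_def g L2_inner_def
    using L2_integrable_mult[OF L L] by (subst Bochner_Integration.integral_add) auto
  have "t * ip u u \<le> t * (\<Sum>i\<in>F0. weight u i) + D u u"
  proof (rule high_frequency_bound[where \<omega> = "\<lambda>i. (real (fst i) * pi)\<^sup>2 / (a \<bullet> a) + (real (snd i) * pi)\<^sup>2 / (b \<bullet> b)", OF u'(1)])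
    fix F :: "(nat \<times> nat) set" assume F: "finite F"
    have "(\<Sum>i\<in>F. ((real (fst i) * pi)\<^sup>2 / (a \<bullet> a) + (real (snd i) * pi)\<^sup>2 / (b \<bullet> b)) * weight u i) =
      (1 / (a \<bullet> a)) * (\<Sum>i\<in>F. (real (fst i) * pi)\<^sup>2 * weight u i) +
      (1 / (b \<bullet> b)) * (\<Sum>i\<in>F. (real (snd i) * pi)\<^sup>2 * weight u i)"
      by (simp add: sum_distrib_left sum.distrib[symmetric] distrib_right)
    also have "\<dots> \<le> D u u"
      unfolding D using pos Bessel_gradient_\<sigma>[OF u' F] Bessel_gradient_\<tau>[OF u' F]
      by (intro add_mono mult_left_mono) auto
    finally show "(\<Sum>i\<in>F. ((real (fst i) * pi)\<^sup>2 / (a \<bullet> a) + (real (snd i) * pi)\<^sup>2 / (b \<bullet> b)) * weight u i) \<le> D u u" .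
  qed (use F0 t pos in auto)
  moreover have "(\<Sum>i\<in>F0. weight u i) = 0" using F0 by (simp add: weight_def)
  ultimately show ?thesis by simp
qed

section \<open>Gradients of functions of one coordinate\<close>

lemma has_weak_gradient_\<sigma>:
  assumes f: "\<And>s. (f has_real_derivative f' s) (at s)" and f': "continuous_on UNIV f'"
  shows "has_weak_gradient P (\<lambda>x. f (\<sigma> x)) (\<lambda>x. f' (\<sigma> x) *\<^sub>R \<alpha>)" "(\<lambda>x. f (\<sigma> x)) \<in> H1 P"
proof -
  have "((\<lambda>x. f (\<sigma> x)) has_derivative (\<lambda>h. (f' (\<sigma> x) *\<^sub>R \<alpha>) \<bullet> h)) (at x)" for x
    using has_derivative_ridge[of f "f' (\<sigma> x)" "- (\<alpha> \<bullet> p)" \<alpha> x] f by (simp add: \<sigma>_def mult.commute)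
  moreover have "continuous_on UNIV (\<lambda>x. (f' (\<sigma> x) *\<^sub>R \<alpha>) \<bullet> b)" for b
    using continuous_comp_\<sigma>[OF f'] by (auto intro!: continuous_intros)
  ultimately show "has_weak_gradient P (\<lambda>x. f (\<sigma> x)) (\<lambda>x. f' (\<sigma> x) *\<^sub>R \<alpha>)" "(\<lambda>x. f (\<sigma> x)) \<in> H1 P"
    by (rule has_weak_gradient_classical[where W = "\<lambda>x. f' (\<sigma> x) *\<^sub>R \<alpha>"])+
qed

lemma has_weak_gradient_\<tau>:
  assumes f: "\<And>s. (f has_real_derivative f' s) (at s)" and f': "continuous_on UNIV f'"
  shows "has_weak_gradient P (\<lambda>x. f (\<tau> x)) (\<lambda>x. f' (\<tau> x) *\<^sub>R \<beta>)" "(\<lambda>x. f (\<tau> x)) \<in> H1 P"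
proof -
  have "((\<lambda>x. f (\<tau> x)) has_derivative (\<lambda>h. (f' (\<tau> x) *\<^sub>R \<beta>) \<bullet> h)) (at x)" for x
    using has_derivative_ridge[of f "f' (\<tau> x)" "- (\<beta> \<bullet> p)" \<beta> x] f by (simp add: \<tau>_def mult.commute)
  moreover have "continuous_on UNIV (\<lambda>x. (f' (\<tau> x) *\<^sub>R \<beta>) \<bullet> b)" for b
    using continuous_comp_\<tau>[OF f'] by (auto intro!: continuous_intros)
  ultimately show "has_weak_gradient P (\<lambda>x. f (\<tau> x)) (\<lambda>x. f' (\<tau> x) *\<^sub>R \<beta>)" "(\<lambda>x. f (\<tau> x)) \<in> H1 P"
    by (rule has_weak_gradient_classical[where W = "\<lambda>x. f' (\<tau> x) *\<^sub>R \<beta>"])+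
qed

lemma dirichlet_form_of_rank_one:
  assumes "u \<in> L2 P" "has_weak_gradient P u (\<lambda>x. A x *\<^sub>R v)" "w \<in> L2 P" "has_weak_gradient P w (\<lambda>x. B x *\<^sub>R z)"
  shows "D u w = (v \<bullet> z) * (LINT x|lebesgue_on P. A x * B x)"
proof -
  have "D u w = (\<Sum>b\<in>Basis. ip (\<lambda>x. (A x *\<^sub>R v) \<bullet> b) (\<lambda>x. (B x *\<^sub>R z) \<bullet> b))"
    by (rule dirichlet_form_eq[OF assms])
  also have "\<dots> = (\<Sum>b\<in>Basis. ((v \<bullet> b) * (z \<bullet> b)) * (LINT x|lebesgue_on P. A x * B x))"
  proof (rule sum.cong[OF refl])
    fix b :: "real^2"
    have "(\<lambda>x. ((A x *\<^sub>R v) \<bullet> b) * ((B x *\<^sub>R z) \<bullet> b)) = (\<lambda>x. ((v \<bullet> b) * (z \<bullet> b)) * (A x * B x))"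
      by (simp add: fun_eq_iff mult_ac)
    then show "ip (\<lambda>x. (A x *\<^sub>R v) \<bullet> b) (\<lambda>x. (B x *\<^sub>R z) \<bullet> b) = ((v \<bullet> b) * (z \<bullet> b)) * (LINT x|lebesgue_on P. A x * B x)"
      unfolding L2_inner_def by simp
  qed
  also have "\<dots> = (v \<bullet> z) * (LINT x|lebesgue_on P. A x * B x)"
    by (simp add: euclidean_inner[of v z] sum_distrib_right)
  finally show ?thesis .
qed

end

subsection \<open>Trial spaces\<close>

text \<open>The eigenvalues of the symmetric matrix with rows \<open>(p, q)\<close> and \<open>(q, r)\<close>.\<close>

definition quadratic_max :: "real \<Rightarrow> real \<Rightarrow> real \<Rightarrow> real" where
  "quadratic_max p q r = (p + r + sqrt ((p - r)\<^sup>2 + 4 * q\<^sup>2)) / 2"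

definition quadratic_min :: "real \<Rightarrow> real \<Rightarrow> real \<Rightarrow> real" where
  "quadratic_min p q r = (p + r - sqrt ((p - r)\<^sup>2 + 4 * q\<^sup>2)) / 2"

text \<open>With M the matrix and L its larger eigenvalue, the two factors are the diagonal entries
  of 2 (L - M). This matrix is singular, so their product is the square of its off-diagonal entry
  \<open>- 2 * q\<close>.\<close>

lemma quadratic_form_discriminant:
  fixes p q r :: real
  defines "S \<equiv> sqrt ((p - r)\<^sup>2 + 4 * q\<^sup>2)"
  shows "0 \<le> S - (p - r)" "0 \<le> S + (p - r)" "(S - (p - r)) * (S + (p - r)) = 4 * q\<^sup>2"
proof -
  have "sqrt ((p - r)\<^sup>2) \<le> S" unfolding S_def by (intro real_sqrt_le_mono) simp
  then show "0 \<le> S - (p - r)" "0 \<le> S + (p - r)" by auto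
  have "S\<^sup>2 = (p - r)\<^sup>2 + 4 * q\<^sup>2" unfolding S_def by simp
  then show "(S - (p - r)) * (S + (p - r)) = 4 * q\<^sup>2" by (simp add: power2_eq_square algebra_simps)
qed

lemma quadratic_form_le:
  fixes p q r x y :: real
  shows "p * x\<^sup>2 + 2 * q * (x * y) + r * y\<^sup>2 \<le> quadratic_max p q r * (x\<^sup>2 + y\<^sup>2)"
proof -
  define S where "S = sqrt ((p - r)\<^sup>2 + 4 * q\<^sup>2)"
  define A where "A = S - (p - r)"
  define B where "B = S + (p - r)"
  have AB: "A \<ge> 0" "B \<ge> 0" "A * B = 4 * q\<^sup>2"
    using quadratic_form_discriminant[of p r q] by (auto simp: A_def B_def S_def)
  have "\<bar>2 * q\<bar> = sqrt A * sqrt B"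
    unfolding real_sqrt_mult[symmetric] AB(3) by (simp add: real_sqrt_mult real_sqrt_abs)
  note eq = this
  have "4 * q * (x * y) \<le> \<bar>4 * q * (x * y)\<bar>" by (rule abs_ge_self)
  also have "\<dots> = 2 * (\<bar>2 * q\<bar> * (\<bar>x\<bar> * \<bar>y\<bar>))" by (simp add: abs_mult)
  also have "\<dots> = 2 * ((sqrt A * \<bar>x\<bar>) * (sqrt B * \<bar>y\<bar>))" unfolding eq by (simp only: mult_ac)
  also have "\<dots> \<le> (sqrt A * \<bar>x\<bar>)\<^sup>2 + (sqrt B * \<bar>y\<bar>)\<^sup>2"
    using zero_le_power2[of "sqrt A * \<bar>x\<bar> - sqrt B * \<bar>y\<bar>"] by (simp add: power2_eq_square algebra_simps)
  also have "\<dots> = A * x\<^sup>2 + B * y\<^sup>2" using AB by (simp add: power_mult_distrib)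
  finally show ?thesis unfolding quadratic_max_def S_def[symmetric] A_def B_def
    by (simp add: power2_eq_square field_simps)
qed

lemma quadratic_form_min_attained:
  fixes p q r :: real
  shows "\<exists>x y. (x \<noteq> 0 \<or> y \<noteq> 0) \<and> p * x\<^sup>2 + 2 * q * (x * y) + r * y\<^sup>2 = quadratic_min p q r * (x\<^sup>2 + y\<^sup>2)"
proof -
  define S where "S = sqrt ((p - r)\<^sup>2 + 4 * q\<^sup>2)"
  define A where "A = S - (p - r)"
  define B where "B = S + (p - r)"
  have AB: "A * B = 4 * q\<^sup>2"
    using quadratic_form_discriminant[of p r q] by (auto simp: A_def B_def S_def)
  have "\<exists>x y. (x \<noteq> 0 \<or> y \<noteq> 0) \<and> B * x\<^sup>2 + 4 * q * (x * y) + A * y\<^sup>2 = 0"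
  proof (cases "B = 0")
    case True
    then show ?thesis by (intro exI[of _ 1] exI[of _ 0]) simp
  next
    case False
    \<comment> \<open>The vector \<open>(- 2 * q, B)\<close> lies in the kernel of the matrix with
      rows \<open>(B, 2 * q)\<close> and \<open>(2 * q, A)\<close>, which is twice the given matrix
      minus its smaller eigenvalue. For \<open>B = 0\<close> that vector is zero, and
      \<open>(1, 0)\<close> takes its place.\<close>
    have "B * (- 2 * q)\<^sup>2 + 4 * q * ((- 2 * q) * B) + A * B\<^sup>2 = B * (A * B - 4 * q\<^sup>2)"
      by (simp add: power2_eq_square algebra_simps)
    then show ?thesis using False AB by (intro exI[of _ "- 2 * q"] exI[of _ B]) auto
  qed
  then show ?thesis unfolding quadratic_min_def S_def[symmetric] A_def B_def
    by (simp add: power2_eq_square field_simps)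
qed

lemma (in form_pair) orthogonal_family_independent:
  assumes w: "\<And>i. i < n \<Longrightarrow> w i \<in> S" "\<And>i. i < n \<Longrightarrow> 0 < q (w i) (w i)"
    and orth: "\<And>i j. \<lbrakk>i < n; j < n; i \<noteq> j\<rbrakk> \<Longrightarrow> q (w i) (w j) = 0"
  shows "q_independent n w"
  unfolding q_independent_def
proof (intro allI impI)
  fix c i assume 0: "q (\<Sum>i<n. c i *\<^sub>R w i) (\<Sum>i<n. c i *\<^sub>R w i) = 0" and i: "i < n"
  have "q (\<Sum>i<n. c i *\<^sub>R w i) (\<Sum>i<n. c i *\<^sub>R w i) = (\<Sum>i<n. (c i)\<^sup>2 * q (w i) (w i))"
    using w orth by (intro q.square_orthogonal_sum) auto
  then have "(\<Sum>i<n. (c i)\<^sup>2 * q (w i) (w i)) = 0" using 0 by simp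
  then have "\<forall>i\<in>{..<n}. (c i)\<^sup>2 * q (w i) (w i) = 0"
    using w(2) by (subst (asm) sum_nonneg_eq_0_iff) (auto simp: less_imp_le)
  then show "c i = 0" using i w(2)[OF i] by auto
qed

context parallelogram
begin

lemma const_H1 [intro, simp]: "(\<lambda>_. c) \<in> H1 P"
  using has_weak_gradient_\<sigma>(2)[of "\<lambda>_. c" "\<lambda>_. 0"] by simp

lemma D_const: "v \<in> H1 P \<Longrightarrow> D (\<lambda>_. c) v = 0"
proof -
  assume v: "v \<in> H1 P"
  have h: "has_weak_gradient P (\<lambda>_. c) (\<lambda>_. 0)"
    using has_weak_gradient_\<sigma>(1)[of "\<lambda>_. c" "\<lambda>_. 0"] by simp
  show ?thesis
    by (subst dirichlet_form_eq[OF H1_L2[OF const_H1] h H1_L2[OF v] weak_gradient[OF v]])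
      (simp add: L2_inner_def)
qed

lemma ip_\<sigma>\<sigma>: "\<lbrakk>continuous_on UNIV f; continuous_on UNIV h\<rbrakk> \<Longrightarrow>
    ip (\<lambda>x. f (\<sigma> x)) (\<lambda>x. h (\<sigma> x)) = J * integral {0..1} (\<lambda>s. f s * h s)"
  using integral_product[of "\<lambda>s. f s * h s" "\<lambda>_. 1"] by (simp add: L2_inner_def continuous_intros)

lemma ip_\<tau>\<tau>: "\<lbrakk>continuous_on UNIV f; continuous_on UNIV h\<rbrakk> \<Longrightarrow>
    ip (\<lambda>x. f (\<tau> x)) (\<lambda>x. h (\<tau> x)) = J * integral {0..1} (\<lambda>s. f s * h s)"
  using integral_product[of "\<lambda>_. 1" "\<lambda>s. f s * h s"] by (simp add: L2_inner_def continuous_intros)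

lemma ip_\<sigma>\<tau>: "\<lbrakk>continuous_on UNIV f; continuous_on UNIV h\<rbrakk> \<Longrightarrow>
    ip (\<lambda>x. f (\<sigma> x)) (\<lambda>x. h (\<tau> x)) = J * integral {0..1} f * integral {0..1} h"
  using integral_product[of f h] by (simp add: L2_inner_def)

lemma ip_const_\<sigma>: "continuous_on UNIV f \<Longrightarrow> ip (\<lambda>_. c) (\<lambda>x. f (\<sigma> x)) = J * (c * integral {0..1} f)"
  using ip_\<sigma>\<sigma>[of "\<lambda>_. c" f] by simp

lemma ip_const_\<tau>: "continuous_on UNIV f \<Longrightarrow> ip (\<lambda>_. c) (\<lambda>x. f (\<tau> x)) = J * (c * integral {0..1} f)"
  using ip_\<tau>\<tau>[of "\<lambda>_. c" f] by simp

lemma ip_const_const: "ip (\<lambda>_. c) (\<lambda>_. d) = J * (c * d)"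
  using ip_\<sigma>\<sigma>[of "\<lambda>_. c" "\<lambda>_. d"] by simp

context
  fixes f f' h h' :: "real \<Rightarrow> real"
  assumes f: "\<And>s. (f has_real_derivative f' s) (at s)" "continuous_on UNIV f'"
    and h: "\<And>s. (h has_real_derivative h' s) (at s)" "continuous_on UNIV h'"
begin

lemma D_\<sigma>\<sigma>: "D (\<lambda>x. f (\<sigma> x)) (\<lambda>x. h (\<sigma> x)) = (\<alpha> \<bullet> \<alpha>) * (J * integral {0..1} (\<lambda>s. f' s * h' s))"
  using dirichlet_form_of_rank_one[OF H1_L2[OF has_weak_gradient_\<sigma>(2)[OF f]] has_weak_gradient_\<sigma>(1)[OF f]
      H1_L2[OF has_weak_gradient_\<sigma>(2)[OF h]] has_weak_gradient_\<sigma>(1)[OF h]] ip_\<sigma>\<sigma>[OF f(2) h(2)]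
  by (simp add: L2_inner_def)

lemma D_\<tau>\<tau>: "D (\<lambda>x. f (\<tau> x)) (\<lambda>x. h (\<tau> x)) = (\<beta> \<bullet> \<beta>) * (J * integral {0..1} (\<lambda>s. f' s * h' s))"
  using dirichlet_form_of_rank_one[OF H1_L2[OF has_weak_gradient_\<tau>(2)[OF f]] has_weak_gradient_\<tau>(1)[OF f]
      H1_L2[OF has_weak_gradient_\<tau>(2)[OF h]] has_weak_gradient_\<tau>(1)[OF h]] ip_\<tau>\<tau>[OF f(2) h(2)]
  by (simp add: L2_inner_def)

lemma D_\<sigma>\<tau>: "D (\<lambda>x. f (\<sigma> x)) (\<lambda>x. h (\<tau> x)) = (\<alpha> \<bullet> \<beta>) * (J * (integral {0..1} f' * integral {0..1} h'))"
  using dirichlet_form_of_rank_one[OF H1_L2[OF has_weak_gradient_\<sigma>(2)[OF f]] has_weak_gradient_\<sigma>(1)[OF f]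
      H1_L2[OF has_weak_gradient_\<tau>(2)[OF h]] has_weak_gradient_\<tau>(1)[OF h]] ip_\<sigma>\<tau>[OF f(2) h(2)]
  by (simp add: L2_inner_def)

end

text \<open>The constant belongs to the trial space because min-max counts the eigenvalue 0
  first.\<close>

definition trial :: "(real \<Rightarrow> real) \<Rightarrow> real \<Rightarrow> real \<Rightarrow> real \<Rightarrow> real^2 \<Rightarrow> real" where
  "trial f c0 c1 c2 = c0 *\<^sub>R (\<lambda>_. 1) + c1 *\<^sub>R (\<lambda>x. f (\<sigma> x)) + c2 *\<^sub>R (\<lambda>x. f (\<tau> x))"

text \<open>Poincare's inequality: for \<open>N = 1\<close> the Rellich inequality removes only the
  frequency \<open>(0, 0)\<close>, the mean value. Positivity allows division by the eigenvalue in
  the discussion of equality.\<close>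

lemma positive_gap:
  assumes e: "eigensystem n u m" "1 < n"
  shows "0 < m 1"
proof -
  let ?c = "a \<bullet> a + b \<bullet> b"
  have "a \<noteq> 0" using dual by auto
  then have c: "?c > 0" by (simp add: add_pos_nonneg)
  have "pi\<^sup>2 / ?c \<le> m 1"
  proof (rule minmax_lower[OF e, of "\<lambda>_ _. 1"])
    fix v assume v: "v \<in> H1 P" "\<And>j::nat. j < 1 \<Longrightarrow> ip v (\<lambda>_. 1) = 0"
    have "{..<1} \<times> {..<1} = {(0::nat, 0::nat)}" by auto
    moreover have "E (0, 0) = (\<lambda>_. 1)" by (simp add: fun_eq_iff E_def e_def)
    ultimately have "ip v v \<le> ?c / pi\<^sup>2 * D v v"
      using Rellich_inequality[OF v(1), of 1] v(2)[of 0] by (simp add: weight_def)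
    then show "pi\<^sup>2 / ?c * ip v v \<le> D v v" using c by (simp add: field_simps)
  qed simp
  moreover have "0 < pi\<^sup>2 / ?c" using c by simp
  ultimately show ?thesis by linarith
qed

text \<open>Modulo constants, the Dirichlet form relative to the \<open>L2\<close> form on the trial
  space has the matrix with rows \<open>(p', q')\<close> and \<open>(q', r')\<close>. The diagonal
  contains the integral of the square of \<open>f'\<close>; off the diagonal the variables separate,
  which leaves the square of the integral of \<open>f'\<close>.\<close>

context
  fixes f f' :: "real \<Rightarrow> real" and N G Z p' q' r' :: real
  assumes f: "\<And>s. (f has_real_derivative f' s) (at s)" and f': "continuous_on UNIV f'"
    and ints: "integral {0..1} f = 0" "integral {0..1} (\<lambda>s. f s * f s) = N" "N > 0"
      "integral {0..1} (\<lambda>s. f' s * f' s) = G" "integral {0..1} f' = Z"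
  defines "p' \<equiv> G * (\<alpha> \<bullet> \<alpha>) / N" and "q' \<equiv> Z\<^sup>2 * (\<alpha> \<bullet> \<beta>) / N" and "r' \<equiv> G * (\<beta> \<bullet> \<beta>) / N"
begin

lemma cont_f: "continuous_on UNIV f"
  by (rule DERIV_continuous_on[OF f[THEN DERIV_subset]]) auto

lemma trial_H1: "trial f c0 c1 c2 \<in> H1 P" "(\<lambda>x. f (\<sigma> x)) \<in> H1 P" "(\<lambda>x. f (\<tau> x)) \<in> H1 P"
proof -
  show *: "(\<lambda>x. f (\<sigma> x)) \<in> H1 P" "(\<lambda>x. f (\<tau> x)) \<in> H1 P"
    using has_weak_gradient_\<sigma>(2)[OF f f'] has_weak_gradient_\<tau>(2)[OF f f'] .
  show "trial f c0 c1 c2 \<in> H1 P" unfolding trial_def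
    by (rule q.closed(2)[OF q.closed(2)[OF q.closed(3)[OF const_H1] q.closed(3)[OF *(1)]] q.closed(3)[OF *(2)]])
qed

lemma trial_basis_values:
  "ip (\<lambda>_. 1) (\<lambda>_. 1) = J" "ip (\<lambda>_. 1) (\<lambda>x. f (\<sigma> x)) = 0" "ip (\<lambda>_. 1) (\<lambda>x. f (\<tau> x)) = 0"
  "ip (\<lambda>x. f (\<sigma> x)) (\<lambda>x. f (\<sigma> x)) = J * N" "ip (\<lambda>x. f (\<tau> x)) (\<lambda>x. f (\<tau> x)) = J * N"
  "ip (\<lambda>x. f (\<sigma> x)) (\<lambda>x. f (\<tau> x)) = 0"
  "D (\<lambda>x. f (\<sigma> x)) (\<lambda>x. f (\<sigma> x)) = J * N * p'" "D (\<lambda>x. f (\<tau> x)) (\<lambda>x. f (\<tau> x)) = J * N * r'"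
  "D (\<lambda>x. f (\<sigma> x)) (\<lambda>x. f (\<tau> x)) = J * N * q'"
  using ints cont_f D_\<sigma>\<sigma>[OF f f' f f'] D_\<tau>\<tau>[OF f f' f f'] D_\<sigma>\<tau>[OF f f' f f']
  by (simp_all add: ip_const_const ip_const_\<sigma> ip_const_\<tau> ip_\<sigma>\<sigma> ip_\<tau>\<tau> ip_\<sigma>\<tau> p'_def q'_def r'_def power2_eq_square)

lemma trial_basis_values':
  "ip (\<lambda>x. f (\<sigma> x)) (\<lambda>_. 1) = 0" "ip (\<lambda>x. f (\<tau> x)) (\<lambda>_. 1) = 0"
  "ip (\<lambda>x. f (\<tau> x)) (\<lambda>x. f (\<sigma> x)) = 0" "D (\<lambda>x. f (\<sigma> x)) (\<lambda>_. 1) = 0"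
  "D (\<lambda>x. f (\<tau> x)) (\<lambda>_. 1) = 0" "D (\<lambda>x. f (\<tau> x)) (\<lambda>x. f (\<sigma> x)) = J * N * q'"
  using q.sym[of "\<lambda>x. f (\<sigma> x)" "\<lambda>_. 1"] q.sym[of "\<lambda>x. f (\<tau> x)" "\<lambda>_. 1"]
    q.sym[of "\<lambda>x. f (\<tau> x)" "\<lambda>x. f (\<sigma> x)"] d.sym[of "\<lambda>x. f (\<sigma> x)" "\<lambda>_. 1"]
    d.sym[of "\<lambda>x. f (\<tau> x)" "\<lambda>_. 1"] d.sym[of "\<lambda>x. f (\<tau> x)" "\<lambda>x. f (\<sigma> x)"]
  by (simp_all add: trial_H1 trial_basis_values D_const)

lemma ip_trial: "ip (trial f c0 c1 c2) (trial f c0 c1 c2) = J * (c0\<^sup>2 + N * (c1\<^sup>2 + c2\<^sup>2))"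
  unfolding trial_def
  by (simp add: q.add_left q.add_right q.scale_left q.scale_right trial_H1 trial_basis_values trial_basis_values')
    (simp add: power2_eq_square algebra_simps)

lemma D_trial: "D (trial f c0 c1 c2) (trial f c0 c1 c2) = J * N * (p' * c1\<^sup>2 + 2 * q' * (c1 * c2) + r' * c2\<^sup>2)"
  unfolding trial_def
  by (simp add: d.add_left d.add_right d.scale_left d.scale_right trial_H1 trial_basis_values trial_basis_values' D_const)
    (simp add: power2_eq_square algebra_simps)

text \<open>It is a Rayleigh quotient of the Dirichlet form. The sign matters below: adding a
  constant raises only the \<open>L2\<close> norm, which is harmless for a nonnegative
  bound.\<close>

lemma quadratic_min_nonneg: "0 \<le> quadratic_min p' q' r'"
proof -
  obtain x y where xy: "x \<noteq> 0 \<or> y \<noteq> 0"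
    "p' * x\<^sup>2 + 2 * q' * (x * y) + r' * y\<^sup>2 = quadratic_min p' q' r' * (x\<^sup>2 + y\<^sup>2)"
    using quadratic_form_min_attained by blast
  have "0 \<le> (J * N * (x\<^sup>2 + y\<^sup>2)) * quadratic_min p' q' r'"
    using D_trial[of 0 x y] d.nonneg[OF trial_H1(1), of 0 x y] xy(2) by (simp add: mult_ac)
  moreover have "x\<^sup>2 + y\<^sup>2 > 0" using xy(1) by (simp add: sum_power2_gt_zero_iff)
  then have "J * N * (x\<^sup>2 + y\<^sup>2) > 0" using J_pos ints(3) by simp
  ultimately show ?thesis by (metis mult_pos_neg not_less)
qed

text \<open>The trial plane is spanned by the constants and the combination of
  \<open>f \<circ> \<sigma>\<close> and \<open>f \<circ> \<tau>\<close> that minimizes the quadratic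
  form.\<close>

lemma second_eigenvalue_le:
  assumes e: "eigensystem n u m" "1 < n"
  shows "m 1 \<le> quadratic_min p' q' r'"
    "m 1 = quadratic_min p' q' r' \<Longrightarrow>
      \<exists>c0 c1 c2. (c0 \<noteq> 0 \<or> c1 \<noteq> 0 \<or> c2 \<noteq> 0) \<and> trial f c0 c1 c2 \<in> eig (m 1)"
proof -
  obtain x y where xy: "x \<noteq> 0 \<or> y \<noteq> 0"
    "p' * x\<^sup>2 + 2 * q' * (x * y) + r' * y\<^sup>2 = quadratic_min p' q' r' * (x\<^sup>2 + y\<^sup>2)"
    using quadratic_form_min_attained by blast
  define w where "w i = (if i = 0 then trial f 1 0 0 else trial f 0 x y)" for i :: nat
  have S: "(\<Sum>i<Suc 1. c i *\<^sub>R w i) = trial f (c 0) (c 1 * x) (c 1 * y)" for c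
    by (simp add: w_def trial_def fun_eq_iff algebra_simps)
  have pos: "x\<^sup>2 + y\<^sup>2 > 0" using xy(1) by (simp add: sum_power2_gt_zero_iff)
  have w: "w i \<in> H1 P" for i by (simp add: w_def trial_H1)
  have ind: "q_independent (Suc 1) w"
    unfolding q_independent_def S ip_trial
  proof (intro allI impI)
    fix c :: "nat \<Rightarrow> real" and i assume "J * ((c 0)\<^sup>2 + N * ((c 1 * x)\<^sup>2 + (c 1 * y)\<^sup>2)) = 0" "i < Suc 1"
    then have "(c 0)\<^sup>2 + N * ((c 1 * x)\<^sup>2 + (c 1 * y)\<^sup>2) = 0" using J_pos by simp
    then have "(c 0)\<^sup>2 + (c 1)\<^sup>2 * (N * (x\<^sup>2 + y\<^sup>2)) = 0"
      by (simp add: power_mult_distrib algebra_simps)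
    then have "(c 0)\<^sup>2 = 0 \<and> (c 1)\<^sup>2 * (N * (x\<^sup>2 + y\<^sup>2)) = 0"
      using pos ints(3) by (subst (asm) add_nonneg_eq_0_iff) auto
    then have "c 0 = 0" "c 1 = 0" using pos ints(3) by auto
    then show "c i = 0" using \<open>i < Suc 1\<close> by (cases i) auto
  qed
  have le: "D (\<Sum>i<Suc 1. c i *\<^sub>R w i) (\<Sum>i<Suc 1. c i *\<^sub>R w i) \<le>
      quadratic_min p' q' r' * ip (\<Sum>i<Suc 1. c i *\<^sub>R w i) (\<Sum>i<Suc 1. c i *\<^sub>R w i)" for c
  proof -
    have "p' * (c 1 * x)\<^sup>2 + 2 * q' * ((c 1 * x) * (c 1 * y)) + r' * (c 1 * y)\<^sup>2 =
        (c 1)\<^sup>2 * (p' * x\<^sup>2 + 2 * q' * (x * y) + r' * y\<^sup>2)" by (simp add: power2_eq_square algebra_simps)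
    also have "\<dots> = quadratic_min p' q' r' * ((c 1 * x)\<^sup>2 + (c 1 * y)\<^sup>2)"
      unfolding xy(2) by (simp add: power2_eq_square algebra_simps)
    finally have "D (\<Sum>i<Suc 1. c i *\<^sub>R w i) (\<Sum>i<Suc 1. c i *\<^sub>R w i) =
        quadratic_min p' q' r' * (J * (N * ((c 1 * x)\<^sup>2 + (c 1 * y)\<^sup>2)))"
      unfolding S D_trial by simp
    also have "\<dots> \<le> quadratic_min p' q' r' * (J * ((c 0)\<^sup>2 + N * ((c 1 * x)\<^sup>2 + (c 1 * y)\<^sup>2)))"
      using J_pos by (intro mult_left_mono quadratic_min_nonneg) auto
    finally show ?thesis unfolding S ip_trial .
  qed
  show "m 1 \<le> quadratic_min p' q' r'" by (rule minmax_upper(1)[OF e w ind le])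
  assume eq: "m 1 = quadratic_min p' q' r'"
  have "\<exists>c. (\<exists>i<Suc 1. c i \<noteq> 0) \<and> (\<Sum>i<Suc 1. c i *\<^sub>R w i) \<in> eig (quadratic_min p' q' r')"
    by (rule minmax_upper(2)[OF e w ind le eq])
  then obtain c where c: "\<exists>i<Suc 1. c i \<noteq> 0" "trial f (c 0) (c 1 * x) (c 1 * y) \<in> eig (m 1)"
    unfolding S eq by blast
  have "c 0 \<noteq> 0 \<or> c 1 * x \<noteq> 0 \<or> c 1 * y \<noteq> 0"
    using c(1) xy(1) by (auto simp: less_Suc_eq)
  then show "\<exists>c0 c1 c2. (c0 \<noteq> 0 \<or> c1 \<noteq> 0 \<or> c2 \<noteq> 0) \<and> trial f c0 c1 c2 \<in> eig (m 1)"
    using c(2) by blast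
qed

text \<open>Here the full three-dimensional trial space is used, on which the quotient is at most
  the larger eigenvalue of the matrix.\<close>

lemma third_eigenvalue_le:
  assumes e: "eigensystem n u m" "2 < n"
  shows "m 2 \<le> quadratic_max p' q' r'"
    "m 2 = quadratic_max p' q' r' \<Longrightarrow>
      \<exists>c0 c1 c2. (c0 \<noteq> 0 \<or> c1 \<noteq> 0 \<or> c2 \<noteq> 0) \<and> trial f c0 c1 c2 \<in> eig (m 2)"
proof -
  define w where "w i = (if i = 0 then trial f 1 0 0 else if i = 1 then trial f 0 1 0 else trial f 0 0 1)" for i :: nat
  have S: "(\<Sum>i<Suc 2. c i *\<^sub>R w i) = trial f (c 0) (c 1) (c 2)" for c
    by (simp add: w_def trial_def fun_eq_iff algebra_simps numeral_2_eq_2)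
  have w: "w i \<in> H1 P" for i by (simp add: w_def trial_H1)
  have ind: "q_independent (Suc 2) w"
    unfolding q_independent_def S ip_trial
  proof (intro allI impI)
    fix c :: "nat \<Rightarrow> real" and i assume "J * ((c 0)\<^sup>2 + N * ((c 1)\<^sup>2 + (c 2)\<^sup>2)) = 0" "i < Suc 2"
    then have "(c 0)\<^sup>2 + N * ((c 1)\<^sup>2 + (c 2)\<^sup>2) = 0" using J_pos by simp
    then have "(c 0)\<^sup>2 = 0 \<and> N * ((c 1)\<^sup>2 + (c 2)\<^sup>2) = 0"
      using ints(3) by (subst (asm) add_nonneg_eq_0_iff) auto
    then have "c 0 = 0" "c 1 = 0" "c 2 = 0" using ints(3) by (auto simp: sum_power2_eq_zero_iff)
    moreover have "i = 0 \<or> i = 1 \<or> i = 2" using \<open>i < Suc 2\<close> by auto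
    ultimately show "c i = 0" by auto
  qed
  have "0 \<le> quadratic_max p' q' r'"
  proof -
    have "quadratic_min p' q' r' \<le> quadratic_max p' q' r'"
      by (simp add: quadratic_min_def quadratic_max_def)
    then show ?thesis using quadratic_min_nonneg by simp
  qed
  then have le: "D (\<Sum>i<Suc 2. c i *\<^sub>R w i) (\<Sum>i<Suc 2. c i *\<^sub>R w i) \<le>
      quadratic_max p' q' r' * ip (\<Sum>i<Suc 2. c i *\<^sub>R w i) (\<Sum>i<Suc 2. c i *\<^sub>R w i)" for c
  proof -
    have "D (\<Sum>i<Suc 2. c i *\<^sub>R w i) (\<Sum>i<Suc 2. c i *\<^sub>R w i) \<le>
        J * N * (quadratic_max p' q' r' * ((c 1)\<^sup>2 + (c 2)\<^sup>2))"
      unfolding S D_trial using J_pos ints(3) by (intro mult_left_mono quadratic_form_le) auto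
    also have "\<dots> = quadratic_max p' q' r' * (J * (N * ((c 1)\<^sup>2 + (c 2)\<^sup>2)))" by simp
    also have "\<dots> \<le> quadratic_max p' q' r' * (J * ((c 0)\<^sup>2 + N * ((c 1)\<^sup>2 + (c 2)\<^sup>2)))"
      using J_pos \<open>0 \<le> quadratic_max p' q' r'\<close> by (intro mult_left_mono) auto
    finally show ?thesis unfolding S ip_trial .
  qed
  show "m 2 \<le> quadratic_max p' q' r'" by (rule minmax_upper(1)[OF e w ind le])
  assume eq: "m 2 = quadratic_max p' q' r'"
  have "\<exists>c. (\<exists>i<Suc 2. c i \<noteq> 0) \<and> (\<Sum>i<Suc 2. c i *\<^sub>R w i) \<in> eig (quadratic_max p' q' r')"
    by (rule minmax_upper(2)[OF e w ind le eq])
  then obtain c where c: "\<exists>i<Suc 2. c i \<noteq> 0" "trial f (c 0) (c 1) (c 2) \<in> eig (m 2)"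
    unfolding S eq by blast
  have "c 0 \<noteq> 0 \<or> c 1 \<noteq> 0 \<or> c 2 \<noteq> 0"
    using c(1) by (auto simp: less_Suc_eq numeral_2_eq_2)
  then show "\<exists>c0 c1 c2. (c0 \<noteq> 0 \<or> c1 \<noteq> 0 \<or> c2 \<noteq> 0) \<and> trial f c0 c1 c2 \<in> eig (m 2)"
    using c(2) by blast
qed

text \<open>The eigenvalue equation is tested against \<open>1\<close>, \<open>h \<circ> \<sigma>\<close> and \<open>h \<circ> \<tau>\<close>.\<close>

lemma trial_eigenfunction:
  assumes v: "trial f c0 c1 c2 \<in> eig t" and t: "t > 0"
    and h: "\<And>s. (h has_real_derivative h' s) (at s)" "continuous_on UNIV h'"
    and hints: "integral {0..1} h = 0" "integral {0..1} (\<lambda>s. f s * h s) = X"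
      "integral {0..1} (\<lambda>s. f' s * h' s) = 0" "integral {0..1} h' = Y"
  shows "c0 = 0" "c2 * (\<alpha> \<bullet> \<beta>) * Z * Y = t * c1 * X" "c1 * (\<alpha> \<bullet> \<beta>) * Z * Y = t * c2 * X"
proof -
  have ch: "continuous_on UNIV h" by (rule DERIV_continuous_on[OF h(1)[THEN DERIV_subset]]) auto
  have hH1: "(\<lambda>x. h (\<sigma> x)) \<in> H1 P" "(\<lambda>x. h (\<tau> x)) \<in> H1 P"
    using has_weak_gradient_\<sigma>(2)[OF h] has_weak_gradient_\<tau>(2)[OF h] .
  note [simp] = trial_H1 hH1
  have "D (\<lambda>_. 1) (trial f c0 c1 c2) = 0" by (simp add: D_const)
  then have "0 = t * ip (trial f c0 c1 c2) (\<lambda>_. 1)"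
    using eig_eq[OF v, of "\<lambda>_. 1"] d.sym[of "\<lambda>_. 1" "trial f c0 c1 c2"] by simp
  moreover have "ip (trial f c0 c1 c2) (\<lambda>_. 1) = J * c0"
    unfolding trial_def q.sym[OF trial_H1(1)[unfolded trial_def] const_H1]
    by (simp add: q.add_right q.scale_right trial_basis_values)
  ultimately show "c0 = 0" using t J_pos by simp
  have "ip (\<lambda>x. f (\<sigma> x)) (\<lambda>x. h (\<sigma> x)) = J * X" "ip (\<lambda>x. f (\<tau> x)) (\<lambda>x. h (\<tau> x)) = J * X"
    "ip (\<lambda>x. f (\<sigma> x)) (\<lambda>x. h (\<tau> x)) = 0" "ip (\<lambda>x. f (\<tau> x)) (\<lambda>x. h (\<sigma> x)) = 0"
    "ip (\<lambda>_. 1) (\<lambda>x. h (\<sigma> x)) = 0" "ip (\<lambda>_. 1) (\<lambda>x. h (\<tau> x)) = 0"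
    using hints cont_f ch ints(1) q.sym[of "\<lambda>x. f (\<tau> x)" "\<lambda>x. h (\<sigma> x)"]
    by (simp_all add: ip_const_\<sigma> ip_const_\<tau> ip_\<sigma>\<sigma> ip_\<tau>\<tau> ip_\<sigma>\<tau>)
  note ips = this
  have "D (\<lambda>x. f (\<sigma> x)) (\<lambda>x. h (\<sigma> x)) = 0" "D (\<lambda>x. f (\<tau> x)) (\<lambda>x. h (\<tau> x)) = 0"
    "D (\<lambda>x. f (\<sigma> x)) (\<lambda>x. h (\<tau> x)) = (\<alpha> \<bullet> \<beta>) * (J * (Z * Y))"
    "D (\<lambda>x. f (\<tau> x)) (\<lambda>x. h (\<sigma> x)) = (\<alpha> \<bullet> \<beta>) * (J * (Z * Y))"
    using hints ints(5) D_\<sigma>\<sigma>[OF f f' h] D_\<tau>\<tau>[OF f f' h] D_\<sigma>\<tau>[OF f f' h] D_\<sigma>\<tau>[OF h f f']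
      d.sym[of "\<lambda>x. f (\<tau> x)" "\<lambda>x. h (\<sigma> x)"] by simp_all
  note Ds = this
  have "D (trial f c0 c1 c2) (\<lambda>x. h (\<sigma> x)) = t * ip (trial f c0 c1 c2) (\<lambda>x. h (\<sigma> x))"
    "D (trial f c0 c1 c2) (\<lambda>x. h (\<tau> x)) = t * ip (trial f c0 c1 c2) (\<lambda>x. h (\<tau> x))"
    by (intro eig_eq[OF v] hH1)+
  then have "c2 * ((\<alpha> \<bullet> \<beta>) * (J * (Z * Y))) = t * (c1 * (J * X))"
    "c1 * ((\<alpha> \<bullet> \<beta>) * (J * (Z * Y))) = t * (c2 * (J * X))"
    unfolding trial_def
    by (simp_all add: q.add_left q.scale_left d.add_left d.scale_left ips Ds D_const)
  then have "J * (c2 * (\<alpha> \<bullet> \<beta>) * Z * Y) = J * (t * c1 * X)" "J * (c1 * (\<alpha> \<bullet> \<beta>) * Z * Y) = J * (t * c2 * X)"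
    by (simp_all add: mult_ac)
  then show "c2 * (\<alpha> \<bullet> \<beta>) * Z * Y = t * c1 * X" "c1 * (\<alpha> \<bullet> \<beta>) * Z * Y = t * c2 * X"
    using J_pos by simp_all
qed

end

end

subsection \<open>Bounds for the first eigenvalues\<close>

lemma has_integral_derivative_unit_interval:
  assumes "\<And>s. (F has_real_derivative f s) (at s)"
  shows "(f has_integral F 1 - F 0) {0..1}"
  using assms
  by (intro fundamental_theorem_of_calculus)
    (auto simp: has_real_derivative_iff_has_vector_derivative[symmetric] intro: DERIV_subset)

lemma cos_profile_integrals:
  "integral {0..1} (\<lambda>s. cos (pi * s)) = 0"
  "integral {0..1} (\<lambda>s. cos (pi * s) * cos (pi * s)) = 1 / 2"
  "integral {0..1} (\<lambda>s. (- pi * sin (pi * s)) * (- pi * sin (pi * s))) = pi\<^sup>2 / 2"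
  "integral {0..1} (\<lambda>s. - pi * sin (pi * s)) = - 2"
  "integral {0..1} (\<lambda>s. cos (3 * pi * s)) = 0"
  "integral {0..1} (\<lambda>s. cos (pi * s) * cos (3 * pi * s)) = 0"
  "integral {0..1} (\<lambda>s. (- pi * sin (pi * s)) * (- (3 * pi) * sin (3 * pi * s))) = 0"
  "integral {0..1} (\<lambda>s. - (3 * pi) * sin (3 * pi * s)) = - 2"
proof -
  show "integral {0..1} (\<lambda>s. cos (pi * s)) = 0"
    using integral_unique[OF has_integral_cos_cos[of 1 0]] by (simp add: cos_inner_def)
  show "integral {0..1} (\<lambda>s. cos (pi * s) * cos (pi * s)) = 1 / 2"
    using integral_unique[OF has_integral_cos_cos[of 1 1]] by (simp add: cos_inner_def)
  show "integral {0..1} (\<lambda>s. cos (3 * pi * s)) = 0"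
    using integral_unique[OF has_integral_cos_cos[of 3 0]] by (simp add: cos_inner_def)
  show "integral {0..1} (\<lambda>s. cos (pi * s) * cos (3 * pi * s)) = 0"
    using integral_unique[OF has_integral_cos_cos[of 1 3]] by (simp add: cos_inner_def)
  have "((\<lambda>s. pi\<^sup>2 * (sin (real 1 * pi * s) * sin (real 1 * pi * s))) has_integral pi\<^sup>2 * cos_inner 1 1) {0..1}"
    by (intro has_integral_mult_right has_integral_sin_sin) auto
  from integral_unique[OF this]
  show "integral {0..1} (\<lambda>s. (- pi * sin (pi * s)) * (- pi * sin (pi * s))) = pi\<^sup>2 / 2"
    by (simp add: cos_inner_def power2_eq_square mult_ac)
  have "((\<lambda>s. (3 * pi\<^sup>2) * (sin (real 1 * pi * s) * sin (real 3 * pi * s))) has_integral (3 * pi\<^sup>2) * cos_inner 1 3) {0..1}"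
    by (intro has_integral_mult_right has_integral_sin_sin) auto
  from integral_unique[OF this]
  show "integral {0..1} (\<lambda>s. (- pi * sin (pi * s)) * (- (3 * pi) * sin (3 * pi * s))) = 0"
    by (simp add: cos_inner_def power2_eq_square mult_ac)
  have "((\<lambda>s. - pi * sin (pi * s)) has_integral cos (pi * 1) - cos (pi * 0)) {0..1}"
    by (rule has_integral_derivative_unit_interval) (auto intro!: derivative_eq_intros)
  from integral_unique[OF this] show "integral {0..1} (\<lambda>s. - pi * sin (pi * s)) = - 2" by simp
  have "((\<lambda>s. - (3 * pi) * sin (3 * pi * s)) has_integral cos (3 * pi * 1) - cos (3 * pi * 0)) {0..1}"
    by (rule has_integral_derivative_unit_interval) (auto intro!: derivative_eq_intros)
  then have "integral {0..1} (\<lambda>s. - (3 * pi) * sin (3 * pi * s)) = cos (3 * pi * 1) - cos (3 * pi * 0)"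
    by (rule integral_unique)
  also have "\<dots> = - 2" using cos_npi[of 3] by simp
  finally show "integral {0..1} (\<lambda>s. - (3 * pi) * sin (3 * pi * s)) = - 2" .
qed

lemma linear_profile_integrals:
  "integral {0..1} (\<lambda>s::real. s - 1 / 2) = 0"
  "integral {0..1} (\<lambda>s::real. (s - 1 / 2) * (s - 1 / 2)) = 1 / 12"
  "integral {0..1} (\<lambda>s. sin (2 * pi * s)) = 0"
  "integral {0..1} (\<lambda>s. (s - 1 / 2) * sin (2 * pi * s)) = - 1 / (2 * pi)"
  "integral {0..1} (\<lambda>s. 2 * pi * cos (2 * pi * s)) = 0"
proof -
  have "((\<lambda>s::real. s - 1 / 2) has_integral (1\<^sup>2 / 2 - 1 / 2) - (0\<^sup>2 / 2 - 0 / 2)) {0..1}"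
    by (rule has_integral_derivative_unit_interval) (auto intro!: derivative_eq_intros)
  then show "integral {0..1} (\<lambda>s::real. s - 1 / 2) = 0" by (simp add: integral_unique)
  have "((\<lambda>s::real. (s - 1 / 2) * (s - 1 / 2)) has_integral ((1 - 1 / 2) ^ 3 / 3) - ((0 - 1 / 2) ^ 3 / 3)) {0..1}"
    by (rule has_integral_derivative_unit_interval) (auto intro!: derivative_eq_intros simp: power2_eq_square)
  then show "integral {0..1} (\<lambda>s::real. (s - 1 / 2) * (s - 1 / 2)) = 1 / 12"
    by (simp add: integral_unique power3_eq_cube)
  have "((\<lambda>s. sin (2 * pi * s)) has_integral (- cos (2 * pi * 1) / (2 * pi)) - (- cos (2 * pi * 0) / (2 * pi))) {0..1}"
    by (rule has_integral_derivative_unit_interval) (auto intro!: derivative_eq_intros)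
  then show "integral {0..1} (\<lambda>s. sin (2 * pi * s)) = 0" by (simp add: integral_unique)
  have "((\<lambda>s. (s - 1 / 2) * sin (2 * pi * s)) has_integral
      (sin (2 * pi * 1) / (2 * pi)\<^sup>2 - (1 - 1 / 2) * cos (2 * pi * 1) / (2 * pi)) -
      (sin (2 * pi * 0) / (2 * pi)\<^sup>2 - (0 - 1 / 2) * cos (2 * pi * 0) / (2 * pi))) {0..1}"
    by (rule has_integral_derivative_unit_interval)
      (auto intro!: derivative_eq_intros simp: power2_eq_square field_simps)
  then have "integral {0..1} (\<lambda>s. (s - 1 / 2) * sin (2 * pi * s)) =
      (sin (2 * pi * 1) / (2 * pi)\<^sup>2 - (1 - 1 / 2) * cos (2 * pi * 1) / (2 * pi)) -
      (sin (2 * pi * 0) / (2 * pi)\<^sup>2 - (0 - 1 / 2) * cos (2 * pi * 0) / (2 * pi))"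
    by (rule integral_unique)
  also have "\<dots> = - 1 / (2 * pi)" by simp
  finally show "integral {0..1} (\<lambda>s. (s - 1 / 2) * sin (2 * pi * s)) = - 1 / (2 * pi)" .
  have "((\<lambda>s. 2 * pi * cos (2 * pi * s)) has_integral sin (2 * pi * 1) - sin (2 * pi * 0)) {0..1}"
    by (rule has_integral_derivative_unit_interval) (auto intro!: derivative_eq_intros)
  then have "integral {0..1} (\<lambda>s. 2 * pi * cos (2 * pi * s)) = sin (2 * pi * 1) - sin (2 * pi * 0)"
    by (rule integral_unique)
  also have "\<dots> = 0" by simp
  finally show "integral {0..1} (\<lambda>s. 2 * pi * cos (2 * pi * s)) = 0" .
qed

lemma quadratic_mult:
  assumes "0 \<le> c"
  shows "quadratic_min (c * p) (c * q) (c * r) = c * quadratic_min p q r"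
    "quadratic_max (c * p) (c * q) (c * r) = c * quadratic_max p q r"
proof -
  have "(c * p - c * r)\<^sup>2 + 4 * (c * q)\<^sup>2 = c\<^sup>2 * ((p - r)\<^sup>2 + 4 * q\<^sup>2)"
    by (simp add: power2_eq_square algebra_simps)
  then have "sqrt ((c * p - c * r)\<^sup>2 + 4 * (c * q)\<^sup>2) = c * sqrt ((p - r)\<^sup>2 + 4 * q\<^sup>2)"
    using assms by (simp add: real_sqrt_mult)
  then show "quadratic_min (c * p) (c * q) (c * r) = c * quadratic_min p q r"
    "quadratic_max (c * p) (c * q) (c * r) = c * quadratic_max p q r"
    by (simp_all add: quadratic_min_def quadratic_max_def algebra_simps)
qed

context parallelogram
begin

lemma J_square: "J\<^sup>2 = (a$1 * b$2 - a$2 * b$1)\<^sup>2" "J\<^sup>2 = (a \<bullet> a) * (b \<bullet> b) - (a \<bullet> b)\<^sup>2"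
  by (simp_all add: J_def inner_vec_def sum_2 power2_eq_square algebra_simps)

text \<open>Up to the signed area, \<open>\<alpha>\<close> and \<open>\<beta>\<close> are
  \<open>b\<close> and \<open>a\<close> turned by right angles in opposite directions; hence the
  exchange of the lengths and the sign of the mixed product.\<close>

lemma dual_inner:
  "\<alpha> \<bullet> \<alpha> = (b \<bullet> b) / J\<^sup>2" "\<alpha> \<bullet> \<beta> = - (a \<bullet> b) / J\<^sup>2" "\<beta> \<bullet> \<beta> = (a \<bullet> a) / J\<^sup>2"
proof -
  define \<delta> where "\<delta> = a$1 * b$2 - a$2 * b$1"
  have d: "\<alpha>$1 * \<delta> = b$2" "\<alpha>$2 * \<delta> = - b$1" "\<beta>$1 * \<delta> = - a$2" "\<beta>$2 * \<delta> = a$1"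
    unfolding \<delta>_def using dual_coords by algebra+
  have "(\<alpha> \<bullet> \<alpha>) * \<delta>\<^sup>2 = (\<alpha>$1 * \<delta>)\<^sup>2 + (\<alpha>$2 * \<delta>)\<^sup>2"
    "(\<alpha> \<bullet> \<beta>) * \<delta>\<^sup>2 = (\<alpha>$1 * \<delta>) * (\<beta>$1 * \<delta>) + (\<alpha>$2 * \<delta>) * (\<beta>$2 * \<delta>)"
    "(\<beta> \<bullet> \<beta>) * \<delta>\<^sup>2 = (\<beta>$1 * \<delta>)\<^sup>2 + (\<beta>$2 * \<delta>)\<^sup>2"
    by (simp_all add: inner_vec_def sum_2 power2_eq_square algebra_simps)
  then have "(\<alpha> \<bullet> \<alpha>) * J\<^sup>2 = b \<bullet> b" "(\<alpha> \<bullet> \<beta>) * J\<^sup>2 = - (a \<bullet> b)" "(\<beta> \<bullet> \<beta>) * J\<^sup>2 = a \<bullet> a"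
    unfolding d J_square(1) \<delta>_def[symmetric]
    by (simp_all add: inner_vec_def sum_2 power2_eq_square algebra_simps)
  then show "\<alpha> \<bullet> \<alpha> = (b \<bullet> b) / J\<^sup>2" "\<alpha> \<bullet> \<beta> = - (a \<bullet> b) / J\<^sup>2" "\<beta> \<bullet> \<beta> = (a \<bullet> a) / J\<^sup>2"
    using J_pos by (simp_all add: field_simps)
qed

lemma dual_inner_0_iff: "\<alpha> \<bullet> \<beta> = 0 \<longleftrightarrow> a \<bullet> b = 0"
  using J_pos by (simp add: dual_inner)

lemma E_0_k: "E (0, k) = (\<lambda>x. cos (real k * pi * \<tau> x))"
  by (simp add: fun_eq_iff E_def e_def)

lemma E_j_0: "E (j, 0) = (\<lambda>x. cos (real j * pi * \<sigma> x))"
  by (simp add: fun_eq_iff E_def e_def)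

lemma cos_derivative:
  "((\<lambda>s. cos (w * s)) has_real_derivative - w * sin (w * s)) (at s)" "continuous_on UNIV (\<lambda>s::real. - w * sin (w * s))"
  by (auto intro!: derivative_eq_intros continuous_intros)

lemma E_H1: "E (0, k) \<in> H1 P" "E (j, 0) \<in> H1 P"
  using has_weak_gradient_\<tau>(2)[OF cos_derivative, of "real k * pi"]
    has_weak_gradient_\<sigma>(2)[OF cos_derivative, of "real j * pi"]
  by (simp_all add: E_0_k E_j_0)

lemma eigensystem3: "\<exists>u m. eigensystem 3 u m"
  by (rule eigensystem_exists[of "\<lambda>j. E (j, 0)"]) (auto simp: E_H1 ip_E_pos ip_E_orthogonal)

context
  fixes u m assumes es: "eigensystem 3 u m"
begin

text \<open>The indices of \<open>m\<close> start at 0, the numbering of the \<mu> at 1.\<close>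

lemma mu_2: "neumann_mu P 2 = m 1" and mu_3: "neumann_mu P 3 = m 2"
  using neumann_mu_eigensystem[OF es, of 1] neumann_mu_eigensystem[OF es, of 2]
  by (simp_all add: numeral_2_eq_2 numeral_3_eq_3)

lemma m_pos: "0 < m 1" "0 < m 2"
  using positive_gap[OF es] eigensystem_mono[OF es, of 1 2] by auto

text \<open>\<open>cos (3 pi s)\<close> is orthogonal to \<open>cos (pi s)\<close>, and so are the
  derivatives, but the integral of its own derivative is \<open>- 2\<close>. The tested equations
  therefore say that \<open>\<alpha> \<bullet> \<beta>\<close> times \<open>c1\<close> and times
  \<open>c2\<close> is zero, while \<open>c0 = 0\<close>.\<close>

lemma cos_trial_eigenfunction:
  assumes v: "trial (\<lambda>s. cos (pi * s)) c0 c1 c2 \<in> eig t" "t > 0" and c: "c0 \<noteq> 0 \<or> c1 \<noteq> 0 \<or> c2 \<noteq> 0"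
  shows "a \<bullet> b = 0"
proof -
  have N: "(0::real) < 1 / 2" by simp
  note T = trial_eigenfunction[OF cos_derivative[of pi] cos_profile_integrals(1,2) N
      cos_profile_integrals(3,4) v cos_derivative[of "3 * pi"] cos_profile_integrals(5-8)]
  show ?thesis using T c by (auto simp: dual_inner_0_iff)
qed

text \<open>The roles are reversed: the derivative of \<open>sin (2 pi s)\<close> has integral zero,
  while its product with the profile integrates to \<open>- 1 / (2 pi)\<close>. The tested equations
  then annihilate \<open>c1\<close> and \<open>c2\<close> for every shape of the
  parallelogram.\<close>

lemma linear_trial_not_eigenfunction:
  assumes v: "trial (\<lambda>s. s - 1 / 2) c0 c1 c2 \<in> eig t" "t > 0" and c: "c0 \<noteq> 0 \<or> c1 \<noteq> 0 \<or> c2 \<noteq> 0"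
  shows False
proof -
  have f: "((\<lambda>s::real. s - 1 / 2) has_real_derivative 1) (at s)" for s
    by (auto intro!: derivative_eq_intros)
  have h: "((\<lambda>s. sin (2 * pi * s)) has_real_derivative 2 * pi * cos (2 * pi * s)) (at s)" for s
    by (auto intro!: derivative_eq_intros)
  have c1: "continuous_on UNIV (\<lambda>_. 1 :: real)" "continuous_on UNIV (\<lambda>s. 2 * pi * cos (2 * pi * s))"
    by (auto intro!: continuous_intros)
  have i: "integral {0..1} (\<lambda>s::real. 1 * 1 :: real) = 1" "integral {0..1} (\<lambda>s::real. 1 :: real) = 1"
    "integral {0..1} (\<lambda>s. 1 * (2 * pi * cos (2 * pi * s))) = 0"
    using linear_profile_integrals(5) by auto
  have N: "(0::real) < 1 / 12" by simp
  note T = trial_eigenfunction[OF f c1(1) linear_profile_integrals(1,2) N i(1,2) v h c1(2)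
      linear_profile_integrals(3,4) i(3) linear_profile_integrals(5)]
  show False using T c v(2) by auto
qed

text \<open>The entries stay unevaluated so that they agree literally with instances of
  \<open>p'\<close>, \<open>q'\<close>, \<open>r'\<close>: for the cosine
  \<open>G = pi^2 / 2\<close>, \<open>Z = - 2\<close>, \<open>N = 1 / 2\<close>; for the linear
  profile \<open>G = Z = 1\<close>, \<open>N = 1 / 12\<close>.\<close>

abbreviation (input) cos_min where
  "cos_min \<equiv> quadratic_min (pi\<^sup>2 / 2 * (\<alpha> \<bullet> \<alpha>) / (1 / 2)) ((- 2)\<^sup>2 * (\<alpha> \<bullet> \<beta>) / (1 / 2)) (pi\<^sup>2 / 2 * (\<beta> \<bullet> \<beta>) / (1 / 2))"

abbreviation (input) cos_max where
  "cos_max \<equiv> quadratic_max (pi\<^sup>2 / 2 * (\<alpha> \<bullet> \<alpha>) / (1 / 2)) ((- 2)\<^sup>2 * (\<alpha> \<bullet> \<beta>) / (1 / 2)) (pi\<^sup>2 / 2 * (\<beta> \<bullet> \<beta>) / (1 / 2))"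

abbreviation (input) linear_min where
  "linear_min \<equiv> quadratic_min (1 * (\<alpha> \<bullet> \<alpha>) / (1 / 12)) (1\<^sup>2 * (\<alpha> \<bullet> \<beta>) / (1 / 12)) (1 * (\<beta> \<bullet> \<beta>) / (1 / 12))"

lemma m1_le_cos: "m 1 \<le> cos_min" "m 1 = cos_min \<Longrightarrow> a \<bullet> b = 0"
proof -
  note T = second_eigenvalue_le[OF cos_derivative[of pi] cos_profile_integrals(1,2) _ cos_profile_integrals(3,4) es]
  show "m 1 \<le> cos_min" by (rule T(1)) auto
  assume eq: "m 1 = cos_min"
  have "\<exists>c0 c1 c2. (c0 \<noteq> 0 \<or> c1 \<noteq> 0 \<or> c2 \<noteq> 0) \<and> trial (\<lambda>s. cos (pi * s)) c0 c1 c2 \<in> eig (m 1)"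
    by (rule T(2)[OF _ _ eq]) auto
  then show "a \<bullet> b = 0" using cos_trial_eigenfunction m_pos by blast
qed

text \<open>Strict, since linear trial functions are never eigenfunctions; only the cosine bound can
  account for equality in (i).\<close>

lemma m1_less_linear: "m 1 < linear_min"
proof -
  have f: "((\<lambda>s::real. s - 1 / 2) has_real_derivative 1) (at s)" for s
    by (auto intro!: derivative_eq_intros)
  have i: "integral {0..1} (\<lambda>s::real. 1 * 1 :: real) = 1" "integral {0..1} (\<lambda>s::real. 1 :: real) = 1" by auto
  note T = second_eigenvalue_le[OF f continuous_on_const linear_profile_integrals(1,2) _ i es]
  have "m 1 \<le> linear_min" by (rule T(1)) auto
  moreover have "m 1 \<noteq> linear_min"
  proof
    assume eq: "m 1 = linear_min"
    have "\<exists>c0 c1 c2. (c0 \<noteq> 0 \<or> c1 \<noteq> 0 \<or> c2 \<noteq> 0) \<and> trial (\<lambda>s. s - 1 / 2) c0 c1 c2 \<in> eig (m 1)"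
      by (rule T(2)[OF _ _ eq]) auto
    then show False using linear_trial_not_eigenfunction m_pos by blast
  qed
  ultimately show ?thesis by simp
qed

lemma m2_le_cos: "m 2 \<le> cos_max" "m 2 = cos_max \<Longrightarrow> a \<bullet> b = 0"
proof -
  note T = third_eigenvalue_le[OF cos_derivative[of pi] cos_profile_integrals(1,2) _ cos_profile_integrals(3,4) es]
  show "m 2 \<le> cos_max" by (rule T(1)) auto
  assume eq: "m 2 = cos_max"
  have "\<exists>c0 c1 c2. (c0 \<noteq> 0 \<or> c1 \<noteq> 0 \<or> c2 \<noteq> 0) \<and> trial (\<lambda>s. cos (pi * s)) c0 c1 c2 \<in> eig (m 2)"
    by (rule T(2)[OF _ _ eq]) auto
  then show "a \<bullet> b = 0" using cos_trial_eigenfunction m_pos by blast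
qed

text \<open>Removing the constant leaves the frequencies with some index at least 1, and the lowest
  of these belongs to the longer side \<open>b\<close>.\<close>

lemma rectangle_m1_ge:
  assumes ab: "a \<bullet> b = 0" and le: "a \<bullet> a \<le> b \<bullet> b"
  shows "pi\<^sup>2 / (b \<bullet> b) \<le> m 1"
proof (rule minmax_lower[OF es, of 1 "\<lambda>_. E (0, 0)"])
  have pos: "a \<bullet> a > 0" "b \<bullet> b > 0" using dual by auto
  fix v assume v: "v \<in> H1 P" "\<And>j::nat. j < 1 \<Longrightarrow> ip v (E (0, 0)) = 0"
  show "pi\<^sup>2 / (b \<bullet> b) * ip v v \<le> D v v"
  proof (rule rectangle_spectral_bound[OF ab v(1), of "{(0, 0)}"])
    fix i :: "nat \<times> nat" assume "i \<notin> {(0, 0)}"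
    then consider "1 \<le> fst i" | "1 \<le> snd i" by (cases i) fastforce
    then show "pi\<^sup>2 / (b \<bullet> b) \<le> (real (fst i) * pi)\<^sup>2 / (a \<bullet> a) + (real (snd i) * pi)\<^sup>2 / (b \<bullet> b)"
    proof cases
      case 1
      then have "(1 * pi)\<^sup>2 \<le> (real (fst i) * pi)\<^sup>2" by (intro power_mono mult_right_mono) auto
      then have "pi\<^sup>2 / (b \<bullet> b) \<le> (real (fst i) * pi)\<^sup>2 / (a \<bullet> a)" using pos le by (intro frac_le) auto
      moreover have "0 \<le> (real (snd i) * pi)\<^sup>2 / (b \<bullet> b)" by simp
      ultimately show ?thesis by linarith
    next
      case 2
      then have "(1 * pi)\<^sup>2 \<le> (real (snd i) * pi)\<^sup>2" by (intro power_mono mult_right_mono) auto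
      then have "pi\<^sup>2 / (b \<bullet> b) \<le> (real (snd i) * pi)\<^sup>2 / (b \<bullet> b)" using pos by (intro divide_right_mono) auto
      moreover have "0 \<le> (real (fst i) * pi)\<^sup>2 / (a \<bullet> a)" by simp
      ultimately show ?thesis by linarith
    qed
  qed (use v pos in auto)
qed (auto simp: E_H1)

text \<open>Once \<open>(0, 0)\<close> and \<open>(0, 1)\<close> are removed, the lowest candidates
  are \<open>(1, 0)\<close> and \<open>(0, 2)\<close>; they produce the two terms of the
  minimum.\<close>

lemma rectangle_m2_ge:
  assumes ab: "a \<bullet> b = 0"
  shows "min (pi\<^sup>2 / (a \<bullet> a)) (4 * pi\<^sup>2 / (b \<bullet> b)) \<le> m 2"
proof (rule minmax_lower[OF es, of 2 "\<lambda>k. E (0, k)"])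
  have pos: "a \<bullet> a > 0" "b \<bullet> b > 0" using dual by auto
  let ?t = "min (pi\<^sup>2 / (a \<bullet> a)) (4 * pi\<^sup>2 / (b \<bullet> b))"
  fix v assume v: "v \<in> H1 P" "\<And>j. j < 2 \<Longrightarrow> ip v (E (0, j)) = 0"
  show "?t * ip v v \<le> D v v"
  proof (rule rectangle_spectral_bound[OF ab v(1), of "{(0, 0), (0, 1)}"])
    fix i :: "nat \<times> nat" assume "i \<notin> {(0, 0), (0, 1)}"
    then consider "1 \<le> fst i" | "2 \<le> snd i"
      by (cases i) (auto simp: not_le less_Suc_eq numeral_2_eq_2)
    then show "?t \<le> (real (fst i) * pi)\<^sup>2 / (a \<bullet> a) + (real (snd i) * pi)\<^sup>2 / (b \<bullet> b)"
    proof cases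
      case 1
      then have "(1 * pi)\<^sup>2 \<le> (real (fst i) * pi)\<^sup>2" by (intro power_mono mult_right_mono) auto
      then have "pi\<^sup>2 / (a \<bullet> a) \<le> (real (fst i) * pi)\<^sup>2 / (a \<bullet> a)" using pos by (intro divide_right_mono) auto
      moreover have "0 \<le> (real (snd i) * pi)\<^sup>2 / (b \<bullet> b)" by simp
      ultimately show ?thesis by linarith
    next
      case 2
      then have "(2 * pi)\<^sup>2 \<le> (real (snd i) * pi)\<^sup>2" by (intro power_mono mult_right_mono) auto
      then have "4 * pi\<^sup>2 / (b \<bullet> b) \<le> (real (snd i) * pi)\<^sup>2 / (b \<bullet> b)"
        using pos by (intro divide_right_mono) (auto simp: power_mult_distrib)
      moreover have "0 \<le> (real (fst i) * pi)\<^sup>2 / (a \<bullet> a)" by simp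
      ultimately show ?thesis by linarith
    qed
  qed (use v pos in auto)
qed (auto simp: E_H1)

text \<open>The trial functions are \<open>1\<close>, \<open>cos (pi \<tau>)\<close> and
  \<open>cos (2 pi \<tau>)\<close>. For a rectangle the bound is \<open>4 pi^2 / l2^2\<close>, which
  lies below \<open>lambda_plus\<close> exactly when \<open>l2 > 2 * l1\<close> and then excludes
  equality in (ii).\<close>

lemma m2_le_long_side: "m 2 \<le> 4 * pi\<^sup>2 * (\<beta> \<bullet> \<beta>)"
proof (rule minmax_upper(1)[OF es, of 2 "\<lambda>k. E (0, k)"])
  show "q_independent (Suc 2) (\<lambda>k. E (0, k))"
    by (intro orthogonal_family_independent) (auto simp: E_H1 ip_E_pos ip_E_orthogonal)
  have DE: "D (E (0, j)) (E (0, k)) = (\<beta> \<bullet> \<beta>) * ((real j * pi) * (real k * pi)) * ip (E (0, j)) (E (0, k))" for j k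
  proof (cases "j > 0 \<and> k > 0")
    case True
    have "((\<lambda>s. (real j * pi) * (real k * pi) * (sin (real j * pi * s) * sin (real k * pi * s)))
        has_integral (real j * pi) * (real k * pi) * cos_inner j k) {0..1}"
      using True by (intro has_integral_mult_right has_integral_sin_sin) auto
    from integral_unique[OF this]
    have "integral {0..1} (\<lambda>s. (- (real j * pi) * sin (real j * pi * s)) * (- (real k * pi) * sin (real k * pi * s))) =
        (real j * pi) * (real k * pi) * cos_inner j k"
      by (simp only: mult_minus_left mult_minus_right minus_minus mult_ac)
    then show ?thesis
      unfolding E_0_k D_\<tau>\<tau>[OF cos_derivative cos_derivative]
      unfolding E_0_k[symmetric] by (simp add: E_def ip_e cos_inner_def)
  next
    case False
    have c: "E (0, 0) = (\<lambda>_. 1)" by (simp add: E_0_k)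
    show ?thesis
      using False D_const[OF E_H1(1)[of k]] D_const[OF E_H1(1)[of j]] d.sym[OF E_H1(1)[of j] const_H1[of 1]]
      by (auto simp: c)
  qed
  fix c :: "nat \<Rightarrow> real"
  have "D (\<Sum>k<Suc 2. c k *\<^sub>R E (0, k)) (\<Sum>k<Suc 2. c k *\<^sub>R E (0, k)) =
      (\<Sum>k<Suc 2. (c k)\<^sup>2 * D (E (0, k)) (E (0, k)))"
    by (intro d.square_orthogonal_sum) (auto simp: E_H1 DE ip_E_orthogonal)
  also have "\<dots> \<le> (\<Sum>k<Suc 2. (c k)\<^sup>2 * (4 * pi\<^sup>2 * (\<beta> \<bullet> \<beta>) * ip (E (0, k)) (E (0, k))))"
  proof (intro sum_mono mult_left_mono)
    fix k :: nat assume "k \<in> {..<Suc 2}"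
    then have "(real k * pi)\<^sup>2 \<le> (2 * pi)\<^sup>2" by (intro power_mono mult_right_mono) auto
    then have "(\<beta> \<bullet> \<beta>) * (real k * pi)\<^sup>2 \<le> (\<beta> \<bullet> \<beta>) * (4 * pi\<^sup>2)"
      by (intro mult_left_mono) (auto simp: power_mult_distrib)
    then have "(\<beta> \<bullet> \<beta>) * (real k * pi)\<^sup>2 * ip (E (0, k)) (E (0, k)) \<le> (\<beta> \<bullet> \<beta>) * (4 * pi\<^sup>2) * ip (E (0, k)) (E (0, k))"
      using ip_E_pos[of "(0, k)"] by (intro mult_right_mono) auto
    then show "D (E (0, k)) (E (0, k)) \<le> 4 * pi\<^sup>2 * (\<beta> \<bullet> \<beta>) * ip (E (0, k)) (E (0, k))"
      unfolding DE power2_eq_square by (simp only: mult_ac)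
  qed auto
  also have "\<dots> = 4 * pi\<^sup>2 * (\<beta> \<bullet> \<beta>) * (\<Sum>k<Suc 2. (c k)\<^sup>2 * ip (E (0, k)) (E (0, k)))"
    unfolding sum_distrib_left by (simp only: mult_ac)
  also have "(\<Sum>k<Suc 2. (c k)\<^sup>2 * ip (E (0, k)) (E (0, k))) =
      ip (\<Sum>k<Suc 2. c k *\<^sub>R E (0, k)) (\<Sum>k<Suc 2. c k *\<^sub>R E (0, k))"
    by (intro q.square_orthogonal_sum[symmetric]) (auto simp: E_H1 ip_E_orthogonal)
  finally show "D (\<Sum>k<Suc 2. c k *\<^sub>R E (0, k)) (\<Sum>k<Suc 2. c k *\<^sub>R E (0, k)) \<le> 4 * pi\<^sup>2 * (\<beta> \<bullet> \<beta>) *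
      ip (\<Sum>k<Suc 2. c k *\<^sub>R E (0, k)) (\<Sum>k<Suc 2. c k *\<^sub>R E (0, k))" .
qed (auto simp: E_H1)

end

text \<open>The difference set forgets the base point and is centrally symmetric, so two
  descriptions of one parallelogram can be compared through their dual vectors alone.\<close>

lemma differences_P: "{x - y | x y. x \<in> P \<and> y \<in> P} = {z. \<bar>\<alpha> \<bullet> z\<bar> < 1 \<and> \<bar>\<beta> \<bullet> z\<bar> < 1}"
proof (intro set_eqI iffI; clarify)
  fix x y assume "x \<in> P" "y \<in> P"
  moreover have "\<alpha> \<bullet> (x - y) = \<sigma> x - \<sigma> y" "\<beta> \<bullet> (x - y) = \<tau> x - \<tau> y"
    by (auto simp: \<sigma>_def \<tau>_def inner_diff_right)
  ultimately show "\<bar>\<alpha> \<bullet> (x - y)\<bar> < 1 \<and> \<bar>\<beta> \<bullet> (x - y)\<bar> < 1" by (auto simp: P_def)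
next
  fix z assume z: "\<bar>\<alpha> \<bullet> z\<bar> < 1" "\<bar>\<beta> \<bullet> z\<bar> < 1"
  \<comment> \<open>Two points placed symmetrically about the centre, each displaced by half the
    coordinates of \<open>z\<close>.\<close>
  let ?x = "\<lambda>r. p + ((1 + r * (\<alpha> \<bullet> z)) / 2) *\<^sub>R a + ((1 + r * (\<beta> \<bullet> z)) / 2) *\<^sub>R b"
  have "?x 1 \<in> P" "?x (-1) \<in> P" using z by (auto simp: P_def \<sigma>_affine \<tau>_affine)
  moreover have "z = ?x 1 - ?x (-1)"
  proof -
    have "?x 1 - ?x (-1) = (((1 + 1 * (\<alpha> \<bullet> z)) / 2) - ((1 + (-1) * (\<alpha> \<bullet> z)) / 2)) *\<^sub>R a +
        (((1 + 1 * (\<beta> \<bullet> z)) / 2) - ((1 + (-1) * (\<beta> \<bullet> z)) / 2)) *\<^sub>R b"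
      by (simp only: scaleR_left_diff_distrib) simp
    also have "\<dots> = (\<alpha> \<bullet> z) *\<^sub>R a + (\<beta> \<bullet> z) *\<^sub>R b" by (simp add: field_simps)
    finally show ?thesis by (simp add: expansion)
  qed
  ultimately show "\<exists>x y. z = x - y \<and> x \<in> P \<and> y \<in> P" by blast
qed

end

text \<open>Radial scaling passes from strict to weak inequalities, that is, from the open
  difference body to its closure, which has vertices.\<close>

lemma abs_le_1_iff_scaled: "\<bar>c\<bar> \<le> 1 \<longleftrightarrow> (\<forall>r. 0 \<le> r \<and> r < 1 \<longrightarrow> \<bar>r * c\<bar> < 1)" for c :: real
proof (intro iffI allI impI)
  fix r :: real assume c: "\<bar>c\<bar> \<le> 1" and r: "0 \<le> r \<and> r < 1"
  have "\<bar>r * c\<bar> \<le> r * 1" unfolding abs_mult using r c by (intro mult_mono) auto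
  then show "\<bar>r * c\<bar> < 1" using r by simp
next
  assume h: "\<forall>r. 0 \<le> r \<and> r < 1 \<longrightarrow> \<bar>r * c\<bar> < 1"
  show "\<bar>c\<bar> \<le> 1"
  proof (rule ccontr)
    assume "\<not> \<bar>c\<bar> \<le> 1"
    then have "0 \<le> 1 / \<bar>c\<bar> \<and> 1 / \<bar>c\<bar> < 1" by auto
    then have "\<bar>1 / \<bar>c\<bar> * c\<bar> < 1" using h by blast
    then show False using \<open>\<not> \<bar>c\<bar> \<le> 1\<close> by (cases "c = 0") (auto simp: abs_mult)
  qed
qed

text \<open>The vertices of the closure of the centrally symmetric body \<open>P - P\<close> are \<open>\<plusminus>a \<plusminus> b\<close>;
  for a rectangle they all have the same length.\<close>

lemma is_rectangle_iff:
  assumes "parallelogram a b \<alpha> \<beta>"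
  shows "is_rectangle (open_parallelogram p a b) \<longleftrightarrow> a \<bullet> b = 0"
proof
  interpret parallelogram p a b \<alpha> \<beta> by (rule assms)
  have "a \<noteq> 0" "b \<noteq> 0" using dual by auto
  then show "is_rectangle (open_parallelogram p a b)" if "a \<bullet> b = 0"
    using that by (auto simp: is_rectangle_def orthogonal_def)
  assume "is_rectangle (open_parallelogram p a b)"
  then obtain p' a' b' where r: "a' \<noteq> 0" "b' \<noteq> 0" "a' \<bullet> b' = 0" "P = open_parallelogram p' a' b'"
    by (auto simp: is_rectangle_def orthogonal_def P_eq)
  define \<alpha>' where "\<alpha>' = (1 / (a' \<bullet> a')) *\<^sub>R a'"
  define \<beta>' where "\<beta>' = (1 / (b' \<bullet> b')) *\<^sub>R b'"
  interpret R: parallelogram p' a' b' \<alpha>' \<beta>'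
    using r by unfold_locales (auto simp: \<alpha>'_def \<beta>'_def inner_commute)
  have "{z. \<bar>\<alpha> \<bullet> z\<bar> < 1 \<and> \<bar>\<beta> \<bullet> z\<bar> < 1} = {z. \<bar>\<alpha>' \<bullet> z\<bar> < 1 \<and> \<bar>\<beta>' \<bullet> z\<bar> < 1}"
    using differences_P R.differences_P r(4) by (simp add: R.P_eq)
  then have "\<bar>\<alpha> \<bullet> z\<bar> < 1 \<and> \<bar>\<beta> \<bullet> z\<bar> < 1 \<longleftrightarrow> \<bar>\<alpha>' \<bullet> z\<bar> < 1 \<and> \<bar>\<beta>' \<bullet> z\<bar> < 1" for z by blast
  then have o: "\<bar>r * (\<alpha> \<bullet> z)\<bar> < 1 \<and> \<bar>r * (\<beta> \<bullet> z)\<bar> < 1 \<longleftrightarrow> \<bar>r * (\<alpha>' \<bullet> z)\<bar> < 1 \<and> \<bar>r * (\<beta>' \<bullet> z)\<bar> < 1" for z r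
    by (metis inner_scaleR_right)
  have c: "\<bar>\<alpha> \<bullet> z\<bar> \<le> 1 \<and> \<bar>\<beta> \<bullet> z\<bar> \<le> 1 \<longleftrightarrow> \<bar>\<alpha>' \<bullet> z\<bar> \<le> 1 \<and> \<bar>\<beta>' \<bullet> z\<bar> \<le> 1" for z
    unfolding abs_le_1_iff_scaled using o by meson
  have vertex: "\<bar>\<alpha>' \<bullet> z\<bar> = 1 \<and> \<bar>\<beta>' \<bullet> z\<bar> = 1" if z: "\<bar>\<alpha> \<bullet> z\<bar> = 1" "\<bar>\<beta> \<bullet> z\<bar> = 1" for z
  proof -
    have le: "\<bar>\<alpha>' \<bullet> z\<bar> \<le> 1" "\<bar>\<beta>' \<bullet> z\<bar> \<le> 1" using c[of z] z by auto
    \<comment> \<open>\<open>z\<close> is an extreme point: a segment of the closed body centred at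
      \<open>z\<close> is trivial.\<close>
    have no: "w = 0" if "\<bar>\<alpha> \<bullet> (z + w)\<bar> \<le> 1 \<and> \<bar>\<beta> \<bullet> (z + w)\<bar> \<le> 1" "\<bar>\<alpha> \<bullet> (z - w)\<bar> \<le> 1 \<and> \<bar>\<beta> \<bullet> (z - w)\<bar> \<le> 1" for w
    proof -
      have "\<alpha> \<bullet> w = 0" "\<beta> \<bullet> w = 0" using that z by (auto simp: inner_add_right inner_diff_right abs_if split: if_splits)
      then show ?thesis using expansion[of w] by simp
    qed
    have "\<bar>\<alpha>' \<bullet> z\<bar> = 1"
    proof (rule ccontr)
      assume "\<bar>\<alpha>' \<bullet> z\<bar> \<noteq> 1"
      \<comment> \<open>The slack: under a strict inequality \<open>z\<close> could be moved by
        \<open>\<epsilon> *\<^sub>R a'\<close> in both directions within the closed body, against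
        extremality.\<close>
      define \<epsilon> where "\<epsilon> = 1 - \<bar>\<alpha>' \<bullet> z\<bar>"
      have "\<epsilon> > 0" using le \<open>\<bar>\<alpha>' \<bullet> z\<bar> \<noteq> 1\<close> by (simp add: \<epsilon>_def)
      have "\<epsilon> *\<^sub>R a' = 0"
        by (rule no; subst c) (use le \<open>\<epsilon> > 0\<close> in \<open>auto simp: inner_add_right inner_diff_right R.dual \<epsilon>_def\<close>)
      then show False using \<open>\<epsilon> > 0\<close> r by simp
    qed
    moreover have "\<bar>\<beta>' \<bullet> z\<bar> = 1"
    proof (rule ccontr)
      assume "\<bar>\<beta>' \<bullet> z\<bar> \<noteq> 1"
      define \<epsilon> where "\<epsilon> = 1 - \<bar>\<beta>' \<bullet> z\<bar>"
      have "\<epsilon> > 0" using le \<open>\<bar>\<beta>' \<bullet> z\<bar> \<noteq> 1\<close> by (simp add: \<epsilon>_def)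
      have "\<epsilon> *\<^sub>R b' = 0"
        by (rule no; subst c) (use le \<open>\<epsilon> > 0\<close> in \<open>auto simp: inner_add_right inner_diff_right R.dual \<epsilon>_def\<close>)
      then show False using \<open>\<epsilon> > 0\<close> r by simp
    qed
    ultimately show ?thesis by simp
  qed
  have len: "z \<bullet> z = a' \<bullet> a' + b' \<bullet> b'" if "\<bar>\<alpha> \<bullet> z\<bar> = 1" "\<bar>\<beta> \<bullet> z\<bar> = 1" for z
  proof -
    have z: "z = (\<alpha>' \<bullet> z) *\<^sub>R a' + (\<beta>' \<bullet> z) *\<^sub>R b'" by (rule R.expansion[symmetric])
    have sq: "(\<alpha>' \<bullet> z) * (\<alpha>' \<bullet> z) = 1" "(\<beta>' \<bullet> z) * (\<beta>' \<bullet> z) = 1"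
    proof -
      have "x * x = 1" if "\<bar>x\<bar> = 1" for x :: real using that abs_mult_self_eq[of x] by simp
      then show "(\<alpha>' \<bullet> z) * (\<alpha>' \<bullet> z) = 1" "(\<beta>' \<bullet> z) * (\<beta>' \<bullet> z) = 1"
        using vertex[OF that] by blast+
    qed
    have "(s *\<^sub>R a' + t *\<^sub>R b') \<bullet> (s *\<^sub>R a' + t *\<^sub>R b') = (s * s) * (a' \<bullet> a') + (t * t) * (b' \<bullet> b')" for s t
      using r(3) by (simp add: inner_add_left inner_add_right inner_commute[of b' a'] mult_ac)
    from this[of "\<alpha>' \<bullet> z" "\<beta>' \<bullet> z"] show ?thesis unfolding z[symmetric] sq by simp
  qed
  \<comment> \<open>The two diagonals have equal length, because both are vertices of the closed
    difference body.\<close>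
  have "(a + b) \<bullet> (a + b) = (a - b) \<bullet> (a - b)"
    using len[of "a + b"] len[of "a - b"] by (simp add: inner_add_right inner_diff_right dual)
  then show "a \<bullet> b = 0" by (simp add: inner_add_left inner_add_right inner_diff_left inner_diff_right inner_commute[of b a])
qed

text \<open>Cramer's rule; a vanishing determinant would make \<open>b\<close> equal to its
  projection on the line of \<open>a\<close>.\<close>

lemma dual_basis_exists:
  fixes a b :: "real^2"
  assumes "\<not> collinear {0, a, b}"
  shows "\<exists>\<alpha> \<beta>. parallelogram a b \<alpha> \<beta>"
proof -
  define \<delta> where "\<delta> = a$1 * b$2 - a$2 * b$1"
  have "\<delta> \<noteq> 0"
  proof
    assume "\<delta> = 0"
    have "a \<noteq> 0" using assms by auto
    then have "b = ((a \<bullet> b) / (a \<bullet> a)) *\<^sub>R a"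
    proof -
      have "(a \<bullet> a) *\<^sub>R b = (a \<bullet> b) *\<^sub>R a"
      proof (simp add: vec_eq_iff forall_2 inner_vec_def sum_2, intro conjI)
        show "(a$1 * a$1 + a$2 * a$2) * b$1 = (a$1 * b$1 + a$2 * b$2) * a$1"
          "(a$1 * a$1 + a$2 * a$2) * b$2 = (a$1 * b$1 + a$2 * b$2) * a$2"
          using \<open>\<delta> = 0\<close> unfolding \<delta>_def by algebra+
      qed
      then have "(1 / (a \<bullet> a)) *\<^sub>R ((a \<bullet> a) *\<^sub>R b) = (1 / (a \<bullet> a)) *\<^sub>R ((a \<bullet> b) *\<^sub>R a)" by simp
      then show ?thesis using \<open>a \<noteq> 0\<close> by simp
    qed
    then show False using assms by (metis collinear_lemma)
  qed
  then show ?thesis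
    by (intro exI[of _ "vector [b$2 / \<delta>, - b$1 / \<delta>]"] exI[of _ "vector [- a$2 / \<delta>, a$1 / \<delta>]"])
      (simp add: parallelogram_def inner_vec_def sum_2 \<delta>_def diff_divide_distrib[symmetric] mult.commute)
qed

theorem theorem3p1:
  fixes P :: "(real^2) set" and p a b :: "real^2" and l1 l2 A \<phi> :: real
  assumes nondegenerate: "\<not> collinear {0, a, b}"
    and parallelogram: "P = open_parallelogram p a b"
    and sides: "l1 = norm a" "l2 = norm b" "l1 \<le> l2"
    and area: "A = measure lebesgue P"
    and angle: "\<phi> = angle_between a b"
  shows "neumann_mu P 2 \<le> min (lambda_minus A l1 l2 \<phi>) (eta_minus A l1 l2 \<phi>)
    \<and> neumann_mu P 3 \<le> lambda_plus A l1 l2 \<phi>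
    \<and> (neumann_mu P 2 + neumann_mu P 3) / 2 \<le> pi\<^sup>2 / A\<^sup>2 * ((l1\<^sup>2 + l2\<^sup>2) / 2)
    \<and> (neumann_mu P 2 = min (lambda_minus A l1 l2 \<phi>) (eta_minus A l1 l2 \<phi>)
         \<longleftrightarrow> is_rectangle P)
    \<and> (is_rectangle P \<longrightarrow>
         neumann_mu P 2 = lambda_minus A l1 l2 \<phi> \<and> lambda_minus A l1 l2 \<phi> = pi\<^sup>2 / l2\<^sup>2)
    \<and> (neumann_mu P 3 = lambda_plus A l1 l2 \<phi> \<longleftrightarrow> is_rectangle P \<and> l2 \<le> 2 * l1)
    \<and> ((neumann_mu P 2 + neumann_mu P 3) / 2 = pi\<^sup>2 / A\<^sup>2 * ((l1\<^sup>2 + l2\<^sup>2) / 2)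
         \<longleftrightarrow> is_rectangle P \<and> l2 \<le> 2 * l1)
    \<and> (is_rectangle P \<and> l2 \<le> 2 * l1 \<longrightarrow>
         neumann_mu P 2 = lambda_minus A l1 l2 \<phi> \<and> lambda_minus A l1 l2 \<phi> = pi\<^sup>2 / l2\<^sup>2 \<and>
         neumann_mu P 3 = lambda_plus A l1 l2 \<phi> \<and> lambda_plus A l1 l2 \<phi> = pi\<^sup>2 / l1\<^sup>2)"
proof -
  obtain \<alpha> \<beta> where dual: "parallelogram a b \<alpha> \<beta>"
    using dual_basis_exists[OF nondegenerate] by blast
  interpret Q: parallelogram p a b \<alpha> \<beta> by (rule dual)
  obtain u m where es: "Q.eigensystem 3 u m" using Q.eigensystem3 by blast
  have P: "P = Q.P" using parallelogram Q.P_eq by simp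
  have A: "A = Q.J" using area P Q.measure_P by simp
  have rect: "is_rectangle P \<longleftrightarrow> a \<bullet> b = 0" unfolding parallelogram by (rule is_rectangle_iff[OF dual])
  have sq: "l1\<^sup>2 = a \<bullet> a" "l2\<^sup>2 = b \<bullet> b" using sides by (simp_all add: power2_norm_eq_inner)
  have ne: "a \<noteq> 0" "b \<noteq> 0" using Q.dual by auto
  have lpos: "l1 > 0" "l2 > 0" using sides ne by auto
  have ab_le: "a \<bullet> a \<le> b \<bullet> b" using sides lpos by (simp add: sq[symmetric] power_mono)
  \<comment> \<open>Removes the \<open>arccos\<close>: the bounds contain the angle only through
    this product.\<close>
  have cos: "l1\<^sup>2 * l2\<^sup>2 * (cos \<phi>)\<^sup>2 = (a \<bullet> b)\<^sup>2"
  proof -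
    have "\<bar>(a \<bullet> b) / (norm a * norm b)\<bar> \<le> 1"
      using Cauchy_Schwarz_ineq2[of a b] ne by (simp add: abs_mult divide_le_eq)
    from abs_le_D1[OF this] abs_le_D2[OF this] have "cos \<phi> = (a \<bullet> b) / (l1 * l2)"
      unfolding angle angle_between_def sides by (intro cos_arccos) linarith+
    then show ?thesis using lpos by (simp add: power_divide power_mult_distrib)
  qed
  define Lm Lp H where "Lm = lambda_minus A l1 l2 \<phi>" and "Lp = lambda_plus A l1 l2 \<phi>" and "H = eta_minus A l1 l2 \<phi>"
  define c where "c = pi\<^sup>2 / A\<^sup>2"
  have Apos: "A > 0" using A Q.J_pos by simp
  have cpos: "c > 0" using Apos by (simp add: c_def)
  have di: "\<alpha> \<bullet> \<alpha> = l2\<^sup>2 / A\<^sup>2" "\<alpha> \<bullet> \<beta> = - (a \<bullet> b) / A\<^sup>2" "\<beta> \<bullet> \<beta> = l1\<^sup>2 / A\<^sup>2"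
    using Q.dual_inner by (simp_all add: A sq)
  have args: "pi\<^sup>2 / 2 * (\<alpha> \<bullet> \<alpha>) / (1 / 2) = c * l2\<^sup>2" "(- 2)\<^sup>2 * (\<alpha> \<bullet> \<beta>) / (1 / 2) = c * (- 8 / pi\<^sup>2 * (a \<bullet> b))"
    "pi\<^sup>2 / 2 * (\<beta> \<bullet> \<beta>) / (1 / 2) = c * l1\<^sup>2"
    using Apos by (simp_all add: di c_def)
  have args': "1 * (\<alpha> \<bullet> \<alpha>) / (1 / 12) = 12 / A\<^sup>2 * l2\<^sup>2" "1\<^sup>2 * (\<alpha> \<bullet> \<beta>) / (1 / 12) = 12 / A\<^sup>2 * (- (a \<bullet> b))"
    "1 * (\<beta> \<bullet> \<beta>) / (1 / 12) = 12 / A\<^sup>2 * l1\<^sup>2"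
    by (simp_all add: di)
  \<comment> \<open>\<open>8 / pi^2\<close> is the off-diagonal factor 8 divided by the diagonal
    factor \<open>pi^2\<close>, which \<open>c\<close> absorbs; \<open>4 * (8 / pi^2)^2\<close> is
    the constant \<open>256 / pi^4\<close>.\<close>
  have root: "(l2\<^sup>2 - l1\<^sup>2)\<^sup>2 + 4 * (- 8 / pi\<^sup>2 * (a \<bullet> b))\<^sup>2 =
      (l1\<^sup>2 - l2\<^sup>2)\<^sup>2 + 256 / pi ^ 4 * l1\<^sup>2 * l2\<^sup>2 * (cos \<phi>)\<^sup>2"
    using cos[symmetric] by (simp add: power_mult_distrib power_divide power2_commute[of "l2\<^sup>2"] mult.assoc)
  have root': "(l2\<^sup>2 - l1\<^sup>2)\<^sup>2 + 4 * (- (a \<bullet> b))\<^sup>2 = (l1\<^sup>2 - l2\<^sup>2)\<^sup>2 + 4 * l1\<^sup>2 * l2\<^sup>2 * (cos \<phi>)\<^sup>2"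
    using cos[symmetric] by (simp add: power2_commute[of "l2\<^sup>2"] mult.assoc)
  have Lm_eq: "Lm = c * quadratic_min (l2\<^sup>2) (- 8 / pi\<^sup>2 * (a \<bullet> b)) (l1\<^sup>2)"
    unfolding Lm_def lambda_minus_def quadratic_min_def root c_def by (simp add: add.commute)
  have Lp_eq: "Lp = c * quadratic_max (l2\<^sup>2) (- 8 / pi\<^sup>2 * (a \<bullet> b)) (l1\<^sup>2)"
    unfolding Lp_def lambda_plus_def quadratic_max_def root c_def by (simp add: add.commute)
  have H_eq: "H = 12 / A\<^sup>2 * quadratic_min (l2\<^sup>2) (- (a \<bullet> b)) (l1\<^sup>2)"
  proof -
    have "12 / y * (X / 2) = 6 / y * X" for X y :: real by simp
    then show ?thesis
      unfolding H_def eta_minus_def quadratic_min_def root' by (simp only: add.commute[of "l2\<^sup>2"])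
  qed
  have mu: "neumann_mu P 2 = m 1" "neumann_mu P 3 = m 2"
    unfolding P by (rule Q.mu_2[OF es], rule Q.mu_3[OF es])
  have m1: "m 1 \<le> Lm" "m 1 = Lm \<Longrightarrow> a \<bullet> b = 0"
    using Q.m1_le_cos[OF es] unfolding args Lm_eq quadratic_mult[OF less_imp_le[OF cpos]] by blast+
  have m1H: "m 1 < H"
    using Q.m1_less_linear[OF es] unfolding args' H_eq by (subst (asm) quadratic_mult) auto
  have m2: "m 2 \<le> Lp" "m 2 = Lp \<Longrightarrow> a \<bullet> b = 0"
    using Q.m2_le_cos[OF es] unfolding args Lp_eq quadratic_mult[OF less_imp_le[OF cpos]] by blast+
  \<comment> \<open>The square roots cancel, so the two cosine bounds add up to twice the bound in
    (iii).\<close>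
  have sum: "Lm + Lp = 2 * (c * ((l1\<^sup>2 + l2\<^sup>2) / 2))"
  proof -
    have "(x - r) / 2 + (x + r) / 2 = x" for x r :: real by (simp add: field_simps)
    then show ?thesis
      unfolding Lm_eq Lp_eq quadratic_min_def quadratic_max_def distrib_left[symmetric] by (simp only:) simp
  qed
  have rectangle: "Lm = pi\<^sup>2 / l2\<^sup>2" "Lp = pi\<^sup>2 / l1\<^sup>2" "m 1 = Lm" "m 2 = Lp \<longleftrightarrow> l2 \<le> 2 * l1" if ab: "a \<bullet> b = 0"
  proof -
    have A2: "A\<^sup>2 = l1\<^sup>2 * l2\<^sup>2" using Q.J_square(2) ab by (simp add: A sq)
    have l: "l1\<^sup>2 \<le> l2\<^sup>2" using ab_le by (simp add: sq)
    have "quadratic_min (l2\<^sup>2) (- 8 / pi\<^sup>2 * (a \<bullet> b)) (l1\<^sup>2) = l1\<^sup>2"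
      "quadratic_max (l2\<^sup>2) (- 8 / pi\<^sup>2 * (a \<bullet> b)) (l1\<^sup>2) = l2\<^sup>2"
      using l by (simp_all add: quadratic_min_def quadratic_max_def ab)
    then show L: "Lm = pi\<^sup>2 / l2\<^sup>2" "Lp = pi\<^sup>2 / l1\<^sup>2"
      using lpos by (simp_all add: Lm_eq Lp_eq c_def A2)
    show "m 1 = Lm"
      using Q.rectangle_m1_ge[OF es ab ab_le] m1(1) by (simp add: L sq)
    have ge: "min (pi\<^sup>2 / l1\<^sup>2) (4 * pi\<^sup>2 / l2\<^sup>2) \<le> m 2"
      using Q.rectangle_m2_ge[OF es ab] by (simp add: sq)
    have le: "m 2 \<le> 4 * pi\<^sup>2 / l2\<^sup>2"
      using Q.m2_le_long_side[OF es] lpos by (simp add: di A2)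
    have iff: "pi\<^sup>2 / l1\<^sup>2 \<le> 4 * pi\<^sup>2 / l2\<^sup>2 \<longleftrightarrow> l2 \<le> 2 * l1"
    proof -
      have "pi\<^sup>2 / l1\<^sup>2 \<le> 4 * pi\<^sup>2 / l2\<^sup>2 \<longleftrightarrow> l2\<^sup>2 \<le> (2 * l1)\<^sup>2"
        using lpos by (simp add: divide_simps power_mult_distrib)
      also have "\<dots> \<longleftrightarrow> l2 \<le> 2 * l1" unfolding abs_le_square_iff[symmetric] using lpos by simp
      finally show ?thesis .
    qed
    \<comment> \<open>For \<open>l2 \<le> 2 * l1\<close> the minimum in \<open>ge\<close> is
      \<open>Lp\<close>, namely \<open>pi^2 / l1^2\<close>; otherwise the bound in \<open>le\<close>
      lies strictly below \<open>Lp\<close>.\<close>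
    show "m 2 = Lp \<longleftrightarrow> l2 \<le> 2 * l1"
      using ge le m2(1) iff unfolding L by (auto simp: min_def split: if_splits)
  qed
  \<comment> \<open>A sum of two upper bounds is attained only when each of them is.\<close>
  have goal3: "(m 1 + m 2) / 2 \<le> c * ((l1\<^sup>2 + l2\<^sup>2) / 2)"
    "(m 1 + m 2) / 2 = c * ((l1\<^sup>2 + l2\<^sup>2) / 2) \<longleftrightarrow> m 1 = Lm \<and> m 2 = Lp"
    using m1(1) m2(1) sum by auto
  have ineq2: "m 1 \<le> min Lm H" using m1(1) m1H by simp
  \<comment> \<open>As \<open>m 1 < H\<close> is strict, attaining the minimum means attaining
    \<open>Lm\<close>.\<close>
  have eq2: "m 1 = min Lm H \<longleftrightarrow> a \<bullet> b = 0"
  proof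
    assume "m 1 = min Lm H"
    then have "m 1 = Lm" using m1H by (auto simp: min_def split: if_splits)
    then show "a \<bullet> b = 0" by (rule m1(2))
  next
    assume "a \<bullet> b = 0"
    then show "m 1 = min Lm H" using rectangle(3) m1H by simp
  qed
  have eq3: "m 2 = Lp \<longleftrightarrow> a \<bullet> b = 0 \<and> l2 \<le> 2 * l1"
    using m2(2) rectangle(4) by blast
  have eq23: "m 1 = Lm \<and> m 2 = Lp \<longleftrightarrow> a \<bullet> b = 0 \<and> l2 \<le> 2 * l1"
    using eq3 rectangle(3) by blast
  have val2: "a \<bullet> b = 0 \<longrightarrow> m 1 = Lm \<and> Lm = pi\<^sup>2 / l2\<^sup>2"
    using rectangle(1,3) by blast
  have val23: "a \<bullet> b = 0 \<and> l2 \<le> 2 * l1 \<longrightarrow>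
      m 1 = Lm \<and> Lm = pi\<^sup>2 / l2\<^sup>2 \<and> m 2 = Lp \<and> Lp = pi\<^sup>2 / l1\<^sup>2"
    using val2 eq3 rectangle(2) by blast
  show ?thesis
    unfolding mu rect Lm_def[symmetric] Lp_def[symmetric] H_def[symmetric] c_def[symmetric] goal3(2)
    by (intro conjI ineq2 m2(1) goal3(1) eq2 val2 eq3 eq23 val23)
qed

end
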